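(* Let $\overline{M} = I\,{}_{h}\!\times_{\rho}\mathbb{P}$ be a doubly warped product spacetime with $\rho'\geq 0$ on $I$. Let $\psi:M\to\overline{M}$ be a connected compact spacelike hypersurface whose mean curvature function $H$ in the direction of the future-pointing unit normal satisfies $$H \;\geq\; \mathcal{H}\circ\psi \quad\text{on } M, \qquad \text{where } \mathcal{H}(t,x)=\frac{\rho'(t)}{h(x)\rho(t)} .$$ Then $\psi(M)$ is a spacelike slice, i.e. there is $t_0\in I$ such that $\psi(M)=\{t_0\}\times\mathbb{P}$.
   Context: Manifolds are smooth and without boundary. Let $(\mathbb{P},\sigma)$ be a connected Riemannian manifold of dimension $m$, $I\subseteq\mathbb{R}$ an open interval, and $h\in C^\infty(\mathbb{P})$, $\rho\in C^\infty(I)$ positive functions. The doubly warped product spacetime $\overline{M}=I\,{}_{h}\!\times_{\rho}\mathbb{P}$ is the product $I\times\mathbb{P}$ endowed with the Lorentzian metric $\overline{g}_{(t,x)}=-h(x)^2\,\pi_I^*(\mathrm{d}t^2)+\rho(t)^2\,\pi_{\mathbb{P}}^*(\sigma)$, where $\pi_I,\pi_{\mathbb{P}}$ are the projections onto the factors; it is time-oriented by the timelike vector field $\partial_t=\partial/\partial t$. The sets $\Sigma_t=\{t\}\times\mathbb{P}$, $t\in I$, are called spacelike slices. A spacelike hypersurface $\psi:M\to\overline{M}$ is a smooth immersion of an $m$-dimensional manifold $M$ such that $g=\psi^*\overline{g}$ is a Riemannian metric. There is a unique global unit timelike normal vector field $N$ along $\psi$ with $\overline{g}(N,N)=-1$ and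 $\overline{g}(N,\partial_t)<0$; it is called the future-pointing unit normal. With $\nabla,\overline{\nabla}$ the Levi-Civita connections of $g,\overline{g}$, the second fundamental form is $\mathrm{II}(V,W)=\overline{\nabla}_V W-\nabla_V W$, the mean curvature vector is $\mathbf{H}=\frac{1}{m}\mathrm{trace}_g(\mathrm{II})$, and the mean curvature function in the direction of $N$ is $H=-\overline{g}(\mathbf{H},N)$, so that $\mathbf{H}=HN$. *)

theory Defs
  imports "HOL-Analysis.Analysis"
begin

section \<open>Smooth functions between normed spaces\<close>

text \<open>Both predicates are meant for open sets only.\<close>

primrec C_k_on :: "nat \<Rightarrow> 'a::real_normed_vector set \<Rightarrow> ('a \<Rightarrow> 'b::real_normed_vector) \<Rightarrow> bool" where
  "C_k_on 0 S f \<longleftrightarrow> continuous_on S f"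
| "C_k_on (Suc k) S f \<longleftrightarrow>
     (\<forall>x\<in>S. f differentiable at x) \<and> (\<forall>v. C_k_on k S (\<lambda>x. frechet_derivative f (at x) v))"

definition smooth_on :: "'a::real_normed_vector set \<Rightarrow> ('a \<Rightarrow> 'b::real_normed_vector) \<Rightarrow> bool" where
  "smooth_on S f \<longleftrightarrow> (\<forall>k. C_k_on k S f)"


section \<open>Smooth manifolds\<close>

text \<open>
  A manifold is given by an atlas: a set of charts, each consisting of its domain and its coordinate
  map into the model space. The points of the manifold are the points covered by the charts, with
  the subspace topology of the ambient type. The Hausdorff property and second countability are
  imposed through the sort of the ambient type.
\<close>

type_synonym ('a, 'e) chart = "'a set \<times> ('a \<Rightarrow> 'e)"
type_synonym ('a, 'e) atlas = "('a, 'e) chart set"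

definition chart_dom :: "('a, 'e) chart \<Rightarrow> 'a set" where
  "chart_dom c = fst c"

definition chart_map :: "('a, 'e) chart \<Rightarrow> 'a \<Rightarrow> 'e" where
  "chart_map c = snd c"

definition chart_inv :: "('a, 'e) chart \<Rightarrow> 'e \<Rightarrow> 'a" where
  "chart_inv c = inv_into (chart_dom c) (chart_map c)"

definition points :: "('a, 'e) atlas \<Rightarrow> 'a set" where
  "points M = (\<Union>c\<in>M. chart_dom c)"

definition smooth_manifold :: "('a::topological_space, 'e::euclidean_space) atlas \<Rightarrow> bool" where
  "smooth_manifold M \<longleftrightarrow>
     (\<forall>c\<in>M. openin (top_of_set (points M)) (chart_dom c) \<and>
            open (chart_map c ` chart_dom c) \<and>
            homeomorphism (chart_dom c) (chart_map c ` chart_dom c) (chart_map c) (chart_inv c)) \<and>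
     (\<forall>c\<in>M. \<forall>d\<in>M. smooth_on (chart_map c ` (chart_dom c \<inter> chart_dom d)) (chart_map d \<circ> chart_inv c))"

definition interval_manifold :: "real set \<Rightarrow> (real, real) atlas" where
  "interval_manifold I = {(I, \<lambda>t. t)}"

definition prod_manifold :: "('a, 'e) atlas \<Rightarrow> ('b, 'f) atlas \<Rightarrow> ('a \<times> 'b, 'e \<times> 'f) atlas" where
  "prod_manifold M N =
     {(chart_dom c \<times> chart_dom d, map_prod (chart_map c) (chart_map d)) | c d. c \<in> M \<and> d \<in> N}"

definition smooth_fun_on ::
    "('a, 'e::euclidean_space) atlas \<Rightarrow> 'a set \<Rightarrow> ('a \<Rightarrow> real) \<Rightarrow> bool" where
  "smooth_fun_on M U f \<longleftrightarrow> (\<forall>c\<in>M. smooth_on (chart_map c ` (chart_dom c \<inter> U)) (f \<circ> chart_inv c))"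

definition local_rep ::
    "('a, 'e) chart \<Rightarrow> ('b, 'f) chart \<Rightarrow> ('a \<Rightarrow> 'b) \<Rightarrow> 'e \<Rightarrow> 'f" where
  "local_rep c d F = chart_map d \<circ> F \<circ> chart_inv c"

definition smooth_map ::
    "('a::topological_space, 'e::euclidean_space) atlas \<Rightarrow>
     ('b::topological_space, 'f::euclidean_space) atlas \<Rightarrow> ('a \<Rightarrow> 'b) \<Rightarrow> bool" where
  "smooth_map M N F \<longleftrightarrow>
     continuous_on (points M) F \<and> F ` points M \<subseteq> points N \<and>
     (\<forall>c\<in>M. \<forall>d\<in>N. smooth_on (chart_map c ` (chart_dom c \<inter> F -` chart_dom d)) (local_rep c d F))"


section \<open>Tangent vectors\<close>

text \<open>
  A tangent vector at a point acts on the functions that are smooth near that point, as a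
  directional derivative. By convention it sends every other function to 0, so that tangent vectors
  do not depend on the chart used to write them down.
\<close>

type_synonym 'a tangent = "('a \<Rightarrow> real) \<Rightarrow> real"

definition smooth_near ::
    "('a::topological_space, 'e::euclidean_space) atlas \<Rightarrow> 'a \<Rightarrow> ('a \<Rightarrow> real) \<Rightarrow> bool" where
  "smooth_near M p f \<longleftrightarrow> (\<exists>U. openin (top_of_set (points M)) U \<and> p \<in> U \<and> smooth_fun_on M U f)"

definition coord_tangent ::
    "('a::topological_space, 'e::euclidean_space) atlas \<Rightarrow> ('a, 'e) chart \<Rightarrow> 'a \<Rightarrow> 'e \<Rightarrow> 'a tangent" where
  "coord_tangent M c p v =
     (\<lambda>f. if smooth_near M p f then frechet_derivative (f \<circ> chart_inv c) (at (chart_map c p)) v else 0)"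

definition tangent_space ::
    "('a::topological_space, 'e::euclidean_space) atlas \<Rightarrow> 'a \<Rightarrow> 'a tangent set" where
  "tangent_space M p = {coord_tangent M c p v | c v. c \<in> M \<and> p \<in> chart_dom c}"

definition differential ::
    "('b::topological_space, 'f::euclidean_space) atlas \<Rightarrow> ('a \<Rightarrow> 'b) \<Rightarrow> 'a \<Rightarrow> 'a tangent \<Rightarrow> 'b tangent" where
  "differential N F p X = (\<lambda>f. if smooth_near N (F p) f then X (f \<circ> F) else 0)"

definition immersion ::
    "('a::topological_space, 'e::euclidean_space) atlas \<Rightarrow>
     ('b::topological_space, 'f::euclidean_space) atlas \<Rightarrow> ('a \<Rightarrow> 'b) \<Rightarrow> bool" where
  "immersion M N F \<longleftrightarrow>
     smooth_map M N F \<and> (\<forall>p\<in>points M. inj_on (differential N F p) (tangent_space M p))"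


section \<open>Metrics\<close>

type_synonym 'a metric_field = "'a \<Rightarrow> 'a tangent \<Rightarrow> 'a tangent \<Rightarrow> real"

definition metric_coeff ::
    "('a::topological_space, 'e::euclidean_space) atlas \<Rightarrow> 'a metric_field \<Rightarrow> ('a, 'e) chart \<Rightarrow>
     'e \<Rightarrow> 'e \<Rightarrow> 'e \<Rightarrow> real" where
  "metric_coeff M g c y v w =
     g (chart_inv c y) (coord_tangent M c (chart_inv c y) v) (coord_tangent M c (chart_inv c y) w)"

definition riemannian_metric ::
    "('a::topological_space, 'e::euclidean_space) atlas \<Rightarrow> 'a metric_field \<Rightarrow> bool" where
  "riemannian_metric M g \<longleftrightarrow>
     (\<forall>c\<in>M.
        (\<forall>y\<in>chart_map c ` chart_dom c.
           bilinear (metric_coeff M g c y) \<and>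
           (\<forall>v w. metric_coeff M g c y v w = metric_coeff M g c y w v) \<and>
           (\<forall>v. v \<noteq> 0 \<longrightarrow> metric_coeff M g c y v v > 0)) \<and>
        (\<forall>v w. smooth_on (chart_map c ` chart_dom c) (\<lambda>y. metric_coeff M g c y v w)))"

definition pullback_metric ::
    "('b::topological_space, 'f::euclidean_space) atlas \<Rightarrow> ('a \<Rightarrow> 'b) \<Rightarrow> 'b metric_field \<Rightarrow> 'a metric_field" where
  "pullback_metric N F g p X Y = g (F p) (differential N F p X) (differential N F p Y)"

text \<open>The tensor \<open>dt\<^sup>2\<close> on an interval; \<open>dt(X)\<close> is \<open>X\<close> applied to the identity function.\<close>

definition dt_squared :: "real metric_field" where
  "dt_squared t X Y = X (\<lambda>s. s) * Y (\<lambda>s. s)"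

definition doubly_warped_metric ::
    "real set \<Rightarrow> ('p::topological_space, 'e::euclidean_space) atlas \<Rightarrow> ('p \<Rightarrow> real) \<Rightarrow> (real \<Rightarrow> real) \<Rightarrow>
     'p metric_field \<Rightarrow> (real \<times> 'p) metric_field" where
  "doubly_warped_metric I P h \<rho> \<sigma> z X Y =
     - (h (snd z))\<^sup>2 * pullback_metric (interval_manifold I) fst dt_squared z X Y
     + (\<rho> (fst z))\<^sup>2 * pullback_metric P snd \<sigma> z X Y"

text \<open>The vector field \<open>\<partial>\<^sub>t\<close> on the product of the interval \<open>I\<close> and \<open>P\<close>.\<close>

definition time_vector ::
    "real set \<Rightarrow> ('p::topological_space, 'e::euclidean_space) atlas \<Rightarrow> real \<times> 'p \<Rightarrow> (real \<times> 'p) tangent" where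
  "time_vector I P z =
     (\<lambda>f. if smooth_near (prod_manifold (interval_manifold I) P) z f
          then deriv (\<lambda>s. f (s, snd z)) (fst z) else 0)"


section \<open>Levi-Civita connection\<close>

text \<open>
  For coefficients \<open>G\<close> of a semi-Riemannian metric in a chart, \<open>\<Gamma> = levi_civita_form G y\<close> describes the
  Levi-Civita connection at \<open>y\<close>: for vector fields with coordinate functions \<open>V\<close> and \<open>W\<close>, the
  covariant derivative of \<open>W\<close> along \<open>V\<close> is \<open>DW(V) + \<Gamma>(V, W)\<close>. The conditions below are
  tensoriality of \<open>\<Gamma>\<close>, vanishing torsion, and compatibility with the metric. They determine \<open>\<Gamma>\<close> as
  soon as \<open>G y\<close> is nondegenerate, by lemma \<open>levi_civita_ex1\<close>.
\<close>

definition levi_civita_form ::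
    "('e::euclidean_space \<Rightarrow> 'e \<Rightarrow> 'e \<Rightarrow> real) \<Rightarrow> 'e \<Rightarrow> 'e \<Rightarrow> 'e \<Rightarrow> 'e" where
  "levi_civita_form G y =
     (THE \<Gamma>. bilinear \<Gamma> \<and> (\<forall>v w. \<Gamma> v w = \<Gamma> w v) \<and>
        (\<forall>u v w. frechet_derivative (\<lambda>z. G z v w) (at y) u = G y (\<Gamma> u v) w + G y v (\<Gamma> u w)))"

lemma levi_civita_ex1:
  fixes B :: "'e::euclidean_space \<Rightarrow> 'e \<Rightarrow> real" and D :: "'e \<Rightarrow> 'e \<Rightarrow> 'e \<Rightarrow> real"
  assumes B: "bilinear B" "\<And>v w. B v w = B w v" and nondeg: "\<And>v. (\<And>w. B v w = 0) \<Longrightarrow> v = 0"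
    and D: "\<And>u. bilinear (D u)" "\<And>v w. linear (\<lambda>u. D u v w)" "\<And>u v w. D u v w = D u w v"
  shows "\<exists>!\<Gamma>. bilinear \<Gamma> \<and> (\<forall>v w. \<Gamma> v w = \<Gamma> w v) \<and> (\<forall>u v w. D u v w = B (\<Gamma> u v) w + B v (\<Gamma> u w))"
proof -
  define T where "T u = (\<Sum>b\<in>Basis. B u b *\<^sub>R b)" for u
  define K where "K v w z = (D v w z + D w v z - D z v w) / 2" for v w z
  have linB1: "linear (\<lambda>u. B u w)" and linB2: "linear (\<lambda>u. B w u)" for w
    using B(1) by (simp_all add: bilinear_def)
  have linD1: "linear (\<lambda>v. D u v w)" and linD2: "linear (\<lambda>v. D u w v)" for u w
    using D(1)[of u] by (simp_all add: bilinear_def)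
  have K_add: "K (a + b) w z = K a w z + K b w z" "K w (a + b) z = K w a z + K w b z"
    "K w z (a + b) = K w z a + K w z b" for a b w z
    by (simp_all add: K_def linear_add[OF linD1] linear_add[OF linD2] linear_add[OF D(2)] field_simps)
  have K_scale: "K (r *\<^sub>R a) w z = r *\<^sub>R K a w z" "K w (r *\<^sub>R a) z = r *\<^sub>R K w a z"
    "K w z (r *\<^sub>R a) = r *\<^sub>R K w z a" for r a w z
    by (simp_all add: K_def linear_scale[OF linD1] linear_scale[OF linD2] linear_scale[OF D(2)]
        field_simps)
  have linT: "linear T"
    by (rule linearI)
      (simp_all add: T_def linear_add[OF linB1] linear_scale[OF linB1] scaleR_add_left sum.distrib
        scaleR_sum_right)
  have B_expand: "B u w = T u \<bullet> w" for u w
  proof -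
    have "B u w = B u (\<Sum>b\<in>Basis. (w \<bullet> b) *\<^sub>R b)"
      by (simp add: euclidean_representation)
    also have "\<dots> = (\<Sum>b\<in>Basis. (w \<bullet> b) * B u b)"
      by (simp add: linear_sum[OF linB2] linear_scale[OF linB2])
    also have "\<dots> = T u \<bullet> w"
      by (simp add: T_def inner_sum_left inner_sum_right inner_commute[of _ w] mult.commute)
    finally show ?thesis .
  qed
  have injT: "inj T"
    unfolding linear_injective_0[OF linT] using nondeg by (simp add: B_expand)
  then have surjT: "surj T"
    using linear_injective_imp_surjective linT by blast
  define S where "S = inv T"
  have linS: "linear S"
    unfolding S_def using linT injT by (rule inj_linear_imp_inv_linear)
  have TS: "T (S x) = x" for x
    by (simp add: S_def surjT surj_f_inv_f)
  define \<Gamma> where "\<Gamma> v w = S (\<Sum>b\<in>Basis. K v w b *\<^sub>R b)" for v w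
  have B\<Gamma>: "B (\<Gamma> v w) z = K v w z" for v w z
  proof -
    have "B (\<Gamma> v w) z = (\<Sum>b\<in>Basis. (z \<bullet> b) * K v w b)"
      by (simp add: B_expand \<Gamma>_def TS inner_sum_left inner_sum_right inner_commute[of _ z] mult.commute)
    also have "\<dots> = K v w (\<Sum>b\<in>Basis. (z \<bullet> b) *\<^sub>R b)"
    proof -
      have "linear (K v w)"
        by (rule linearI) (simp_all add: K_add K_scale)
      then show ?thesis
        by (simp add: linear_sum linear_scale)
    qed
    finally show ?thesis
      by (simp add: euclidean_representation)
  qed
  have "bilinear \<Gamma>"
    unfolding bilinear_def
  proof (intro conjI allI linearI)
    show "\<Gamma> x (a + b) = \<Gamma> x a + \<Gamma> x b" for x a b
      by (simp add: \<Gamma>_def K_add scaleR_add_left sum.distrib linear_add[OF linS])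
    show "\<Gamma> (a + b) x = \<Gamma> a x + \<Gamma> b x" for x a b
      by (simp add: \<Gamma>_def K_add scaleR_add_left sum.distrib linear_add[OF linS])
    show "\<Gamma> x (r *\<^sub>R a) = r *\<^sub>R \<Gamma> x a" for x r a
      by (simp add: \<Gamma>_def K_scale linear_scale[OF linS, symmetric] scaleR_sum_right)
    show "\<Gamma> (r *\<^sub>R a) x = r *\<^sub>R \<Gamma> a x" for x r a
      by (simp add: \<Gamma>_def K_scale linear_scale[OF linS, symmetric] scaleR_sum_right)
  qed
  moreover have "\<Gamma> v w = \<Gamma> w v" for v w
    by (simp add: \<Gamma>_def K_def D(3)[of _ v w] add.commute)
  moreover have "D u v w = B (\<Gamma> u v) w + B v (\<Gamma> u w)" for u v w
  proof -
    have "B v (\<Gamma> u w) = K u w v"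
      by (simp only: B(2)[of v] B\<Gamma>)
    then show ?thesis
      using D(3)[of u v w] D(3)[of v u w] D(3)[of w u v] by (simp only: B\<Gamma> K_def) argo
  qed
  moreover have "\<Delta> = \<Gamma>"
    if \<Delta>: "\<And>v w. \<Delta> v w = \<Delta> w v" "\<And>u v w. D u v w = B (\<Delta> u v) w + B v (\<Delta> u w)" for \<Delta>
  proof (intro ext)
    fix v w
    have "B (\<Delta> v w) z = K v w z" for z
    proof -
      have "B v (\<Delta> w z) = B (\<Delta> w z) v" "B w (\<Delta> v z) = B (\<Delta> v z) w"
        "\<Delta> z v = \<Delta> v z" "\<Delta> z w = \<Delta> w z" "\<Delta> w v = \<Delta> v w"
        "B v (\<Delta> z w) = B (\<Delta> z w) v"
        by (fact B(2) \<Delta>(1))+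
      then show ?thesis
        unfolding K_def \<Delta>(2) by (simp only:) argo
    qed
    then have "B (\<Delta> v w - \<Gamma> v w) z = 0" for z
      by (simp add: linear_diff[OF linB1] B\<Gamma>)
    then show "\<Delta> v w = \<Gamma> v w"
      using nondeg[of "\<Delta> v w - \<Gamma> v w"] by simp
  qed
  ultimately show ?thesis
    by (intro ex1I[of _ \<Gamma>]) blast+
qed


section \<open>Mean curvature\<close>

text \<open>
  In charts \<open>c\<close> of \<open>M\<close> and \<open>d\<close> of \<open>N\<close>, this is \<open>II(V, W) = \<nabla>\<^sup>N\<^sub>V W - \<nabla>\<^sup>M\<^sub>V W\<close> at \<open>p\<close> for the coordinate vector
  fields \<open>V\<close>, \<open>W\<close> of \<open>c\<close> with constant components \<open>v\<close>, \<open>w\<close>; it is tensorial in \<open>V\<close> and \<open>W\<close>. Here \<open>\<nabla>\<^sup>M\<close>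
  belongs to the metric induced by \<open>\<psi>\<close>, and the result is given by its components in \<open>d\<close>.
\<close>

definition second_fundamental_form ::
    "('a::topological_space, 'e::euclidean_space) atlas \<Rightarrow> ('b::topological_space, 'f::euclidean_space) atlas \<Rightarrow>
     'b metric_field \<Rightarrow> ('a \<Rightarrow> 'b) \<Rightarrow> ('a, 'e) chart \<Rightarrow> ('b, 'f) chart \<Rightarrow> 'a \<Rightarrow> 'e \<Rightarrow> 'e \<Rightarrow> 'f" where
  "second_fundamental_form M N g \<psi> c d p v w =
     (let F = local_rep c d \<psi>;
          y = chart_map c p;
          DF = (\<lambda>z. frechet_derivative F (at z));
          \<Gamma>M = levi_civita_form (metric_coeff M (pullback_metric N \<psi> g) c) y;
          \<Gamma>N = levi_civita_form (metric_coeff N g d) (F y)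
      in (frechet_derivative (\<lambda>z. DF z w) (at y) v + \<Gamma>N (DF y v) (DF y w)) - DF y (\<Gamma>M v w))"

definition orthonormal_basis :: "('e::euclidean_space \<Rightarrow> 'e \<Rightarrow> real) \<Rightarrow> 'e set \<Rightarrow> bool" where
  "orthonormal_basis G E \<longleftrightarrow>
     independent E \<and> span E = UNIV \<and> (\<forall>e\<in>E. \<forall>f\<in>E. G e f = (if e = f then 1 else 0))"

text \<open>For positive definite \<open>G\<close> and bilinear \<open>B\<close> the choice of the basis does not matter.\<close>

definition metric_trace ::
    "('e::euclidean_space \<Rightarrow> 'e \<Rightarrow> real) \<Rightarrow> ('e \<Rightarrow> 'e \<Rightarrow> 'f::real_vector) \<Rightarrow> 'f" where
  "metric_trace G B = (\<Sum>e\<in>(SOME E. orthonormal_basis G E). B e e)"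

definition mean_curvature_vector ::
    "('a::topological_space, 'e::euclidean_space) atlas \<Rightarrow> ('b::topological_space, 'f::euclidean_space) atlas \<Rightarrow>
     'b metric_field \<Rightarrow> ('a \<Rightarrow> 'b) \<Rightarrow> ('a, 'e) chart \<Rightarrow> ('b, 'f) chart \<Rightarrow> 'a \<Rightarrow> 'b tangent" where
  "mean_curvature_vector M N g \<psi> c d p =
     coord_tangent N d (\<psi> p)
       ((1 / DIM('e)) *\<^sub>R
        metric_trace (metric_coeff M (pullback_metric N \<psi> g) c (chart_map c p))
          (second_fundamental_form M N g \<psi> c d p))"

text \<open>
  \<open>H\<close> is the mean curvature function of \<open>\<psi>\<close> in the direction of \<open>\<nu>\<close>. The mean curvature vector is the same
  in all charts, so a unique such \<open>H\<close> exists on \<open>points M\<close>.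
\<close>

definition mean_curvature_function ::
    "('a::topological_space, 'e::euclidean_space) atlas \<Rightarrow> ('b::topological_space, 'f::euclidean_space) atlas \<Rightarrow>
     'b metric_field \<Rightarrow> ('a \<Rightarrow> 'b) \<Rightarrow> ('a \<Rightarrow> 'b tangent) \<Rightarrow> ('a \<Rightarrow> real) \<Rightarrow> bool" where
  "mean_curvature_function M N g \<psi> \<nu> H \<longleftrightarrow>
     (\<forall>p\<in>points M. \<forall>c\<in>M. \<forall>d\<in>N. p \<in> chart_dom c \<and> \<psi> p \<in> chart_dom d \<longrightarrow>
        H p = - g (\<psi> p) (mean_curvature_vector M N g \<psi> c d p) (\<nu> p))"


section \<open>Spacelike hypersurfaces\<close>

definition spacelike_hypersurface ::
    "('a::topological_space, 'e::euclidean_space) atlas \<Rightarrow> ('b::topological_space, 'f::euclidean_space) atlas \<Rightarrow>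
     'b metric_field \<Rightarrow> ('a \<Rightarrow> 'b) \<Rightarrow> bool" where
  "spacelike_hypersurface M N g \<psi> \<longleftrightarrow>
     smooth_manifold M \<and> DIM('f) = DIM('e) + 1 \<and> immersion M N \<psi> \<and>
     riemannian_metric M (pullback_metric N \<psi> g)"

text \<open>\<open>T\<close> is the vector field that gives the time orientation.\<close>

definition future_unit_normal ::
    "('a::topological_space, 'e::euclidean_space) atlas \<Rightarrow> ('b::topological_space, 'f::euclidean_space) atlas \<Rightarrow>
     'b metric_field \<Rightarrow> ('b \<Rightarrow> 'b tangent) \<Rightarrow> ('a \<Rightarrow> 'b) \<Rightarrow> ('a \<Rightarrow> 'b tangent) \<Rightarrow> bool" where
  "future_unit_normal M N g T \<psi> \<nu> \<longleftrightarrow>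
     (\<forall>p\<in>points M.
        \<nu> p \<in> tangent_space N (\<psi> p) \<and>
        (\<forall>X\<in>tangent_space M p. g (\<psi> p) (\<nu> p) (differential N \<psi> p X) = 0) \<and>
        g (\<psi> p) (\<nu> p) (\<nu> p) = -1 \<and>
        g (\<psi> p) (\<nu> p) (T (\<psi> p)) < 0)"

end

theory Submission
  imports Defs
begin

text \<open>
  Let \<open>\<tau>\<close> be the time coordinate along \<open>\<psi>\<close>. In charts \<open>\<psi>\<close> is \<open>F = (u, f)\<close>, and since \<open>\<nu>\<close> is normal, only
  the second derivatives of \<open>F\<close> and the Levi-Civita connection of the ambient metric enter \<open>H\<close>: the
  connection of the induced metric drops out. Normality of \<open>\<nu> = (b, Y)\<close> also gives \<open>|Y| \<le> C b |Du|\<close> locally,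
  and \<open>\<nu>\<close> being a unit vector gives \<open>1 - 1 / (h b) \<le> C |Du|\<close>. Hence every term of the mean curvature
  other than the second derivatives of \<open>u\<close> and the value \<open>\<rho>' / (h \<rho>)\<close> of a slice is \<open>O(|Du|)\<close>, and the
  assumption on \<open>H\<close> becomes \<open>\<Sum>\<^sub>e D\<^sup>2u(e, e) \<ge> - C |Du|\<close>, where \<open>e\<close> runs over an orthonormal basis of the
  induced metric. By compactness \<open>\<tau>\<close> attains its maximum, so Hopf's strong maximum principle makes it
  constant. Then the projection to \<open>P\<close> is an immersion between spaces of equal dimension, so its image
  is open; as it is also compact, it is all of \<open>P\<close>.
\<close>

section \<open>Calculus of smooth functions\<close>

text \<open>The slice through a point has mean curvature \<open>\<rho>' / (h \<rho>)\<close> there,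
  so the hypersurface is compared, at each of its points, with the slice through that very point.
  The zeroth order terms then cancel, and all that remains must be bounded linearly in |Du|; where
  it is quadratic in Du, a local bound on |Du| absorbs one factor. The resulting inequality makes
  the time coordinate a subsolution, which is why its maximum and not its minimum is used.

  The trace runs over an orthonormal basis picked by \<open>SOME\<close>, which need not vary
  continuously with the point. The maximum principle is therefore stated without a coefficient
  matrix: at each point it asks for some set \<open>E\<close> of vectors obeying ellipticity bounds
  whose constant is uniform in the point. Hopf's argument evaluates the operator at a single point
  only, so this suffices.\<close>

lemma C_k_on_subset: "C_k_on k S f \<Longrightarrow> T \<subseteq> S \<Longrightarrow> C_k_on k T f"
  by (induction k arbitrary: f) (auto intro: continuous_on_subset)

text \<open>Differentiability is not assumed: \<open>f\<close> and \<open>g\<close> have the same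
  derivatives at \<open>x\<close>, so the choice behind \<open>frechet_derivative\<close> is made
  from the same set, be it empty or not.\<close>

lemma frechet_derivative_cong_open:
  assumes "open S" "x \<in> S" "\<And>y. y \<in> S \<Longrightarrow> f y = g y"
  shows "frechet_derivative f (at x) = frechet_derivative g (at x)"
proof -
  have "(f has_derivative D) (at x) \<longleftrightarrow> (g has_derivative D) (at x)" for D
    using assms has_derivative_transform_within_open[of f D x UNIV S g]
      has_derivative_transform_within_open[of g D x UNIV S f] by auto
  then show ?thesis
    by (simp add: frechet_derivative_def)
qed

lemma differentiable_cong_open:
  assumes "f differentiable (at x)" "open S" "x \<in> S" "\<And>y. y \<in> S \<Longrightarrow> f y = g y"
  shows "g differentiable (at x)"
  using assms by (meson differentiable_def has_derivative_transform_within_open)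

lemma C_k_on_cong:
  assumes "open S" "\<And>x. x \<in> S \<Longrightarrow> f x = g x"
  shows "C_k_on k S f \<longleftrightarrow> C_k_on k S g"
  using assms(2)
proof (induction k arbitrary: f g)
  case 0
  then show ?case using continuous_on_cong by fastforce
next
  case (Suc k)
  have 1: "C_k_on k S (\<lambda>x. frechet_derivative f (at x) v) \<longleftrightarrow>
        C_k_on k S (\<lambda>x. frechet_derivative g (at x) v)" for v
    by (intro Suc.IH, subst frechet_derivative_cong_open[OF assms(1) _ Suc.prems]) auto
  have "f differentiable (at x) \<longleftrightarrow> g differentiable (at x)" if "x \<in> S" for x
    using differentiable_cong_open[OF _ assms(1) that, of f g] differentiable_cong_open[OF _ assms(1) that, of g f]
      Suc.prems by auto
  with 1 show ?case by simp
qed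

lemma C_k_on_SucD: "C_k_on (Suc k) S f \<Longrightarrow> C_k_on k S f"
  by (induction k arbitrary: f)
    (auto intro: continuous_at_imp_continuous_on differentiable_imp_continuous_within)

text \<open>Entry point of the rules below: on an open set a derivative in closed form may replace
  \<open>frechet_derivative\<close>, since \<open>C_k_on\<close> depends only on the values
  there.\<close>

lemma C_k_on_Suc_transform:
  assumes "open S" "\<And>x. x \<in> S \<Longrightarrow> (f has_derivative f' x) (at x)" "\<And>v. C_k_on k S (\<lambda>x. f' x v)"
  shows "C_k_on (Suc k) S f"
proof -
  have "frechet_derivative f (at x) = f' x" if "x \<in> S" for x
    using assms(2)[OF that] frechet_derivative_at by metis
  then have "C_k_on k S (\<lambda>x. frechet_derivative f (at x) v)" for v
    using assms(3)[of v] C_k_on_cong[OF assms(1), of "\<lambda>x. frechet_derivative f (at x) v" "\<lambda>x. f' x v" k]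
    by simp
  then show ?thesis
    using assms(2) by (auto simp: differentiable_def)
qed

lemma C_k_on_Suc_derivative:
  "C_k_on (Suc k) S f \<Longrightarrow> x \<in> S \<Longrightarrow> (f has_derivative frechet_derivative f (at x)) (at x)"
  by (simp add: frechet_derivative_works)

lemma C_k_on_const: "open S \<Longrightarrow> C_k_on k S (\<lambda>x. a)"
  by (induction k arbitrary: a)
    (simp, rule C_k_on_Suc_transform[of _ _ "\<lambda>_ _. 0"], auto)

lemma C_k_on_bounded_linear:
  assumes "open S" "bounded_linear L"
  shows "C_k_on k S L"
proof (cases k)
  case 0
  then show ?thesis
    using assms by (simp add: linear_continuous_on)
next
  case (Suc k)
  show ?thesis
    unfolding Suc using assms
    by (intro C_k_on_Suc_transform[of _ _ "\<lambda>_. L"] C_k_on_const bounded_linear_imp_has_derivative)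
qed

lemma C_k_on_add: "open S \<Longrightarrow> C_k_on k S f \<Longrightarrow> C_k_on k S g \<Longrightarrow> C_k_on k S (\<lambda>x. f x + g x)"
proof (induction k arbitrary: f g)
  case 0
  then show ?case by (simp add: continuous_on_add)
next
  case (Suc k)
  show ?case
    by (rule C_k_on_Suc_transform[OF Suc.prems(1)
          has_derivative_add[OF C_k_on_Suc_derivative[OF Suc.prems(2)] C_k_on_Suc_derivative[OF Suc.prems(3)]]])
      (use Suc in auto)
qed

lemma C_k_on_sum:
  "open S \<Longrightarrow> (\<And>i. i \<in> J \<Longrightarrow> C_k_on k S (f i)) \<Longrightarrow> C_k_on k S (\<lambda>x. \<Sum>i\<in>J. f i x)"
  by (induction J rule: infinite_finite_induct) (simp_all add: C_k_on_const C_k_on_add)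

lemma C_k_on_scaleR:
  "open S \<Longrightarrow> C_k_on k S a \<Longrightarrow> C_k_on k S f \<Longrightarrow> C_k_on k S (\<lambda>x. a x *\<^sub>R f x)"
proof (induction k arbitrary: a f)
  case 0
  then show ?case by (simp add: continuous_on_scaleR)
next
  case (Suc k)
  show ?case
  proof (rule C_k_on_Suc_transform[OF Suc.prems(1)
          has_derivative_scaleR[OF C_k_on_Suc_derivative[OF Suc.prems(2)] C_k_on_Suc_derivative[OF Suc.prems(3)]]])
    fix v
    show "C_k_on k S (\<lambda>x. a x *\<^sub>R frechet_derivative f (at x) v + frechet_derivative a (at x) v *\<^sub>R f x)"
      using Suc.prems Suc.prems(2,3)[THEN C_k_on_SucD] by (intro C_k_on_add Suc.IH) auto
  qed
qed

lemma C_k_on_bounded_linear_comp: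
  "open S \<Longrightarrow> bounded_linear L \<Longrightarrow> C_k_on k S f \<Longrightarrow> C_k_on k S (\<lambda>x. L (f x))"
proof (induction k arbitrary: f)
  case 0
  then show ?case
    using continuous_on_compose2[OF linear_continuous_on] by (simp add: bounded_linear.continuous_on)
next
  case (Suc k)
  show ?case
    by (rule C_k_on_Suc_transform[OF Suc.prems(1)
          bounded_linear.has_derivative[OF Suc.prems(2) C_k_on_Suc_derivative[OF Suc.prems(3)]]])
      (use Suc in auto)
qed

text \<open>In the derivative of the composite, \<open>frechet_derivative g\<close> is applied to a
  direction that varies with the point, which the induction hypothesis cannot treat. Expanding this
  direction over \<open>Basis\<close> leaves fixed directions with scalar coefficients, and the
  hypothesis applies to the partial derivatives of \<open>g\<close>.\<close>

lemma C_k_on_compose: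
  fixes F :: "'a::real_normed_vector \<Rightarrow> 'b::euclidean_space"
  assumes S: "open S" and T: "open T"
  shows "C_k_on k S F \<Longrightarrow> C_k_on k T g \<Longrightarrow> F ` S \<subseteq> T \<Longrightarrow> C_k_on k S (\<lambda>x. g (F x))"
proof (induction k arbitrary: g)
  case 0
  then show ?case by (auto intro: continuous_on_compose2)
next
  case (Suc k)
  let ?D = "\<lambda>x v. \<Sum>b\<in>Basis. (frechet_derivative F (at x) v \<bullet> b) *\<^sub>R frechet_derivative g (at (F x)) b"
  show ?case
  proof (rule C_k_on_Suc_transform[OF S, of _ ?D])
    fix x assume "x \<in> S"
    then have g: "(g has_derivative frechet_derivative g (at (F x))) (at (F x))"
      and F: "(F has_derivative frechet_derivative F (at x)) (at x)"
      using C_k_on_Suc_derivative Suc.prems by blast+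
    have l: "linear (frechet_derivative g (at (F x)))"
      using g has_derivative_linear by blast
    have "frechet_derivative g (at (F x)) (frechet_derivative F (at x) v) = ?D x v" for v
      by (subst (1) euclidean_representation[of "frechet_derivative F (at x) v", symmetric])
        (simp add: linear_sum[OF l] linear_scale[OF l])
    then show "((\<lambda>x. g (F x)) has_derivative ?D x) (at x)"
      using has_derivative_compose[OF F g] by simp
  next
    fix v
    have "C_k_on k S (\<lambda>x. frechet_derivative F (at x) v \<bullet> b)" for b
      using Suc.prems by (intro C_k_on_bounded_linear_comp[of _ "\<lambda>w. w \<bullet> b"] S bounded_linear_inner_left) auto
    moreover have "C_k_on k S (\<lambda>x. frechet_derivative g (at (F x)) b)" for b
      using Suc.prems Suc.prems(1)[THEN C_k_on_SucD] by (intro Suc.IH) auto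
    ultimately show "C_k_on k S (\<lambda>x. ?D x v)"
      by (intro C_k_on_sum C_k_on_scaleR S)
  qed
qed

lemma smooth_on_compose:
  fixes F :: "'a::real_normed_vector \<Rightarrow> 'b::euclidean_space"
  assumes "open S" "open T" "smooth_on S F" "smooth_on T g" "F ` S \<subseteq> T"
  shows "smooth_on S (\<lambda>x. g (F x))"
  using assms(3-) C_k_on_compose[OF assms(1,2)] unfolding smooth_on_def by blast

lemma smooth_on_subset: "smooth_on S f \<Longrightarrow> T \<subseteq> S \<Longrightarrow> smooth_on T f"
  unfolding smooth_on_def using C_k_on_subset by blast

lemma smooth_on_cong:
  "open S \<Longrightarrow> (\<And>x. x \<in> S \<Longrightarrow> f x = g x) \<Longrightarrow> smooth_on S f \<longleftrightarrow> smooth_on S g"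
  unfolding smooth_on_def using C_k_on_cong by blast

lemma smooth_on_bounded_linear: "open S \<Longrightarrow> bounded_linear L \<Longrightarrow> smooth_on S L"
  unfolding smooth_on_def using C_k_on_bounded_linear by blast

lemma smooth_on_derivative:
  "smooth_on S f \<Longrightarrow> x \<in> S \<Longrightarrow> (f has_derivative frechet_derivative f (at x)) (at x)"
  unfolding smooth_on_def using C_k_on_Suc_derivative by blast

lemma smooth_on_frechet_derivative:
  "smooth_on S f \<Longrightarrow> smooth_on S (\<lambda>x. frechet_derivative f (at x) v)"
  unfolding smooth_on_def by (metis C_k_on.simps(2))

lemma smooth_on_imp_continuous_on: "smooth_on S f \<Longrightarrow> continuous_on S f"
  unfolding smooth_on_def by (metis C_k_on.simps(1))

lemma smooth_on_eq:
  "open S \<Longrightarrow> smooth_on S f \<Longrightarrow> (\<And>x. x \<in> S \<Longrightarrow> f x = g x) \<Longrightarrow> smooth_on S g"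
  using smooth_on_cong by blast

lemma smooth_on_Pair:
  assumes "open S" "smooth_on S f" "smooth_on S g"
  shows "smooth_on S (\<lambda>x. (f x, g x))"
proof -
  have "C_k_on k S (\<lambda>x. (f x, 0) + (0, g x))" for k
    using assms
    by (intro C_k_on_add C_k_on_bounded_linear_comp[of _ "\<lambda>a. (a, 0)"] C_k_on_bounded_linear_comp[of _ "\<lambda>a. (0, a)"]
        bounded_linear_Pair bounded_linear_ident bounded_linear_zero)
      (auto simp: smooth_on_def)
  then show ?thesis
    by (simp add: smooth_on_def)
qed

section \<open>The strong maximum principle\<close>

text \<open>Along the line through \<open>z\<close> in direction \<open>e\<close> the first
  derivative vanishes at 0. A positive second derivative would make it positive just to the right of
  0, and \<open>f\<close> would rise above its maximum.\<close>

lemma second_derivative_le_0_at_local_max: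
  fixes f :: "'e::real_normed_vector \<Rightarrow> real"
  assumes U: "open U" "z \<in> U" and max: "\<And>y. y \<in> U \<Longrightarrow> f y \<le> f z"
    and df: "\<And>y. y \<in> U \<Longrightarrow> (f has_derivative Df y) (at y)"
    and d2f: "((\<lambda>y. Df y e) has_derivative D2) (at z)"
  shows "D2 e \<le> 0"
proof (rule ccontr)
  assume "\<not> D2 e \<le> 0"
  define g where "g s = f (z + s *\<^sub>R e)" for s
  define g' where "g' s = Df (z + s *\<^sub>R e) e" for s
  have "open ((\<lambda>s. z + s *\<^sub>R e) -` U)"
    using U by (intro open_vimage) (auto intro!: continuous_intros)
  moreover have "0 \<in> (\<lambda>s. z + s *\<^sub>R e) -` U"
    using U by simp
  ultimately obtain r where "r > 0" "ball 0 r \<subseteq> (\<lambda>s. z + s *\<^sub>R e) -` U"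
    using open_contains_ball by blast
  then have r: "r > 0" "\<And>s. \<bar>s\<bar> < r \<Longrightarrow> z + s *\<^sub>R e \<in> U"
    by (auto simp: subset_iff)
  have g: "(g has_real_derivative g' s) (at s)" if "\<bar>s\<bar> < r" for s
  proof -
    have "((\<lambda>s. z + s *\<^sub>R e) has_derivative (\<lambda>s. s *\<^sub>R e)) (at s)"
      by (auto intro!: derivative_eq_intros)
    from has_derivative_compose[OF this df[OF r(2)[OF that]]]
    show ?thesis
      using linear_scale[OF has_derivative_linear[OF df[OF r(2)[OF that]]]]
      by (simp add: g_def[abs_def] g'_def has_field_derivative_def mult_commute_abs)
  qed
  have "((\<lambda>s. z + s *\<^sub>R e) has_derivative (\<lambda>s. s *\<^sub>R e)) (at 0)"
    by (auto intro!: derivative_eq_intros)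
  then have "(g' has_real_derivative D2 e) (at 0)"
    using has_derivative_compose[of "\<lambda>s. z + s *\<^sub>R e" "\<lambda>s. s *\<^sub>R e" 0 UNIV "\<lambda>y. Df y e" D2] d2f
      linear_scale[OF has_derivative_linear[OF d2f]]
    by (simp add: g'_def[abs_def] has_field_derivative_def mult_commute_abs)
  moreover have "g' 0 = 0"
    using differential_zero_maxmin[of z U f "Df z"] U df max by (auto simp: g'_def)
  ultimately obtain d where d: "d > 0" "\<And>s. 0 < s \<Longrightarrow> s < d \<Longrightarrow> 0 < g' s"
    using DERIV_pos_inc_right[of g' "D2 e" 0] \<open>\<not> D2 e \<le> 0\<close> by auto
  define t where "t = min d r / 2"
  have t: "0 < t" "t < d" "t < r"
    using d r by (auto simp: t_def)
  have "g 0 < g t"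
  proof (rule DERIV_pos_imp_increasing_open[OF t(1)])
    show "\<exists>y. (g has_real_derivative y) (at s) \<and> 0 < y" if "0 < s" "s < t" for s
      using that t by (intro exI[of _ "g' s"] conjI g d) auto
    show "continuous_on {0..t} g"
      using t by (intro continuous_at_imp_continuous_on ballI DERIV_isCont[OF g]) auto
  qed
  moreover have "g t \<le> g 0"
    using max[OF r(2)[of t]] t by (simp add: g_def)
  ultimately show False by simp
qed

text \<open>E. Hopf's argument: at a maximum point on the boundary of a ball in which \<open>u\<close> stays below the
  maximum, perturbing \<open>u\<close> by a multiple of \<open>exp (- \<alpha> |y - q|\<^sup>2)\<close> produces an interior maximum that
  violates the differential inequality.\<close>

lemma strong_maximum_principle:
  fixes u :: "'e::euclidean_space \<Rightarrow> real"
  assumes U: "open U" "y0 \<in> U" and max: "\<And>y. y \<in> U \<Longrightarrow> u y \<le> u y0"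
    and du: "\<And>y. y \<in> U \<Longrightarrow> (u has_derivative Du y) (at y)"
    and d2u: "\<And>y v. y \<in> U \<Longrightarrow> ((\<lambda>z. Du z v) has_derivative D2u y v) (at y)"
    and C: "C > 0"
    and ell: "\<And>y N. y \<in> U \<Longrightarrow> 0 \<le> N \<Longrightarrow> (\<And>v. \<bar>Du y v\<bar> \<le> N * norm v) \<Longrightarrow>
      \<exists>E. (\<forall>w. (norm w)\<^sup>2 \<le> C * (\<Sum>e\<in>E. (e \<bullet> w)\<^sup>2)) \<and> (\<Sum>e\<in>E. (norm e)\<^sup>2) \<le> C \<and>
        (\<Sum>e\<in>E. D2u y e e) \<ge> - (C * N)"
  shows "\<exists>r>0. ball y0 r \<subseteq> U \<and> (\<forall>y\<in>ball y0 r. u y = u y0)"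
proof -
  obtain r where r: "r > 0" "cball y0 r \<subseteq> U"
    using U open_contains_cball by blast
  have contu: "continuous_on U u"
    using du by (meson continuous_at_imp_continuous_on has_derivative_continuous)
  have "u q0 = u y0" if q0: "q0 \<in> ball y0 (r / 4)" for q0
  proof (rule ccontr)
    assume ne: "u q0 \<noteq> u y0"
    \<comment> \<open>The point \<open>p\<close> of \<open>A\<close> nearest to \<open>q0\<close>
      lies within r/4 of \<open>q0\<close>, because \<open>y0\<close> belongs to \<open>A\<close>.
      Hence \<open>p\<close> is strictly inside the ball of radius r/2 that cuts out
      \<open>A\<close>.\<close>
    define A where "A = {y \<in> cball y0 (r / 2). u y = u y0}"
    have "continuous_on (cball y0 (r / 2)) u"
      using r by (intro continuous_on_subset[OF contu]) auto
    then have "closed A"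
      unfolding A_def by (rule continuous_closed_preimage_constant) auto
    moreover have "y0 \<in> A"
      using r by (simp add: A_def)
    ultimately obtain p where p: "p \<in> A" "\<And>y. y \<in> A \<Longrightarrow> dist q0 p \<le> dist q0 y"
      using distance_attains_inf[of A q0] by blast
    have q0p: "dist q0 p < r / 4"
      using p(2)[OF \<open>y0 \<in> A\<close>] q0 by (simp add: dist_commute)
    have pr: "dist y0 p < r / 2"
      using q0p q0 dist_triangle[of y0 p q0] by simp
    have "q0 \<noteq> p"
      using ne p by (auto simp: A_def)
    \<comment> \<open>The ball about \<open>q0\<close> through \<open>p\<close> may touch
      \<open>A\<close> in several points. The ball of half the radius about the midpoint is
      internally tangent to it at \<open>p\<close> alone, so on the smaller closed ball
      \<open>u\<close> stays below its maximum except at \<open>p\<close>.\<close>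
    define q where "q = midpoint q0 p"
    define R where "R = dist q0 p / 2"
    have R: "R > 0" "R < r / 8"
      using \<open>q0 \<noteq> p\<close> q0p by (simp_all add: R_def)
    have qp: "dist q p = R" "dist q0 q = R"
      by (simp_all add: q_def R_def dist_midpoint)
    have below: "u y < u y0" if y: "dist q y \<le> R" "y \<noteq> p" for y
    proof -
      have le: "dist q0 y \<le> 2 * R"
        using dist_triangle[of q0 y q] y qp by simp
      then have y0y: "dist y0 y < r / 2"
        using dist_triangle[of y0 y q0] q0 R by simp
      have "y \<notin> A"
      proof
        assume "y \<in> A"
        then have eq: "dist q0 y = 2 * R"
          using p(2)[of y] le by (simp add: R_def)
        \<comment> \<open>Equality in the triangle inequality puts \<open>q\<close> on the segment
          from \<open>q0\<close> to \<open>y\<close>; being its midpoint, it forces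
          \<open>y = p\<close>.\<close>
        then have "dist q0 y = dist q0 q + dist q y"
          using dist_triangle[of q0 y q] y qp by simp
        then have "norm (q0 - q) *\<^sub>R (q - y) = norm (q - y) *\<^sub>R (q0 - q)"
          by (simp add: dist_triangle_eq)
        moreover have "dist q y = R"
          using dist_triangle[of q0 y q] y qp eq by simp
        ultimately have "R *\<^sub>R (q - y) = R *\<^sub>R (q0 - q)"
          using qp by (simp add: dist_norm)
        then have "q - y = q0 - q"
          using R by simp
        then have "y = 2 *\<^sub>R q - q0"
          by (simp add: scaleR_2 algebra_simps)
        then show False
          using y by (simp add: q_def midpoint_def)
      qed
      then have "u y \<noteq> u y0"
        using y0y by (simp add: A_def)
      moreover have "u y \<le> u y0"
        using y0y r by (intro max) auto
      ultimately show ?thesis by simp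
    qed
    \<comment> \<open>With this radius every point of the ball about \<open>p\<close> has distance
      between R/2 and 2R from \<open>q\<close>, so the gradient of the perturbation does not vanish
      there.\<close>
    define s where "s = R / 2"
    have sU: "cball p s \<subseteq> U"
    proof
      fix y assume "y \<in> cball p s"
      then have "dist y0 y \<le> r"
        using dist_triangle[of y0 y p] pr R by (simp add: s_def)
      then show "y \<in> U"
        using r by auto
    qed
    \<comment> \<open>Chosen to contradict
      \<open>2 * \<alpha> * d\<^sup>2 \<le> C\<^sup>2 * (1 + d)\<close>, the inequality reached at
      the end for the distance \<open>d\<close> from \<open>q\<close> to the interior maximum, where
      \<open>R / 2 \<le> d\<close> and \<open>d \<le> 2 * R\<close>.\<close>
    define \<alpha> where "\<alpha> = 2 * C\<^sup>2 * (1 + 2 * R) / R\<^sup>2 + 1"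
    have \<alpha>: "\<alpha> > 0" "\<alpha> * R\<^sup>2 / 2 > C\<^sup>2 * (1 + 2 * R)"
      using R by (simp_all add: \<alpha>_def field_simps add_pos_nonneg)
    define X where "X y = exp (- \<alpha> * ((y - q) \<bullet> (y - q)))" for y
    define K where "K = sphere p s \<inter> cball q R"
    have "compact K"
      by (simp add: K_def compact_Int)
    have "\<exists>\<delta>>0. \<forall>y\<in>K. u y \<le> u y0 - \<delta>"
    proof (cases "K = {}")
      case False
      have "continuous_on K u"
        using sU by (intro continuous_on_subset[OF contu]) (auto simp: K_def)
      then obtain k where k: "k \<in> K" "\<And>y. y \<in> K \<Longrightarrow> u y \<le> u k"
        using continuous_attains_sup[OF \<open>compact K\<close> False] by blast
      have "u k < u y0"
        using k R by (intro below) (auto simp: K_def s_def)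
      then show ?thesis
        using k by (intro exI[of _ "u y0 - u k"]) auto
    qed (auto intro: exI[of _ 1])
    then obtain \<delta> where \<delta>: "\<delta> > 0" "\<And>y. y \<in> K \<Longrightarrow> u y \<le> u y0 - \<delta>"
      by blast
    \<comment> \<open>On \<open>K\<close>, where \<open>u\<close> is at least \<delta> below its
      maximum, the perturbation adds less than \<delta> because X takes values in (0, 1]. On the
      rest of the sphere X is smaller than at \<open>p\<close>, and the perturbation is negative. So
      \<open>\<phi>\<close> is below \<open>u y0\<close> on the whole sphere, but equals it at
      \<open>p\<close>.\<close>
    define \<epsilon> where "\<epsilon> = \<delta> / 2"
    have \<epsilon>: "\<epsilon> > 0"
      using \<delta> by (simp add: \<epsilon>_def)
    define \<phi> where "\<phi> y = u y + \<epsilon> * (X y - X p)" for y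
    have Xdist: "X y = exp (- \<alpha> * (dist q y)\<^sup>2)" for y
      by (simp add: X_def dist_norm norm_minus_commute[of q] flip: power2_norm_eq_inner)
    have sphere: "\<phi> y < u y0" if y: "y \<in> sphere p s" for y
    proof (cases "dist q y \<le> R")
      case True
      then have "u y \<le> u y0 - \<delta>"
        using y by (intro \<delta>) (simp add: K_def)
      moreover have "X y \<le> 1" "0 < X p"
        using \<alpha> by (simp_all add: Xdist)
      then have "\<epsilon> * (X y - X p) < \<delta>"
        using \<epsilon> \<delta> mult_left_mono[of "X y - X p" 1 \<epsilon>] by (simp add: \<epsilon>_def)
      ultimately show ?thesis
        by (simp add: \<phi>_def)
    next
      case False
      then have "(dist q p)\<^sup>2 < (dist q y)\<^sup>2"
        using qp R by (intro power_strict_mono) auto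
      then have "X y < X p"
        using \<alpha> by (simp add: Xdist)
      then have "\<epsilon> * (X y - X p) < 0"
        using \<epsilon> by (simp add: mult_less_0_iff)
      moreover have "u y \<le> u y0"
        using y sU by (intro max) auto
      ultimately show ?thesis
        by (simp add: \<phi>_def)
    qed
    have "continuous_on (cball p s) \<phi>"
      unfolding \<phi>_def X_def by (intro continuous_intros continuous_on_subset[OF contu sU])
    then obtain z where z: "z \<in> cball p s" "\<And>y. y \<in> cball p s \<Longrightarrow> \<phi> y \<le> \<phi> z"
      using continuous_attains_sup[of "cball p s" \<phi>] R by (auto simp: s_def)
    have "\<phi> p = u y0"
      using p by (simp add: \<phi>_def A_def)
    then have "\<phi> z \<ge> u y0"
      using z(2)[of p] R by (simp add: s_def)
    then have zb: "z \<in> ball p s"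
      using sphere[of z] z(1) by (cases "z \<in> sphere p s") auto
    have bU: "y \<in> U" if "y \<in> ball p s" for y
      using that sU by auto
    define DX where "DX y v = X y * (- 2 * \<alpha> * ((y - q) \<bullet> v))" for y v
    have dX: "(X has_derivative DX y) (at y)" for y
      unfolding X_def[abs_def] DX_def
      by (auto intro!: derivative_eq_intros simp: fun_eq_iff inner_commute algebra_simps)
    have d\<phi>: "(\<phi> has_derivative (\<lambda>v. Du y v + \<epsilon> * DX y v)) (at y)" if "y \<in> ball p s" for y
      unfolding \<phi>_def[abs_def] by (auto intro!: derivative_eq_intros du[OF bU[OF that]] dX)
    define D2X where "D2X e v = DX z v * (- 2 * \<alpha> * ((z - q) \<bullet> e)) + X z * (- 2 * \<alpha> * (v \<bullet> e))" for e v
    have d2\<phi>: "((\<lambda>y. Du y e + \<epsilon> * DX y e) has_derivative (\<lambda>v. D2u z e v + \<epsilon> * D2X e v)) (at z)" for e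
      unfolding DX_def[of _ e] D2X_def
      by (rule derivative_eq_intros refl d2u[OF bU[OF zb]] dX)+ (simp add: algebra_simps)
    have grad: "Du z v = \<epsilon> * (X z * (2 * \<alpha> * ((z - q) \<bullet> v)))" for v
    proof -
      have "(\<lambda>v. Du z v + \<epsilon> * DX z v) = (\<lambda>v. 0)"
        by (rule differential_zero_maxmin[OF zb open_ball d\<phi>[OF zb]]) (use z in auto)
      then have "Du z v + \<epsilon> * DX z v = 0"
        by metis
      then show ?thesis by (simp add: DX_def)
    qed
    have hess: "D2u z e e + \<epsilon> * D2X e e \<le> 0" for e
      by (rule second_derivative_le_0_at_local_max[OF open_ball zb _ d\<phi> d2\<phi>]) (use z in auto)
    define d where "d = norm (z - q)"
    \<comment> \<open>At \<open>z\<close> the gradient of \<open>u\<close> is minus that of the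
      perturbation, and \<open>N\<close> is its norm. It carries the same factor
      \<open>\<epsilon> * X z\<close> as the Hessian of the perturbation; this factor cancels, and a
      term of order \<alpha>^2 is left against terms of order \<alpha>.\<close>
    define N where "N = \<epsilon> * (X z * (2 * \<alpha> * d))"
    have Xz: "X z > 0"
      by (simp add: X_def)
    have "N \<ge> 0"
      using \<epsilon> \<alpha> Xz by (simp add: N_def d_def)
    moreover have "\<bar>Du z v\<bar> \<le> N * norm v" for v
    proof -
      have "\<bar>Du z v\<bar> = \<epsilon> * (X z * (2 * \<alpha> * \<bar>(z - q) \<bullet> v\<bar>))"
        using \<epsilon> \<alpha> Xz by (simp add: grad abs_mult)
      also have "\<dots> \<le> \<epsilon> * (X z * (2 * \<alpha> * (d * norm v)))"
        unfolding d_def using \<epsilon> \<alpha> Xz Cauchy_Schwarz_ineq2 by (intro mult_left_mono) auto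
      finally show ?thesis by (simp add: N_def algebra_simps)
    qed
    \<comment> \<open>In turn: the lower and the upper bound for the symbol of the operator that
      sums second derivatives over \<open>E\<close>, and the differential inequality.\<close>
    ultimately obtain E where E: "\<And>w. (norm w)\<^sup>2 \<le> C * (\<Sum>e\<in>E. (e \<bullet> w)\<^sup>2)"
      "(\<Sum>e\<in>E. (norm e)\<^sup>2) \<le> C" "(\<Sum>e\<in>E. D2u z e e) \<ge> - (C * N)"
      using ell[OF bU[OF zb]] by blast
    have "D2X e e = X z * (4 * \<alpha>\<^sup>2 * (e \<bullet> (z - q))\<^sup>2 - 2 * \<alpha> * (norm e)\<^sup>2)" for e
      unfolding power2_norm_eq_inner
      by (simp add: D2X_def DX_def inner_commute power2_eq_square algebra_simps)
    then have "(\<Sum>e\<in>E. D2X e e) =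
        X z * (4 * \<alpha>\<^sup>2 * (\<Sum>e\<in>E. (e \<bullet> (z - q))\<^sup>2) - 2 * \<alpha> * (\<Sum>e\<in>E. (norm e)\<^sup>2))"
      by (simp add: sum_subtractf sum_distrib_left[symmetric])
    moreover have "\<epsilon> * (\<Sum>e\<in>E. D2X e e) \<le> C * N"
    proof -
      have "(\<Sum>e\<in>E. D2u z e e) + \<epsilon> * (\<Sum>e\<in>E. D2X e e) \<le> 0"
        using sum_nonpos[of E "\<lambda>e. D2u z e e + \<epsilon> * D2X e e"] hess
        by (simp add: sum.distrib sum_distrib_left)
      then show ?thesis
        using E(3) by linarith
    qed
    ultimately have "\<epsilon> * (X z * (4 * \<alpha>\<^sup>2 * (\<Sum>e\<in>E. (e \<bullet> (z - q))\<^sup>2) - 2 * \<alpha> * (\<Sum>e\<in>E. (norm e)\<^sup>2)))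
        \<le> \<epsilon> * (X z * (C * (2 * \<alpha> * d)))"
      by (simp only: N_def ac_simps)
    then have "4 * \<alpha>\<^sup>2 * (\<Sum>e\<in>E. (e \<bullet> (z - q))\<^sup>2) - 2 * \<alpha> * (\<Sum>e\<in>E. (norm e)\<^sup>2) \<le> C * (2 * \<alpha> * d)"
      using \<epsilon> Xz by simp
    moreover have "2 * \<alpha> * (\<Sum>e\<in>E. (norm e)\<^sup>2) \<le> 2 * \<alpha> * C"
      using \<alpha> E(2) by simp
    ultimately have "2 * \<alpha> * (2 * \<alpha> * (\<Sum>e\<in>E. (e \<bullet> (z - q))\<^sup>2)) \<le> 2 * \<alpha> * (C * (1 + d))"
      by (simp add: power2_eq_square algebra_simps)
    then have "2 * \<alpha> * (\<Sum>e\<in>E. (e \<bullet> (z - q))\<^sup>2) \<le> C * (1 + d)"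
      using \<alpha> by simp
    then have "C * (2 * \<alpha> * (\<Sum>e\<in>E. (e \<bullet> (z - q))\<^sup>2)) \<le> C * (C * (1 + d))"
      using C by (intro mult_left_mono) auto
    moreover have "2 * \<alpha> * d\<^sup>2 \<le> 2 * \<alpha> * (C * (\<Sum>e\<in>E. (e \<bullet> (z - q))\<^sup>2))"
      using E(1)[of "z - q"] \<alpha> by (simp add: d_def)
    ultimately have "2 * \<alpha> * d\<^sup>2 \<le> C\<^sup>2 * (1 + d)"
      by (simp add: power2_eq_square algebra_simps)
    have "R \<le> d + s" "d \<le> R + s"
      using dist_triangle[of q p z] dist_triangle[of q z p] zb qp
      by (simp_all add: d_def dist_norm norm_minus_commute)
    then have d: "R / 2 \<le> d" "d \<le> 2 * R"
      using R by (simp_all add: s_def)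
    have "(R / 2)\<^sup>2 \<le> d\<^sup>2"
      using d R by (intro power_mono) auto
    then have "2 * \<alpha> * (R / 2)\<^sup>2 \<le> 2 * \<alpha> * d\<^sup>2"
      using \<alpha> by simp
    then have "\<alpha> * R\<^sup>2 / 2 \<le> 2 * \<alpha> * d\<^sup>2"
      by (simp add: power2_eq_square ac_simps)
    moreover have "C\<^sup>2 * (1 + d) \<le> C\<^sup>2 * (1 + 2 * R)"
      using d by (intro mult_left_mono) auto
    ultimately show False
      using \<open>2 * \<alpha> * d\<^sup>2 \<le> C\<^sup>2 * (1 + d)\<close> \<alpha>(2) by linarith
  qed
  moreover have "ball y0 (r / 4) \<subseteq> U" "r / 4 > 0"
    using r by (auto simp: subset_iff)
  ultimately show ?thesis
    by blast
qed

section \<open>Bounds on compact sets and orthonormal bases\<close>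

text \<open>The weight \<open>n i\<close> allows iteration: for a multilinear map the other
  arguments are moved into the index \<open>i\<close>, and \<open>n i\<close> becomes the product of
  their norms.\<close>

lemma linear_family_bound:
  fixes L :: "'i \<Rightarrow> 'a::euclidean_space \<Rightarrow> 'b::real_normed_vector"
  assumes lin: "\<And>i. i \<in> J \<Longrightarrow> linear (L i)"
    and bd: "\<And>b. b \<in> Basis \<Longrightarrow> \<exists>C. \<forall>i\<in>J. norm (L i b) \<le> C * n i"
    and n: "\<And>i. i \<in> J \<Longrightarrow> 0 \<le> n i"
  shows "\<exists>C. \<forall>i\<in>J. \<forall>v. norm (L i v) \<le> C * (norm v * n i)"
proof -
  obtain C where C: "\<And>b i. b \<in> Basis \<Longrightarrow> i \<in> J \<Longrightarrow> norm (L i b) \<le> C b * n i"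
    using bd by metis
  have "norm (L i v) \<le> (\<Sum>b\<in>Basis. C b) * (norm v * n i)" if i: "i \<in> J" for i v
  proof -
    have "norm (L i v) = norm (\<Sum>b\<in>Basis. (v \<bullet> b) *\<^sub>R L i b)"
      by (subst (1) euclidean_representation[of v, symmetric])
        (simp add: linear_sum[OF lin[OF i]] linear_scale[OF lin[OF i]])
    also have "\<dots> \<le> (\<Sum>b\<in>Basis. norm v * (C b * n i))"
    proof (rule sum_norm_le)
      fix b :: 'a assume b: "b \<in> Basis"
      show "norm ((v \<bullet> b) *\<^sub>R L i b) \<le> norm v * (C b * n i)"
        using Basis_le_norm[OF b, of v] C[OF b i] by (simp add: mult_mono)
    qed
    finally show ?thesis
      by (simp add: sum_distrib_left sum_distrib_right ac_simps)
  qed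
  then show ?thesis by blast
qed

text \<open>The form \<open>C * 1\<close> matches premise \<open>bd\<close> of
  \<open>linear_family_bound\<close> for the constant weight 1.\<close>

lemma continuous_bounded_on_compact:
  fixes f :: "'a::topological_space \<Rightarrow> 'b::real_normed_vector"
  assumes "compact K" "continuous_on K f"
  shows "\<exists>C. \<forall>y\<in>K. norm (f y) \<le> C * 1"
  using compact_imp_bounded[OF compact_continuous_image[OF assms(2,1)]]
  by (auto simp: bounded_iff)

lemma linear_family_bound_compact:
  fixes L :: "'i::topological_space \<Rightarrow> 'a::euclidean_space \<Rightarrow> 'b::real_normed_vector"
  assumes K: "compact K" and lin: "\<And>i. i \<in> K \<Longrightarrow> linear (L i)"
    and cont: "\<And>b. continuous_on K (\<lambda>i. L i b)"
  shows "\<exists>C. \<forall>i\<in>K. \<forall>v. norm (L i v) \<le> C * norm v"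
  using linear_family_bound[of K L "\<lambda>_. 1"] lin continuous_bounded_on_compact[OF K cont] by auto

lemma bilinear_family_bound_compact:
  fixes B :: "'i::topological_space \<Rightarrow> 'a::euclidean_space \<Rightarrow> 'b::euclidean_space \<Rightarrow> 'c::real_normed_vector"
  assumes K: "compact K" and lin: "\<And>i. i \<in> K \<Longrightarrow> bilinear (B i)"
    and cont: "\<And>b c. continuous_on K (\<lambda>i. B i b c)"
  shows "\<exists>C. \<forall>i\<in>K. \<forall>v w. norm (B i v w) \<le> C * (norm v * norm w)"
proof -
  have 1: "\<exists>C. \<forall>i\<in>K. \<forall>w. norm (B i b w) \<le> C * norm w" for b
    using linear_family_bound_compact[OF K, of "\<lambda>i. B i b"] lin cont by (simp add: bilinear_def)
  have "\<exists>C. \<forall>p\<in>K \<times> UNIV. \<forall>v. norm (B (fst p) v (snd p)) \<le> C * (norm v * norm (snd p))"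
    using lin 1 by (intro linear_family_bound) (auto simp: bilinear_def)
  then show ?thesis by auto
qed

lemma trilinear_family_bound_compact:
  fixes T :: "'i::topological_space \<Rightarrow> 'a::euclidean_space \<Rightarrow> 'b::euclidean_space \<Rightarrow> 'c::euclidean_space \<Rightarrow>
    'd::real_normed_vector"
  assumes K: "compact K" and lin: "\<And>i u. i \<in> K \<Longrightarrow> bilinear (T i u)"
    and lin1: "\<And>i v w. i \<in> K \<Longrightarrow> linear (\<lambda>u. T i u v w)"
    and cont: "\<And>a b c. continuous_on K (\<lambda>i. T i a b c)"
  shows "\<exists>C. \<forall>i\<in>K. \<forall>u v w. norm (T i u v w) \<le> C * (norm u * (norm v * norm w))"
proof -
  have 1: "\<exists>C. \<forall>i\<in>K. \<forall>v w. norm (T i b v w) \<le> C * (norm v * norm w)" for b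
    using bilinear_family_bound_compact[OF K, of "\<lambda>i. T i b"] lin cont by simp
  have "\<exists>C. \<forall>p\<in>K \<times> UNIV. \<forall>u. norm (T (fst p) u (fst (snd p)) (snd (snd p))) \<le>
      C * (norm u * (norm (fst (snd p)) * norm (snd (snd p))))"
    using lin1 1 by (intro linear_family_bound) auto
  then obtain C where C: "\<forall>p\<in>K \<times> UNIV. \<forall>u. norm (T (fst p) u (fst (snd p)) (snd (snd p))) \<le>
      C * (norm u * (norm (fst (snd p)) * norm (snd (snd p))))"
    by blast
  then have "norm (T i u v w) \<le> C * (norm u * (norm v * norm w))" if "i \<in> K" for i u v w
    using that C[rule_format, of "(i, v, w)" u] by simp
  then show ?thesis by blast
qed

text \<open>The constant is the minimum over the product of \<open>K\<close> with the unit sphere;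
  homogeneity carries it over to all vectors.\<close>

lemma positive_definite_family_bound_compact:
  fixes B :: "'i::topological_space \<Rightarrow> 'a::euclidean_space \<Rightarrow> 'a \<Rightarrow> real"
  assumes K: "compact K" and lin: "\<And>i. i \<in> K \<Longrightarrow> bilinear (B i)"
    and cont: "\<And>b c. continuous_on K (\<lambda>i. B i b c)"
    and pos: "\<And>i v. i \<in> K \<Longrightarrow> v \<noteq> 0 \<Longrightarrow> 0 < B i v v"
  shows "\<exists>c>0. \<forall>i\<in>K. \<forall>v. c * (norm v)\<^sup>2 \<le> B i v v"
proof (cases "K = {}")
  case False
  let ?S = "K \<times> sphere (0::'a) 1"
  \<comment> \<open>Only the entries for fixed arguments are known to be continuous. Expansion in
    coordinates yields continuity jointly in index and vector.\<close>
  let ?f = "\<lambda>p. \<Sum>b\<in>Basis. \<Sum>c\<in>Basis. (snd p \<bullet> b) * (snd p \<bullet> c) * B (fst p) b c"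
  have f: "?f (i, v) = B i v v" if "i \<in> K" for i v
  proof -
    have l: "linear (\<lambda>u. B i u w)" "linear (B i w)" for w
      using lin[OF that] by (auto simp: bilinear_def)
    have "B i v v = B i (\<Sum>b\<in>Basis. (v \<bullet> b) *\<^sub>R b) (\<Sum>c\<in>Basis. (v \<bullet> c) *\<^sub>R c)"
      by (simp add: euclidean_representation)
    also have "\<dots> = (\<Sum>b\<in>Basis. \<Sum>c\<in>Basis. (v \<bullet> b) * (v \<bullet> c) * B i b c)"
      by (simp only: linear_sum[OF l(1)] linear_scale[OF l(1)] linear_sum[OF l(2)] linear_scale[OF l(2)]
          scaleR_sum_right real_scaleR_def mult.assoc) (subst sum.swap, simp add: sum_distrib_left mult.left_commute)
    finally show ?thesis by simp
  qed
  have "continuous_on ?S (\<lambda>p. B (fst p) b c)" for b c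
    by (rule continuous_on_compose2[OF cont continuous_on_fst[OF continuous_on_id]]) auto
  then have "continuous_on ?S ?f"
    by (intro continuous_intros)
  moreover have "compact ?S"
    using K by (intro compact_Times) auto
  moreover have "?S \<noteq> {}"
    using False by simp
  ultimately obtain p where p: "p \<in> ?S" "\<And>q. q \<in> ?S \<Longrightarrow> ?f p \<le> ?f q"
    using continuous_attains_inf[of ?S ?f] by blast
  have "fst p \<in> K" "snd p \<noteq> 0"
    using p(1) by auto
  then have "?f p > 0"
    using f[of "fst p" "snd p"] pos[of "fst p" "snd p"] by simp
  moreover have "?f p * (norm v)\<^sup>2 \<le> B i v v" if i: "i \<in> K" for i v
  proof (cases "v = 0")
    case True
    then show ?thesis
      using bilinear_lzero[OF lin[OF i]] by simp
  next
    case False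
    define w where "w = (1 / norm v) *\<^sub>R v"
    have v: "v = norm v *\<^sub>R w"
      using False by (simp add: w_def)
    have "?f p \<le> B i w w"
      using p(2)[of "(i, w)"] f[OF i, of w] i False by (simp add: w_def)
    then have "?f p * (norm v)\<^sup>2 \<le> (norm v)\<^sup>2 * B i w w"
      by (subst mult.commute) (rule mult_left_mono, simp_all)
    also have "\<dots> = B i (norm v *\<^sub>R w) (norm v *\<^sub>R w)"
      using lin[OF i] by (simp only: bilinear_lmul bilinear_rmul) (simp add: power2_eq_square)
    finally show ?thesis
      using v by simp
  qed
  ultimately show ?thesis by blast
qed (auto intro: exI[of _ 1])

section \<open>Orthonormal bases of inner products\<close>

lemma orthonormal_imp_independent:
  fixes G :: "'e::euclidean_space \<Rightarrow> 'e \<Rightarrow> real"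
  assumes "bilinear G" "finite E" "\<And>e f. e \<in> E \<Longrightarrow> f \<in> E \<Longrightarrow> G e f = (if e = f then 1 else 0)"
  shows "independent E"
proof
  assume "dependent E"
  then obtain c a where c: "(\<Sum>e\<in>E. c e *\<^sub>R e) = 0" "a \<in> E" "c a \<noteq> 0"
    using dependent_finite[OF assms(2)] by blast
  have l: "linear (\<lambda>u. G u a)"
    using assms(1) by (simp add: bilinear_def)
  have "0 = G (\<Sum>e\<in>E. c e *\<^sub>R e) a"
    using linear_0[OF l] by (simp add: c)
  also have "\<dots> = (\<Sum>e\<in>E. c e * G e a)"
    by (simp add: linear_sum[OF l] linear_scale[OF l])
  also have "\<dots> = (\<Sum>e\<in>E. if e = a then c e else 0)"
    using assms(3) c by (intro sum.cong) auto
  also have "\<dots> = c a"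
    using c assms(2) by simp
  finally show False
    using c by simp
qed

text \<open>Orthonormal sets are independent, hence bounded in size, so one of greatest cardinality
  exists. It spans: a vector outside its span, minus its projection and normalised, could be
  added.\<close>

lemma orthonormal_basis_exists:
  fixes G :: "'e::euclidean_space \<Rightarrow> 'e \<Rightarrow> real"
  assumes bil: "bilinear G" and sym: "\<And>v w. G v w = G w v" and pos: "\<And>v. v \<noteq> 0 \<Longrightarrow> G v v > 0"
  shows "\<exists>E. orthonormal_basis G E"
proof -
  let ?ON = "\<lambda>E. finite E \<and> (\<forall>e\<in>E. \<forall>f\<in>E. G e f = (if e = f then 1 else 0))"
  have ind: "independent E" if "?ON E" for E
    using orthonormal_imp_independent[OF bil] that by blast
  have "\<exists>E. ?ON E \<and> (\<forall>E'. ?ON E' \<longrightarrow> card E' \<le> card E)"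
  proof (rule Lattices_Big.ex_has_greatest_nat[of ?ON "{}" card "DIM('e) + 1"])
    show "\<forall>E. ?ON E \<longrightarrow> card E < DIM('e) + 1"
      using independent_bound[OF ind] by (simp add: less_Suc_eq_le)
  qed simp
  then obtain E where E: "?ON E" "\<And>E'. ?ON E' \<Longrightarrow> card E' \<le> card E"
    by blast
  have "span E = UNIV"
  proof (rule ccontr)
    assume "span E \<noteq> UNIV"
    then obtain v where v: "v \<notin> span E"
      by blast
    define w where "w = v - (\<Sum>e\<in>E. G v e *\<^sub>R e)"
    have "(\<Sum>e\<in>E. G v e *\<^sub>R e) \<in> span E"
      by (intro span_sum span_scale span_base)
    then have w: "w \<notin> span E"
      using v unfolding w_def by (metis diff_add_cancel span_add)
    then have "w \<noteq> 0"
      using span_zero by metis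
    have we: "G w f = 0" if f: "f \<in> E" for f
    proof -
      have l: "linear (\<lambda>u. G u f)"
        using bil by (simp add: bilinear_def)
      have "G w f = G v f - (\<Sum>e\<in>E. G v e * G e f)"
        by (simp add: w_def linear_diff[OF l] linear_sum[OF l] linear_scale[OF l])
      also have "(\<Sum>e\<in>E. G v e * G e f) = (\<Sum>e\<in>E. if e = f then G v e else 0)"
        using E f by (intro sum.cong) auto
      finally show ?thesis
        using E f by simp
    qed
    define g where "g = (1 / sqrt (G w w)) *\<^sub>R w"
    have sq: "sqrt (G w w) * sqrt (G w w) = G w w" "sqrt (G w w) > 0"
      using pos[OF \<open>w \<noteq> 0\<close>] by simp_all
    have "g \<notin> span E"
    proof
      assume "g \<in> span E"
      then have "sqrt (G w w) *\<^sub>R g \<in> span E"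
        by (rule span_scale)
      then show False
        using w sq by (simp add: g_def)
    qed
    then have "g \<notin> E"
      using span_base by blast
    have "G g g = 1"
      using sq bil by (simp add: g_def bilinear_lmul bilinear_rmul)
    moreover have "G g f = 0" "G f g = 0" if "f \<in> E" for f
      using we[OF that] sym[of f g] bil by (simp_all add: g_def bilinear_lmul)
    ultimately have "?ON (insert g E)"
      using E(1) by auto
    then have "card (insert g E) \<le> card E"
      by (rule E(2))
    then show False
      using E(1) \<open>g \<notin> E\<close> by simp
  qed
  then show ?thesis
    using E(1) ind[OF E(1)] by (auto simp: orthonormal_basis_def)
qed

lemma orthonormal_basis_finite_card:
  fixes E :: "'e::euclidean_space set"
  assumes "orthonormal_basis G E"
  shows "finite E" "card E = DIM('e)"
proof -
  have E: "independent E" "span E = UNIV"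
    using assms by (auto simp: orthonormal_basis_def)
  show "finite E"
    using E(1) independent_bound by blast
  show "card E = DIM('e)"
    using dim_eq_card_independent[OF E(1)] E(2) dim_span[of E] by (simp add: dim_UNIV)
qed

text \<open>For w = \<Sum> c_e e, Cauchy-Schwarz is applied to |w|^2 = \<Sum> c_e (e \<bullet> w),
  and \<Sum> c_e^2 = G w w is at most L |w|^2. This supplies the lower ellipticity bound for
  \<open>strong_maximum_principle\<close>.\<close>

lemma norm_le_sum_orthonormal_basis:
  fixes G :: "'e::euclidean_space \<Rightarrow> 'e \<Rightarrow> real"
  assumes bil: "bilinear G" and sym: "\<And>v w. G v w = G w v" and E: "orthonormal_basis G E"
    and G: "\<And>v. G v v \<le> L * (norm v)\<^sup>2"
  shows "(norm w)\<^sup>2 \<le> L * (\<Sum>e\<in>E. (e \<bullet> w)\<^sup>2)"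
proof -
  have fin: "finite E"
    using orthonormal_basis_finite_card[OF E] by simp
  have "w \<in> span E"
    using E by (simp add: orthonormal_basis_def)
  then obtain c where w: "w = (\<Sum>e\<in>E. c e *\<^sub>R e)"
    using span_finite[OF fin] by auto
  have l: "linear (\<lambda>u. G u v)" "linear (G v)" for v
    using bil by (auto simp: bilinear_def)
  have Gwe: "G w f = c f" if "f \<in> E" for f
  proof -
    have "G w f = (\<Sum>e\<in>E. c e * G e f)"
      unfolding w by (simp add: linear_sum[OF l(1)] linear_scale[OF l(1)])
    also have "\<dots> = (\<Sum>e\<in>E. if e = f then c e else 0)"
      using E that by (intro sum.cong) (auto simp: orthonormal_basis_def)
    finally show ?thesis
      using fin that by simp
  qed
  have "G w w = (\<Sum>e\<in>E. c e * G w e)"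
    by (subst (2) w) (simp add: linear_sum[OF l(2)] linear_scale[OF l(2)])
  also have "\<dots> = (\<Sum>e\<in>E. (c e)\<^sup>2)"
    by (intro sum.cong) (simp_all add: Gwe power2_eq_square)
  finally have c: "(\<Sum>e\<in>E. (c e)\<^sup>2) \<le> L * (norm w)\<^sup>2"
    using G[of w] by simp
  have "(norm w)\<^sup>2 = (\<Sum>e\<in>E. c e * (e \<bullet> w))"
    unfolding power2_norm_eq_inner by (subst (1) w) (simp add: inner_sum_left)
  then have "((norm w)\<^sup>2)\<^sup>2 \<le> (\<Sum>e\<in>E. (c e)\<^sup>2) * (\<Sum>e\<in>E. (e \<bullet> w)\<^sup>2)"
    using Cauchy_Schwarz_ineq_sum[of c "\<lambda>e. e \<bullet> w" E] by simp
  also have "\<dots> \<le> L * (norm w)\<^sup>2 * (\<Sum>e\<in>E. (e \<bullet> w)\<^sup>2)"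
    by (intro mult_right_mono c sum_nonneg) auto
  finally have *: "(norm w)\<^sup>2 * (norm w)\<^sup>2 \<le> (norm w)\<^sup>2 * (L * (\<Sum>e\<in>E. (e \<bullet> w)\<^sup>2))"
    by (simp add: power2_eq_square ac_simps)
  show ?thesis
  proof (cases "w = 0")
    case True
    then show ?thesis by simp
  next
    case False
    then show ?thesis
      using mult_left_le_imp_le[OF *] by simp
  qed
qed

section \<open>The Levi-Civita connection of a warped metric\<close>

lemma linear_frechet_derivative_family:
  fixes L :: "'a::real_normed_vector \<Rightarrow> 'b::real_vector \<Rightarrow> 'c::real_normed_vector"
  assumes S: "open S" "y \<in> S" and lin: "\<And>z. z \<in> S \<Longrightarrow> linear (L z)"
    and diff: "\<And>v. (\<lambda>z. L z v) differentiable (at y)"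
  shows "linear (\<lambda>v. frechet_derivative (\<lambda>z. L z v) (at y) u)"
proof (rule linearI)
  have d: "((\<lambda>z. L z v) has_derivative frechet_derivative (\<lambda>z. L z v) (at y)) (at y)" for v
    using diff by (simp add: frechet_derivative_works)
  fix v w
  have "frechet_derivative (\<lambda>z. L z (v + w)) (at y) = frechet_derivative (\<lambda>z. L z v + L z w) (at y)"
    using linear_add[OF lin] by (intro frechet_derivative_cong_open[OF S]) simp
  also have "\<dots> = (\<lambda>u. frechet_derivative (\<lambda>z. L z v) (at y) u + frechet_derivative (\<lambda>z. L z w) (at y) u)"
    by (rule frechet_derivative_at[symmetric, OF has_derivative_add[OF d d]])
  finally show "frechet_derivative (\<lambda>z. L z (v + w)) (at y) u =
      frechet_derivative (\<lambda>z. L z v) (at y) u + frechet_derivative (\<lambda>z. L z w) (at y) u"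
    by metis
  fix r
  have "frechet_derivative (\<lambda>z. L z (r *\<^sub>R v)) (at y) = frechet_derivative (\<lambda>z. r *\<^sub>R L z v) (at y)"
    using linear_scale[OF lin] by (intro frechet_derivative_cong_open[OF S]) simp
  also have "\<dots> = (\<lambda>u. r *\<^sub>R frechet_derivative (\<lambda>z. L z v) (at y) u)"
    by (rule frechet_derivative_at[symmetric, OF has_derivative_scaleR_right[OF d]])
  finally show "frechet_derivative (\<lambda>z. L z (r *\<^sub>R v)) (at y) u =
      r *\<^sub>R frechet_derivative (\<lambda>z. L z v) (at y) u"
    by metis
qed

lemma bilinear_frechet_derivative_family:
  fixes B :: "'a::real_normed_vector \<Rightarrow> 'b::real_vector \<Rightarrow> 'c::real_vector \<Rightarrow> 'd::real_normed_vector"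
  assumes S: "open S" "y \<in> S" and bil: "\<And>z. z \<in> S \<Longrightarrow> bilinear (B z)"
    and diff: "\<And>v w. (\<lambda>z. B z v w) differentiable (at y)"
  shows "bilinear (\<lambda>v w. frechet_derivative (\<lambda>z. B z v w) (at y) u)"
  unfolding bilinear_def
proof (intro conjI allI)
  show "linear (\<lambda>w. frechet_derivative (\<lambda>z. B z v w) (at y) u)" for v
    using bil by (intro linear_frechet_derivative_family[OF S _ diff]) (simp add: bilinear_def)
  show "linear (\<lambda>w. frechet_derivative (\<lambda>z. B z w v) (at y) u)" for v
    using bil by (intro linear_frechet_derivative_family[of S y "\<lambda>z w. B z w v"] S diff)
      (simp add: bilinear_def)
qed

text \<open>The form sees only the value and the first derivatives of the coefficients at
  \<open>y\<close>. This matters because the coefficients of the spacetime metric are known in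
  closed form only on the image of a chart.\<close>

lemma levi_civita_form_cong:
  assumes "open S" "y \<in> S" "\<And>z v w. z \<in> S \<Longrightarrow> G z v w = G' z v w"
  shows "levi_civita_form G y = levi_civita_form G' y"
proof -
  have "frechet_derivative (\<lambda>z. G z v w) (at y) = frechet_derivative (\<lambda>z. G' z v w) (at y)" for v w
    by (rule frechet_derivative_cong_open[OF assms(1,2)]) (rule assms(3))
  then show ?thesis
    by (simp add: levi_civita_form_def assms(3)[OF assms(2)])
qed

text \<open>A trace needs only diagonal values of the connection, and the mean curvature function
  pairs them with the normal. Tested against \<open>w\<close>, the Koszul formula on the diagonal
  has just two terms, and \<open>G y\<close> never has to be inverted.\<close>

lemma levi_civita_form_koszul:
  fixes G :: "'e::euclidean_space \<Rightarrow> 'e \<Rightarrow> 'e \<Rightarrow> real"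
  assumes S: "open S" "y \<in> S" and bil: "\<And>z. z \<in> S \<Longrightarrow> bilinear (G z)"
    and sym: "\<And>z v w. z \<in> S \<Longrightarrow> G z v w = G z w v"
    and nondeg: "\<And>v. (\<And>w. G y v w = 0) \<Longrightarrow> v = 0"
    and diff: "\<And>v w. (\<lambda>z. G z v w) differentiable (at y)"
  shows "G y (levi_civita_form G y v v) w =
    frechet_derivative (\<lambda>z. G z v w) (at y) v - frechet_derivative (\<lambda>z. G z v v) (at y) w / 2"
proof -
  let ?D = "\<lambda>u v w. frechet_derivative (\<lambda>z. G z v w) (at y) u"
  let ?P = "\<lambda>\<Gamma>. bilinear \<Gamma> \<and> (\<forall>v w. \<Gamma> v w = \<Gamma> w v) \<and>
    (\<forall>u v w. ?D u v w = G y (\<Gamma> u v) w + G y v (\<Gamma> u w))"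
  define \<Gamma> where "\<Gamma> = levi_civita_form G y"
  have "\<exists>!\<Gamma>. ?P \<Gamma>"
  proof (rule levi_civita_ex1)
    show "bilinear (?D u)" for u
      using bilinear_frechet_derivative_family[OF S bil diff] .
    show "linear (\<lambda>u. ?D u v w)" for v w
      by (rule linear_frechet_derivative[OF diff])
    show "?D u v w = ?D u w v" for u v w
      using frechet_derivative_cong_open[OF S, of "\<lambda>z. G z v w" "\<lambda>z. G z w v"] sym by metis
  qed (use bil sym nondeg S in auto)
  then have "?P \<Gamma>"
    unfolding \<Gamma>_def levi_civita_form_def by (rule theI')
  then have \<Gamma>: "\<Gamma> v w = \<Gamma> w v" "?D u v w = G y (\<Gamma> u v) w + G y v (\<Gamma> u w)" for u v w
    by blast+
  have "G y (\<Gamma> w v) v = G y v (\<Gamma> v w)"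
    using sym[OF S(2)] \<Gamma>(1)[of w v] by simp
  then have "?D w v v = 2 * G y v (\<Gamma> v w)"
    using \<Gamma>(2)[where u = w and v = v and w = v] \<Gamma>(1)[of w v] by simp
  then show ?thesis
    using \<Gamma>(2)[where u = v and v = v and w = w] by (simp add: \<Gamma>_def)
qed

text \<open>The metric -h^2 dt^2 + \<rho>^2 \<sigma> in a product chart with coordinates (t, x),
  where \<open>S x\<close> holds the coefficients of \<sigma> and the first component of a vector is
  its dt part.\<close>

definition warped_form ::
    "('e::euclidean_space \<Rightarrow> real) \<Rightarrow> (real \<Rightarrow> real) \<Rightarrow> ('e \<Rightarrow> 'e \<Rightarrow> 'e \<Rightarrow> real) \<Rightarrow>
     real \<times> 'e \<Rightarrow> real \<times> 'e \<Rightarrow> real \<times> 'e \<Rightarrow> real" where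
  "warped_form h \<rho> S z v w =
     - (h (snd z))\<^sup>2 * (fst v * fst w) + (\<rho> (fst z))\<^sup>2 * S (snd z) (snd v) (snd w)"

lemma bilinear_warped_form:
  assumes "bilinear (S (snd z))"
  shows "bilinear (warped_form h \<rho> S z)"
  unfolding bilinear_def using assms
  by (auto intro!: linearI simp: warped_form_def bilinear_ladd bilinear_radd bilinear_lmul bilinear_rmul
      algebra_simps)

lemma warped_form_derivative:
  fixes h :: "'e::euclidean_space \<Rightarrow> real"
  assumes h: "h differentiable (at (snd z))" and \<rho>: "\<rho> differentiable (at (fst z))"
    and S: "\<And>v w. (\<lambda>x. S x v w) differentiable (at (snd z))"
  shows "((\<lambda>z. warped_form h \<rho> S z v w) has_derivative
    (\<lambda>u. - (2 * h (snd z) * frechet_derivative h (at (snd z)) (snd u)) * (fst v * fst w)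
       + (2 * \<rho> (fst z) * (deriv \<rho> (fst z) * fst u) * S (snd z) (snd v) (snd w)
         + (\<rho> (fst z))\<^sup>2 * frechet_derivative (\<lambda>x. S x (snd v) (snd w)) (at (snd z)) (snd u)))) (at z)"
proof -
  have s: "(snd has_derivative snd) (at z)" and f: "(fst has_derivative fst) (at z)"
    by (auto intro!: derivative_eq_intros)
  have 1: "((\<lambda>z. h (snd z)) has_derivative (\<lambda>u. frechet_derivative h (at (snd z)) (snd u))) (at z)"
    using has_derivative_compose[OF s] h by (simp add: frechet_derivative_works)
  have "(\<rho> has_real_derivative deriv \<rho> (fst z)) (at (fst z))"
    using \<rho> by (simp add: DERIV_deriv_iff_real_differentiable)
  then have 2: "((\<lambda>z. \<rho> (fst z)) has_derivative (\<lambda>u. deriv \<rho> (fst z) * fst u)) (at z)"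
    using has_derivative_compose[OF f] by (simp add: has_field_derivative_def)
  have 3: "((\<lambda>z. S (snd z) (snd v) (snd w)) has_derivative
      (\<lambda>u. frechet_derivative (\<lambda>x. S x (snd v) (snd w)) (at (snd z)) (snd u))) (at z)"
    using has_derivative_compose[OF s, of "\<lambda>x. S x (snd v) (snd w)"] S by (simp add: frechet_derivative_works)
  show ?thesis
    unfolding warped_form_def[abs_def] power2_eq_square
    by (rule derivative_eq_intros refl 1 2 3)+ (simp add: algebra_simps)
qed

text \<open>The two Koszul terms, sorted by derivatives of \<open>h\<close>, \<open>\<rho>\<close>
  and \<open>S\<close>. The last summand is \<rho>^2 times the Koszul expression of \<sigma> alone;
  later it is only bounded, never evaluated.\<close>

lemma warped_form_koszul:
  fixes h :: "'e::euclidean_space \<Rightarrow> real"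
  assumes I: "open I" "fst z \<in> I" "smooth_on I \<rho>" "\<And>t. t \<in> I \<Longrightarrow> \<rho> t > 0"
    and V: "open V" "snd z \<in> V" "smooth_on V h" "\<And>x. x \<in> V \<Longrightarrow> h x > 0"
    and S: "\<And>x. x \<in> V \<Longrightarrow> bilinear (S x)" "\<And>x v w. x \<in> V \<Longrightarrow> S x v w = S x w v"
      "\<And>x v. x \<in> V \<Longrightarrow> v \<noteq> 0 \<Longrightarrow> S x v v > 0" "\<And>v w. smooth_on V (\<lambda>x. S x v w)"
  shows "warped_form h \<rho> S z (levi_civita_form (warped_form h \<rho> S) z (a, X) (a, X)) (b, Y) =
    - 2 * h (snd z) * frechet_derivative h (at (snd z)) X * a * b
    + 2 * \<rho> (fst z) * deriv \<rho> (fst z) * a * S (snd z) X Y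
    + h (snd z) * frechet_derivative h (at (snd z)) Y * a\<^sup>2
    - \<rho> (fst z) * deriv \<rho> (fst z) * b * S (snd z) X X
    + (\<rho> (fst z))\<^sup>2 * (frechet_derivative (\<lambda>x. S x X Y) (at (snd z)) X
        - frechet_derivative (\<lambda>x. S x X X) (at (snd z)) Y / 2)"
proof -
  have dh: "h differentiable (at (snd z))" and d\<rho>: "\<rho> differentiable (at (fst z))"
    and dS: "\<And>v w. (\<lambda>x. S x v w) differentiable (at (snd z))"
    using smooth_on_derivative[OF V(3,2)] smooth_on_derivative[OF I(3,2)] smooth_on_derivative[OF S(4) V(2)]
    unfolding differentiable_def by blast+
  note D = warped_form_derivative[of h z \<rho> S, OF dh d\<rho> dS]
  note fD = frechet_derivative_at[OF D, symmetric]
  have nd: "v = 0" if "\<And>w. warped_form h \<rho> S z v w = 0" for v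
  proof -
    \<comment> \<open>Reversing the time component of the test vector turns the Lorentzian form into
      a sum of nonnegative terms.\<close>
    have "(h (snd z))\<^sup>2 * (fst v)\<^sup>2 + (\<rho> (fst z))\<^sup>2 * S (snd z) (snd v) (snd v) = 0"
      using that[of "(- fst v, snd v)"] by (simp add: warped_form_def power2_eq_square)
    moreover have "S (snd z) (snd v) (snd v) \<ge> 0"
      using S(3)[OF V(2), of "snd v"] bilinear_lzero[OF S(1)[OF V(2)]] by (cases "snd v = 0") (auto intro: less_imp_le)
    ultimately have "(h (snd z))\<^sup>2 * (fst v)\<^sup>2 = 0" "(\<rho> (fst z))\<^sup>2 * S (snd z) (snd v) (snd v) = 0"
      by (simp_all add: add_nonneg_eq_0_iff)
    then have "fst v = 0" "S (snd z) (snd v) (snd v) = 0"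
      using V(4)[OF V(2)] I(4)[OF I(2)] by auto
    then show ?thesis
      using S(3)[OF V(2), of "snd v"] by (cases "snd v = 0") (auto simp: prod_eq_iff)
  qed
  have "warped_form h \<rho> S z (levi_civita_form (warped_form h \<rho> S) z (a, X) (a, X)) (b, Y) =
      frechet_derivative (\<lambda>z. warped_form h \<rho> S z (a, X) (b, Y)) (at z) (a, X)
      - frechet_derivative (\<lambda>z. warped_form h \<rho> S z (a, X) (a, X)) (at z) (b, Y) / 2"
  proof (rule levi_civita_form_koszul[of "I \<times> V"])
    show "open (I \<times> V)" "z \<in> I \<times> V"
      using I V by (auto simp: open_Times mem_Times_iff)
    show "bilinear (warped_form h \<rho> S z)" if "z \<in> I \<times> V" for z
      using that by (intro bilinear_warped_form S) auto
    show "warped_form h \<rho> S z v w = warped_form h \<rho> S z w v" if "z \<in> I \<times> V" for z v w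
      using that S(2)[of "snd z" "snd v" "snd w"] by (auto simp: warped_form_def)
    show "(\<lambda>z. warped_form h \<rho> S z v w) differentiable (at z)" for v w
      unfolding differentiable_def using D by blast
  qed (rule nd)
  then show ?thesis
    by (simp add: fD algebra_simps power2_eq_square add_divide_distrib diff_divide_distrib)
qed

section \<open>The elliptic inequality for the time coordinate\<close>

lemma abs_mult_le:
  fixes x y :: real
  shows "\<bar>x\<bar> \<le> A \<Longrightarrow> \<bar>y\<bar> \<le> B \<Longrightarrow> \<bar>x * y\<bar> \<le> A * B"
  by (simp add: abs_mult mult_mono)

text \<open>The pointwise algebra behind the elliptic inequality. For F = (u, f), \<open>Du\<close>,
  \<open>Df\<close>, \<open>d2u\<close>, \<open>d2f\<close> stand for first derivatives and diagonal
  second derivatives; \<open>h\<close>, \<open>r\<close>, \<open>r1\<close> are the values of h,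
  \<rho>, \<rho>', and \<open>(b, Y)\<close> is the normal. Premise \<open>mean\<close> is the mean
  curvature inequality times the dimension, with \<open>warped_form_koszul\<close> inserted. Since
  one constant \<open>K\<close> bounds all the data, each error term becomes a power of
  \<open>K\<close> times \<open>N\<close>.\<close>

lemma spacelike_trace_estimate:
  fixes K N h r r1 b :: real and Du Dh d2u :: "'e::euclidean_space \<Rightarrow> real" and Df d2f :: "'e \<Rightarrow> 'e"
    and S :: "'e \<Rightarrow> 'e \<Rightarrow> real" and DS :: "'e \<Rightarrow> 'e \<Rightarrow> 'e \<Rightarrow> real"
  assumes K: "1 \<le> K" and N: "0 \<le> N" "N \<le> K" and Du: "\<And>v. \<bar>Du v\<bar> \<le> N * norm v"
    and h: "0 < h" "h \<le> K" "inverse h \<le> K" and r: "0 < r" "r \<le> K" "inverse r \<le> K" "\<bar>r1\<bar> \<le> K"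
    and Df: "linear Df" "\<And>v. norm (Df v) \<le> K * norm v" "\<And>v. norm v \<le> K * norm (Df v)"
    and d2f: "\<And>v. norm (d2f v) \<le> K * (norm v * norm v)"
    and Dh: "linear Dh" "\<And>v. \<bar>Dh v\<bar> \<le> K * norm v"
    and S: "bilinear S" "\<And>v w. \<bar>S v w\<bar> \<le> K * (norm v * norm w)" "\<And>v. (norm v)\<^sup>2 \<le> K * S v v"
    and DS: "\<And>u. bilinear (DS u)" "\<And>v w. linear (\<lambda>u. DS u v w)"
      "\<And>u v w. \<bar>DS u v w\<bar> \<le> K * (norm u * (norm v * norm w))"
    and E: "finite E" "\<And>e. e \<in> E \<Longrightarrow> norm e \<le> K"
      "\<And>e. e \<in> E \<Longrightarrow> - h\<^sup>2 * (Du e)\<^sup>2 + r\<^sup>2 * S (Df e) (Df e) = 1"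
    and b: "0 < b" "- h\<^sup>2 * b\<^sup>2 + r\<^sup>2 * S Y Y = -1"
    and normal: "\<And>v. r\<^sup>2 * S Y (Df v) = h\<^sup>2 * b * Du v"
    and mean: "card E * r1 / (h * r) \<le>
      - (\<Sum>e\<in>E. - h\<^sup>2 * b * d2u e + r\<^sup>2 * S (d2f e) Y - 2 * h * Dh (Df e) * Du e * b
          + 2 * r * r1 * Du e * S (Df e) Y + h * Dh Y * (Du e)\<^sup>2 - r * r1 * b * S (Df e) (Df e)
          + r\<^sup>2 * (DS (Df e) (Df e) Y - DS Y (Df e) (Df e) / 2))"
  shows "(\<Sum>e\<in>E. d2u e) \<ge> - (card E * 10 * K ^ 24 * N)"
proof -
  \<comment> \<open>The slope of the normal. Each summand in \<open>mean\<close> is linear in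
    \<open>(b, Y)\<close>, so division by \<open>b\<close> turns Y into \<eta>, and only \<eta> has
    to be estimated.\<close>
  define \<eta> where "\<eta> = (1 / b) *\<^sub>R Y"
  have Y: "Y = b *\<^sub>R \<eta>"
    using b by (simp add: \<eta>_def)
  have Kpos: "0 < K" "0 \<le> K"
    using K by auto
  have hh: "\<bar>h\<bar> \<le> K" "\<bar>r\<bar> \<le> K" "\<bar>r1\<bar> \<le> K" "\<bar>1 / r\<bar> \<le> K" "\<bar>1 / h\<bar> \<le> K"
    using h r by (auto simp: inverse_eq_divide)
  \<comment> \<open>22 is a common exponent for all error terms; the largest power of
    \<open>K\<close> that arises is 20, in \<open>slope\<close>. Division by
    \<open>h\<^sup>2\<close> at the end raises the exponent to 24.\<close>
  have pw: "K ^ i * N \<le> K ^ 22 * N" if "i \<le> 22" for i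
    using that K N by (intro mult_right_mono power_increasing) auto
  have normal': "r\<^sup>2 * S \<eta> (Df v) = h\<^sup>2 * Du v" for v
    using normal[of v] b S(1) by (simp add: Y bilinear_lmul)
  \<comment> \<open>Lets normality be tested on \<eta> itself: r^2 S(\<eta>, \<eta>) = h^2 Du(v0).
    The left side is quadratic in |\<eta>|, the right side linear with the gradient bound as a
    factor, so one power of |\<eta>| cancels.\<close>
  obtain v0 where v0: "Df v0 = \<eta>"
  proof -
    have "inj Df"
      unfolding linear_injective_0[OF Df(1)] using Df(3) by (metis mult_zero_right norm_le_zero_iff norm_zero)
    then have "surj Df"
      using linear_injective_imp_surjective[OF Df(1)] by blast
    then show ?thesis
      using that by (metis surjD)
  qed
  \<comment> \<open>Used with \<open>N\<close> for smallness and with \<open>K\<close> for mere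
    boundedness. In \<open>slope\<close> one factor of each kind makes the quadratic quantity
    \<open>S \<eta> \<eta>\<close> linear in \<open>N\<close>.\<close>
  have \<eta>_le: "norm \<eta> \<le> K ^ 6 * N'" if N': "0 \<le> N'" "\<And>v. \<bar>Du v\<bar> \<le> N' * norm v" for N'
  proof -
    have "(norm \<eta>)\<^sup>2 \<le> K * S \<eta> \<eta>"
      by (rule S)
    also have "S \<eta> \<eta> = (1 / r)\<^sup>2 * (h\<^sup>2 * Du v0)"
      using normal'[of v0] r by (simp add: v0 field_simps)
    also have "\<dots> \<le> K\<^sup>2 * (K\<^sup>2 * (N' * (K * norm \<eta>)))"
    proof (intro mult_mono)
      show "(1 / r)\<^sup>2 \<le> K\<^sup>2" "h\<^sup>2 \<le> K\<^sup>2"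
        using hh h r by (auto intro!: power_mono simp del: power_divide)
      have "Du v0 \<le> N' * norm v0"
        using N'(2)[of v0] by simp
      also have "\<dots> \<le> N' * (K * norm \<eta>)"
        using Df(3)[of v0] N' by (intro mult_left_mono) (simp_all add: v0)
      finally show "Du v0 \<le> N' * (K * norm \<eta>)" .
      have "0 \<le> r\<^sup>2 * S \<eta> \<eta>"
        using S(3)[of \<eta>] Kpos by (smt (verit) mult_nonneg_nonneg zero_le_mult_iff zero_le_power2)
      then show "0 \<le> h\<^sup>2 * Du v0"
        using normal'[of v0] by (simp add: v0)
      then show "0 \<le> Du v0"
        using h by (simp add: zero_le_mult_iff)
    qed (use N' Kpos in auto)
    finally have "(norm \<eta>)\<^sup>2 \<le> K * (K\<^sup>2 * (K\<^sup>2 * (N' * (K * norm \<eta>))))"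
      using Kpos by simp
    then have *: "norm \<eta> * norm \<eta> \<le> norm \<eta> * (K ^ 6 * N')"
      by (simp add: power2_eq_square power_numeral_reduce ac_simps)
    show ?thesis
    proof (cases "\<eta> = 0")
      case True
      then show ?thesis
        using Kpos N' by simp
    next
      case False
      then show ?thesis
        using mult_left_le_imp_le[OF *] by simp
    qed
  qed
  have \<eta>N: "norm \<eta> \<le> K ^ 6 * N"
    by (intro \<eta>_le N Du)
  have "\<bar>Du v\<bar> \<le> K * norm v" for v
    using Du[of v] N(2) by (meson mult_right_mono norm_ge_zero order_trans)
  then have \<eta>K: "norm \<eta> \<le> K ^ 6 * K"
    using \<eta>_le[of K] Kpos by simp
  \<comment> \<open>What is left after division by \<open>b\<close>, apart from the second
    derivative of u and the term with \<open>r1\<close> and \<open>S (Df e) (Df e)\<close>. Every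
    summand contains \<open>Du\<close> or \<eta>. The weights 1, 2, 2, 1, 1, 1/2 add up to at most
    8, the factor in \<open>bounds\<close>.\<close>
  define R where "R e = r\<^sup>2 * S (d2f e) \<eta> - 2 * (h * (Dh (Df e) * Du e)) + 2 * (r * (r1 * (Du e * S (Df e) \<eta>)))
      + h * (Dh \<eta> * (Du e * Du e)) + r\<^sup>2 * DS (Df e) (Df e) \<eta> - (r\<^sup>2 * DS \<eta> (Df e) (Df e)) / 2" for e
  have bounds: "\<bar>R e\<bar> \<le> 8 * (K ^ 22 * N)" "\<bar>r1 * ((1 / r) * (h\<^sup>2 * (Du e * Du e)))\<bar> \<le> K ^ 22 * N"
    if e: "e \<in> E" for e
  proof -
    have ne: "norm e \<le> K"
      using E(2)[OF e] .
    have a: "\<bar>Du e\<bar> \<le> K * N"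
      using Du[of e] mult_left_mono[OF ne N(1)] by (simp add: mult.commute)
    then have aK: "\<bar>Du e\<bar> \<le> K * K"
      using mult_left_mono[OF N(2) Kpos(2)] by simp
    have X: "norm (Df e) \<le> K * K"
      using Df(2)[of e] mult_left_mono[OF ne Kpos(2)] by simp
    have "norm e * norm e \<le> K * K"
      using ne by (intro mult_mono) (use Kpos in auto)
    then have d2: "norm (d2f e) \<le> K * (K * K)"
      by (rule order_trans[OF d2f mult_left_mono[OF _ Kpos(2)]])
    have r2: "\<bar>r\<^sup>2\<bar> \<le> K\<^sup>2" "\<bar>h\<^sup>2\<bar> \<le> K\<^sup>2"
      using r h by (auto intro: power_mono)
    have SX: "\<bar>S (Df e) \<eta>\<bar> \<le> K * ((K * K) * (K ^ 6 * N))"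
      by (rule order_trans[OF S(2) mult_left_mono[OF mult_mono[OF X \<eta>N]]])
        (use Kpos N in auto)
    have Sd: "\<bar>S (d2f e) \<eta>\<bar> \<le> K * ((K * (K * K)) * (K ^ 6 * N))"
      by (rule order_trans[OF S(2) mult_left_mono[OF mult_mono[OF d2 \<eta>N]]])
        (use Kpos N in auto)
    have DhX: "\<bar>Dh (Df e)\<bar> \<le> K * (K * K)"
      using Dh(2)[of "Df e"] mult_left_mono[OF X Kpos(2)] by simp
    have Dh\<eta>: "\<bar>Dh \<eta>\<bar> \<le> K * (K ^ 6 * N)"
      using Dh(2)[of \<eta>] mult_left_mono[OF \<eta>N Kpos(2)] by simp
    have D1: "\<bar>DS (Df e) (Df e) \<eta>\<bar> \<le> K * ((K * K) * ((K * K) * (K ^ 6 * N)))"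
      by (rule order_trans[OF DS(3) mult_left_mono[OF mult_mono[OF X mult_mono[OF X \<eta>N]]]])
        (use Kpos N in auto)
    have D2: "\<bar>DS \<eta> (Df e) (Df e)\<bar> \<le> K * ((K ^ 6 * N) * ((K * K) * (K * K)))"
      by (rule order_trans[OF DS(3) mult_left_mono[OF mult_mono[OF \<eta>N mult_mono[OF X X]]]])
        (use Kpos N in auto)
    have 1: "\<bar>r\<^sup>2 * S (d2f e) \<eta>\<bar> \<le> K ^ 22 * N"
      by (rule order_trans[OF abs_mult_le[OF r2(1) Sd] order_trans[OF _ pw[of 12]]])
        (simp_all add: power_numeral_reduce ac_simps)
    have 2: "\<bar>h * (Dh (Df e) * Du e)\<bar> \<le> K ^ 22 * N"
      by (rule order_trans[OF abs_mult_le[OF hh(1) abs_mult_le[OF DhX a]] order_trans[OF _ pw[of 5]]])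
        (simp_all add: power_numeral_reduce ac_simps)
    have 3: "\<bar>r * (r1 * (Du e * S (Df e) \<eta>))\<bar> \<le> K ^ 22 * N"
      by (rule order_trans[OF abs_mult_le[OF hh(2) abs_mult_le[OF hh(3) abs_mult_le[OF aK SX]]]
            order_trans[OF _ pw[of 13]]])
        (simp_all add: power_numeral_reduce ac_simps)
    have 4: "\<bar>h * (Dh \<eta> * (Du e * Du e))\<bar> \<le> K ^ 22 * N"
      by (rule order_trans[OF abs_mult_le[OF hh(1) abs_mult_le[OF Dh\<eta> abs_mult_le[OF aK aK]]]
            order_trans[OF _ pw[of 12]]])
        (simp_all add: power_numeral_reduce ac_simps)
    have 5: "\<bar>r\<^sup>2 * DS (Df e) (Df e) \<eta>\<bar> \<le> K ^ 22 * N"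
      by (rule order_trans[OF abs_mult_le[OF r2(1) D1] order_trans[OF _ pw[of 13]]])
        (simp_all add: power_numeral_reduce ac_simps)
    have 6: "\<bar>r\<^sup>2 * DS \<eta> (Df e) (Df e)\<bar> \<le> K ^ 22 * N"
      by (rule order_trans[OF abs_mult_le[OF r2(1) D2] order_trans[OF _ pw[of 13]]])
        (simp_all add: power_numeral_reduce ac_simps)
    show "\<bar>R e\<bar> \<le> 8 * (K ^ 22 * N)"
      using 1 2 3 4 5 6 unfolding R_def abs_le_iff by linarith
    show "\<bar>r1 * ((1 / r) * (h\<^sup>2 * (Du e * Du e)))\<bar> \<le> K ^ 22 * N"
      by (rule order_trans[OF abs_mult_le[OF hh(3) abs_mult_le[OF hh(4) abs_mult_le[OF r2(2) abs_mult_le[OF aK a]]]]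
            order_trans[OF _ pw[of 7]]])
        (simp_all add: power_numeral_reduce ac_simps)
  qed
  \<comment> \<open>The unit condition says that x = h b satisfies x^2 = 1 + b^2 r^2 S(\<eta>,
    \<eta>). So x \<ge> 1, and 1 - 1/x \<le> 1 - 1/x^2 = r^2 S(\<eta>, \<eta>) / h^2, which is small
    with \<eta>.\<close>
  have slope: "\<bar>r1 * ((1 / r) * (1 - 1 / (h * b)))\<bar> \<le> K ^ 22 * N"
  proof -
    have hb: "(h * b)\<^sup>2 = 1 + b\<^sup>2 * (r\<^sup>2 * S \<eta> \<eta>)"
      using b(2) S(1) by (simp add: Y bilinear_lmul bilinear_rmul power2_eq_square algebra_simps)
    have S0: "0 \<le> S \<eta> \<eta>"
      using S(3)[of \<eta>] Kpos by (smt (verit) zero_le_mult_iff zero_le_power2)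
    then have "1 \<le> (h * b)\<^sup>2"
      using hb by simp
    then have hb1: "1 \<le> h * b"
      using h b power_le_one[of "h * b" 2] power2_le_imp_le[of 1 "h * b"] by simp
    have "1 - 1 / (h * b) \<le> ((h * b)\<^sup>2 - 1) / (h * b)\<^sup>2"
    proof -
      have "(1 / (h * b)) * (1 / (h * b)) \<le> 1 / (h * b) * 1"
        using hb1 by (intro mult_left_mono) auto
      moreover have "((h * b)\<^sup>2 - 1) / (h * b)\<^sup>2 = 1 - (1 / (h * b)) * (1 / (h * b))"
        using h b by (simp add: field_simps power2_eq_square)
      ultimately show ?thesis by simp
    qed
    also have "\<dots> = (1 / h)\<^sup>2 * (r\<^sup>2 * S \<eta> \<eta>)"
    proof -
      have "(h * b)\<^sup>2 - 1 = b\<^sup>2 * (r\<^sup>2 * S \<eta> \<eta>)"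
        using hb by simp
      then have "((h * b)\<^sup>2 - 1) / (h * b)\<^sup>2 = (b\<^sup>2 * (r\<^sup>2 * S \<eta> \<eta>)) / (h * b)\<^sup>2"
        by simp
      also have "\<dots> = (1 / h)\<^sup>2 * (r\<^sup>2 * S \<eta> \<eta>)"
        using h(1) b(1) by (simp add: power_mult_distrib power_divide)
      finally show ?thesis .
    qed
    finally have *: "\<bar>1 - 1 / (h * b)\<bar> \<le> \<bar>(1 / h)\<^sup>2 * (r\<^sup>2 * S \<eta> \<eta>)\<bar>"
      using hb1 S0 by (simp add: abs_mult)
    have "\<bar>S \<eta> \<eta>\<bar> \<le> K * ((K ^ 6 * K) * (K ^ 6 * N))"
      by (rule order_trans[OF S(2) mult_left_mono[OF mult_mono[OF \<eta>K \<eta>N]]])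
        (use Kpos N in auto)
    moreover have "\<bar>r\<^sup>2\<bar> \<le> K\<^sup>2" "\<bar>(1 / h)\<^sup>2\<bar> \<le> K\<^sup>2"
      using h r hh(5) by (auto intro!: power_mono simp del: power_divide)
    ultimately have "\<bar>1 - 1 / (h * b)\<bar> \<le> K\<^sup>2 * (K\<^sup>2 * (K * ((K ^ 6 * K) * (K ^ 6 * N))))"
      by (intro order_trans[OF *] abs_mult_le)
    from abs_mult_le[OF hh(3) abs_mult_le[OF hh(4) this]]
    show ?thesis
      by (rule order_trans[OF _ order_trans[OF _ pw[of 20]]]) (simp_all add: power_numeral_reduce ac_simps)
  qed
  define T where "T = (\<Sum>e\<in>E. d2u e)"
  define A where "A = (\<Sum>e\<in>E. R e - r1 * ((1 / r) * (h\<^sup>2 * (Du e * Du e))))"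
  \<comment> \<open>Orthonormality replaces r^2 S(Df e, Df e) by 1 + h^2 Du(e)^2. The 1 produces the
    contribution \<open>r1 / r\<close> of a slice, the rest is quadratic in
    \<open>Du\<close>.\<close>
  have term_eq: "- h\<^sup>2 * b * d2u e + r\<^sup>2 * S (d2f e) Y - 2 * h * Dh (Df e) * Du e * b
          + 2 * r * r1 * Du e * S (Df e) Y + h * Dh Y * (Du e)\<^sup>2 - r * r1 * b * S (Df e) (Df e)
          + r\<^sup>2 * (DS (Df e) (Df e) Y - DS Y (Df e) (Df e) / 2)
      = b * (- (h\<^sup>2 * d2u e) + (R e - r1 * ((1 / r) * (h\<^sup>2 * (Du e * Du e)))) - r1 / r)" if "e \<in> E" for e
  proof -
    have "r * r1 * b * S (Df e) (Df e) = b * (r1 / r) * (r\<^sup>2 * S (Df e) (Df e))"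
      using r by (simp add: power2_eq_square)
    also have "r\<^sup>2 * S (Df e) (Df e) = 1 + h\<^sup>2 * (Du e * Du e)"
      using E(3)[OF that] by (simp add: power2_eq_square)
    finally have 1: "r * r1 * b * S (Df e) (Df e) = b * (r1 / r) * (1 + h\<^sup>2 * (Du e * Du e))" .
    have 2: "S v Y = b * S v \<eta>" "Dh Y = b * Dh \<eta>" "DS v w Y = b * DS v w \<eta>" "DS Y v w = b * DS \<eta> v w" for v w
      using S(1) DS(1) linear_scale[OF DS(2)] linear_scale[OF Dh(1)] by (simp_all add: Y bilinear_rmul)
    show ?thesis
      unfolding 1 2 R_def by (simp add: algebra_simps power2_eq_square add_divide_distrib diff_divide_distrib)
  qed
  have "card E * r1 / (h * r) \<le> - (\<Sum>e\<in>E. b * (- (h\<^sup>2 * d2u e) + (R e - r1 * ((1 / r) * (h\<^sup>2 * (Du e * Du e)))) - r1 / r))"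
    using mean term_eq by (simp cong: sum.cong)
  also have "\<dots> = b * (h\<^sup>2 * T - A + card E * (r1 / r))"
    unfolding sum_distrib_left[symmetric] A_def T_def
    by (simp add: sum.distrib sum_subtractf sum_negf sum_distrib_right[symmetric] algebra_simps)
  finally have "(1 / b) * (card E * r1 / (h * r)) \<le> (1 / b) * (b * (h\<^sup>2 * T - A + card E * (r1 / r)))"
    using b by (intro mult_left_mono) auto
  then have "(1 / b) * (card E * r1 / (h * r)) \<le> h\<^sup>2 * T - A + card E * (r1 / r)"
    using b by simp
  \<comment> \<open>The cancellation of the zeroth order terms: this side differs from
    \<open>card E * (r1 / r)\<close> only by the factor 1 / (h b), and \<open>slope\<close> controls
    the difference.\<close>
  moreover have "(1 / b) * (card E * r1 / (h * r)) = card E * (r1 / r) - card E * (r1 * ((1 / r) * (1 - 1 / (h * b))))"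
    using b h r by (simp add: field_simps)
  ultimately have hT: "A - card E * (r1 * ((1 / r) * (1 - 1 / (h * b)))) \<le> h\<^sup>2 * T"
    by simp
  \<comment> \<open>Per basis vector: 8 from \<open>R\<close> and 1 from the quadratic term in
    \<open>Du\<close>; \<open>slope\<close> adds 1 more, which makes the 10 of the
    conclusion.\<close>
  have "- (card E * (9 * (K ^ 22 * N))) \<le> A"
  proof -
    have "(\<Sum>e\<in>E. - (9 * (K ^ 22 * N))) \<le> A"
      unfolding A_def
    proof (rule sum_mono)
      fix e assume "e \<in> E"
      from bounds[OF this, unfolded abs_le_iff] show "- (9 * (K ^ 22 * N)) \<le> R e - r1 * ((1 / r) * (h\<^sup>2 * (Du e * Du e)))"
        by linarith
    qed
    then show ?thesis by simp
  qed
  moreover have "card E * (r1 * ((1 / r) * (1 - 1 / (h * b)))) \<le> card E * (K ^ 22 * N)"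
    by (intro mult_left_mono abs_le_D1[OF slope]) simp
  ultimately have "- (card E * 10 * K ^ 22 * N) \<le> h\<^sup>2 * T"
    using hT by (simp add: algebra_simps)
  then have "- (h\<^sup>2 * T) \<le> card E * 10 * K ^ 22 * N"
    by simp
  then have "(1 / h)\<^sup>2 * - (h\<^sup>2 * T) \<le> (1 / h)\<^sup>2 * (card E * 10 * K ^ 22 * N)"
    by (intro mult_left_mono) auto
  also have "\<dots> \<le> K\<^sup>2 * (card E * 10 * K ^ 22 * N)"
  proof (rule mult_right_mono)
    show "(1 / h)\<^sup>2 \<le> K\<^sup>2"
      using hh h by (intro power_mono) auto
  qed (use Kpos N in auto)
  also have "(1 / h)\<^sup>2 * - (h\<^sup>2 * T) = - T"
    using h by (simp add: field_simps)
  finally show ?thesis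
    by (simp add: T_def power_numeral_reduce ac_simps)
qed

lemma smooth_on_deriv_continuous:
  fixes \<rho> :: "real \<Rightarrow> real"
  assumes "smooth_on I \<rho>"
  shows "continuous_on I (deriv \<rho>)"
proof -
  have "frechet_derivative \<rho> (at t) 1 = deriv \<rho> t" if "t \<in> I" for t
  proof -
    note d = smooth_on_derivative[OF assms that]
    then have "(\<rho> has_derivative (*) (deriv \<rho> t)) (at t)"
      using DERIV_deriv_iff_real_differentiable[of \<rho> t]
      unfolding differentiable_def has_field_derivative_def by blast
    from has_derivative_unique[OF d this] show ?thesis
      by simp
  qed
  then show ?thesis
    using smooth_on_imp_continuous_on[OF smooth_on_frechet_derivative[OF assms, of 1]]
    by (simp cong: continuous_on_cong)
qed

text \<open>Makes \<open>spacelike_trace_estimate\<close> uniform: on a compact ball all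
  coefficients are bounded, so \<open>r\<close> and \<open>C\<close> are fixed before
  \<open>y\<close>, \<open>E\<close>, \<open>n\<close> and \<open>N\<close>. The conclusion has the
  shape of premise \<open>ell\<close> of \<open>strong_maximum_principle\<close>.\<close>

lemma warped_graph_elliptic_inequality:
  fixes F :: "'e::euclidean_space \<Rightarrow> real \<times> 'e" and h :: "'e \<Rightarrow> real"
  defines "DF \<equiv> \<lambda>y. frechet_derivative F (at y)"
  defines "D2F \<equiv> \<lambda>y v w. frechet_derivative (\<lambda>z. DF z w) (at y) v"
  assumes I: "open I" "smooth_on I \<rho>" "\<And>t. t \<in> I \<Longrightarrow> \<rho> t > 0"
    and V: "open V" "smooth_on V h" "\<And>x. x \<in> V \<Longrightarrow> h x > 0"
    and S: "\<And>x. x \<in> V \<Longrightarrow> bilinear (S x)" "\<And>x v w. x \<in> V \<Longrightarrow> S x v w = S x w v"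
      "\<And>x v. x \<in> V \<Longrightarrow> v \<noteq> 0 \<Longrightarrow> S x v v > 0" "\<And>v w. smooth_on V (\<lambda>x. S x v w)"
    and F: "open U" "smooth_on U F" "F ` U \<subseteq> I \<times> V"
    and G: "\<And>y v w. y \<in> U \<Longrightarrow> G y v w = warped_form h \<rho> S (F y) (DF y v) (DF y w)"
      "\<And>v w. smooth_on U (\<lambda>y. G y v w)" "\<And>y v. y \<in> U \<Longrightarrow> v \<noteq> 0 \<Longrightarrow> G y v v > 0"
    and y0: "y0 \<in> U"
  shows "\<exists>r>0. \<exists>C>0. ball y0 r \<subseteq> U \<and> (\<forall>y\<in>ball y0 r. \<forall>E n N.
    orthonormal_basis (G y) E \<longrightarrow> (\<forall>v. warped_form h \<rho> S (F y) n (DF y v) = 0) \<longrightarrow>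
    warped_form h \<rho> S (F y) n n = -1 \<longrightarrow> fst n > 0 \<longrightarrow>
    DIM('e) * deriv \<rho> (fst (F y)) / (h (snd (F y)) * \<rho> (fst (F y))) \<le>
      - warped_form h \<rho> S (F y)
          (\<Sum>e\<in>E. D2F y e e + levi_civita_form (warped_form h \<rho> S) (F y) (DF y e) (DF y e)) n \<longrightarrow>
    0 \<le> N \<longrightarrow> (\<forall>v. \<bar>fst (DF y v)\<bar> \<le> N * norm v) \<longrightarrow>
    (\<forall>w. (norm w)\<^sup>2 \<le> C * (\<Sum>e\<in>E. (e \<bullet> w)\<^sup>2)) \<and> (\<Sum>e\<in>E. (norm e)\<^sup>2) \<le> C \<and>
    (\<Sum>e\<in>E. fst (D2F y e e)) \<ge> - (C * N))"
proof -
  obtain r where r: "r > 0" "cball y0 r \<subseteq> U"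
    using F(1) y0 open_contains_cball by blast
  define J where "J = cball y0 r"
  have J: "compact J" "J \<subseteq> U"
    using r by (simp_all add: J_def)
  have dF: "(F has_derivative DF y) (at y)" if "y \<in> U" for y
    unfolding DF_def using smooth_on_derivative[OF F(2) that] .
  have linDF: "linear (DF y)" if "y \<in> U" for y
    using dF[OF that] by (rule has_derivative_linear)
  have smDF: "smooth_on U (\<lambda>y. DF y v)" for v
    unfolding DF_def by (rule smooth_on_frechet_derivative[OF F(2)])
  have d2F: "((\<lambda>z. DF z v) has_derivative (\<lambda>w. D2F y w v)) (at y)" if "y \<in> U" for y v
    unfolding D2F_def using smooth_on_derivative[OF smDF that] .
  have bilD2F: "bilinear (D2F y)" if "y \<in> U" for y
    unfolding bilinear_def D2F_def
  proof (intro conjI allI)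
    have diff: "(\<lambda>z. DF z v) differentiable (at y)" for v
      using d2F[OF that] differentiable_def by blast
    show "linear (\<lambda>w. frechet_derivative (\<lambda>z. DF z w) (at y) v)" for v
      by (rule linear_frechet_derivative_family[OF F(1) that linDF diff])
    show "linear (\<lambda>v. frechet_derivative (\<lambda>z. DF z w) (at y) v)" for w
      using d2F[OF that, of w] by (simp add: D2F_def has_derivative_linear)
  qed
  have sV: "fst (F y) \<in> I" "snd (F y) \<in> V" if "y \<in> U" for y
    using F(3) that by (auto simp: image_subset_iff mem_Times_iff)
  have contF: "continuous_on J F"
    using continuous_on_subset[OF smooth_on_imp_continuous_on[OF F(2)] J(2)] .
  have contI: "continuous_on J (\<lambda>y. g (fst (F y)))" if "continuous_on I g" for g :: "real \<Rightarrow> real"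
    by (rule continuous_on_compose2[OF that continuous_on_fst[OF contF]]) (use sV J in auto)
  have contV: "continuous_on J (\<lambda>y. g (snd (F y)))" if "continuous_on V g" for g :: "'e \<Rightarrow> real"
    by (rule continuous_on_compose2[OF that continuous_on_snd[OF contF]]) (use sV J in auto)
  have JU: "y \<in> U" if "y \<in> J" for y
    using J that by blast
  have JV: "snd (F y) \<in> V" "fst (F y) \<in> I" if "y \<in> J" for y
    using sV JU that by blast+
  note ch = smooth_on_imp_continuous_on[OF V(2)] and c\<rho> = smooth_on_imp_continuous_on[OF I(2)]
  have h_nz: "\<forall>y\<in>J. h (snd (F y)) \<noteq> 0" and \<rho>_nz: "\<forall>y\<in>J. \<rho> (fst (F y)) \<noteq> 0"
    using V(3)[OF JV(1)] I(3)[OF JV(2)] by force+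
  obtain C1 where C1: "\<And>y. y \<in> J \<Longrightarrow> \<bar>h (snd (F y))\<bar> \<le> C1"
    using continuous_bounded_on_compact[OF J(1) contV[OF ch]] by auto
  obtain C2 where C2: "\<And>y. y \<in> J \<Longrightarrow> \<bar>inverse (h (snd (F y)))\<bar> \<le> C2"
    using continuous_bounded_on_compact[OF J(1) continuous_on_inverse[OF contV[OF ch] h_nz]] by auto
  obtain C3 where C3: "\<And>y. y \<in> J \<Longrightarrow> \<bar>\<rho> (fst (F y))\<bar> \<le> C3"
    using continuous_bounded_on_compact[OF J(1) contI[OF c\<rho>]] by auto
  obtain C4 where C4: "\<And>y. y \<in> J \<Longrightarrow> \<bar>inverse (\<rho> (fst (F y)))\<bar> \<le> C4"
    using continuous_bounded_on_compact[OF J(1) continuous_on_inverse[OF contI[OF c\<rho>] \<rho>_nz]] by auto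
  obtain C5 where C5: "\<And>y. y \<in> J \<Longrightarrow> \<bar>deriv \<rho> (fst (F y))\<bar> \<le> C5"
    using continuous_bounded_on_compact[OF J(1) contI[OF smooth_on_deriv_continuous[OF I(2)]]] by auto
  obtain C6 where C6: "\<And>y v. y \<in> J \<Longrightarrow> norm (DF y v) \<le> C6 * norm v"
    using linear_family_bound_compact[OF J(1), of DF] linDF JU
      continuous_on_subset[OF smooth_on_imp_continuous_on[OF smDF] J(2)] by blast
  obtain C7 where C7: "\<And>y v w. y \<in> J \<Longrightarrow> norm (D2F y v w) \<le> C7 * (norm v * norm w)"
    using bilinear_family_bound_compact[OF J(1), of D2F] bilD2F JU
      continuous_on_subset[OF smooth_on_imp_continuous_on[OF smooth_on_frechet_derivative[OF smDF]] J(2)]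
    unfolding D2F_def by blast
  obtain C8 where C8: "\<And>y v. y \<in> J \<Longrightarrow> norm (frechet_derivative h (at (snd (F y))) v) \<le> C8 * norm v"
    using linear_family_bound_compact[OF J(1), of "\<lambda>y. frechet_derivative h (at (snd (F y)))"]
      has_derivative_linear[OF smooth_on_derivative[OF V(2) JV(1)]]
      contV[OF smooth_on_imp_continuous_on[OF smooth_on_frechet_derivative[OF V(2)]]]
    by blast
  note C8 = C8[unfolded real_norm_def]
  obtain C9 where C9: "\<And>y v w. y \<in> J \<Longrightarrow> norm (S (snd (F y)) v w) \<le> C9 * (norm v * norm w)"
    using bilinear_family_bound_compact[OF J(1), of "\<lambda>y. S (snd (F y))"] S(1)[OF JV(1)]
      contV[OF smooth_on_imp_continuous_on[OF S(4)]] by blast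
  note C9 = C9[unfolded real_norm_def]
  obtain c1 where c1: "c1 > 0" "\<And>y v. y \<in> J \<Longrightarrow> c1 * (norm v)\<^sup>2 \<le> S (snd (F y)) v v"
    using positive_definite_family_bound_compact[OF J(1), of "\<lambda>y. S (snd (F y))"] S(1)[OF JV(1)]
      contV[OF smooth_on_imp_continuous_on[OF S(4)]] S(3)[OF JV(1)] by blast
  define DS where "DS x u v w = frechet_derivative (\<lambda>x. S x v w) (at x) u" for x u v w
  have dS: "(\<lambda>x. S x v w) differentiable (at x)" if "x \<in> V" for x v w
    using smooth_on_derivative[OF S(4) that] differentiable_def by blast
  have bilDS: "bilinear (DS x u)" "linear (\<lambda>u. DS x u v w)" if "x \<in> V" for x u v w
    unfolding DS_def
    by (rule bilinear_frechet_derivative_family[OF V(1) that S(1) dS[OF that]], assumption)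
      (rule linear_frechet_derivative[OF dS[OF that]])
  have smDS: "smooth_on V (\<lambda>x. DS x u v w)" for u v w
    unfolding DS_def by (rule smooth_on_frechet_derivative[OF S(4)])
  obtain C10 where C10: "\<And>y u v w. y \<in> J \<Longrightarrow> norm (DS (snd (F y)) u v w) \<le> C10 * (norm u * (norm v * norm w))"
    using trilinear_family_bound_compact[OF J(1), of "\<lambda>y. DS (snd (F y))"] bilDS[OF JV(1)]
      contV[OF smooth_on_imp_continuous_on[OF smDS]] by blast
  note C10 = C10[unfolded real_norm_def]
  have bilG: "bilinear (G y)" if "y \<in> U" for y
    unfolding bilinear_def
    by (auto intro!: linearI simp: G(1)[OF that] linear_add[OF linDF[OF that]] linear_scale[OF linDF[OF that]]
        bilinear_ladd[OF bilinear_warped_form[of S "F y" h \<rho>, OF S(1)[OF sV(2)[OF that]]]]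
        bilinear_radd[OF bilinear_warped_form[of S "F y" h \<rho>, OF S(1)[OF sV(2)[OF that]]]]
        bilinear_lmul[OF bilinear_warped_form[of S "F y" h \<rho>, OF S(1)[OF sV(2)[OF that]]]]
        bilinear_rmul[OF bilinear_warped_form[of S "F y" h \<rho>, OF S(1)[OF sV(2)[OF that]]]])
  have symG: "G y v w = G y w v" if "y \<in> U" for y v w
    using S(2)[OF sV(2)[OF that], of "snd (DF y v)"] by (simp add: G(1)[OF that] warped_form_def mult.commute)
  note cG = continuous_on_subset[OF smooth_on_imp_continuous_on[OF G(2)] J(2)]
  obtain C11 where C11: "\<And>y v w. y \<in> J \<Longrightarrow> norm (G y v w) \<le> C11 * (norm v * norm w)"
    using bilinear_family_bound_compact[OF J(1), of G] bilG[OF JU] cG by blast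
  note C11 = C11[unfolded real_norm_def]
  obtain c2 where c2: "c2 > 0" "\<And>y v. y \<in> J \<Longrightarrow> c2 * (norm v)\<^sup>2 \<le> G y v v"
    using positive_definite_family_bound_compact[OF J(1), of G] bilG[OF JU] cG G(3)[OF JU] by blast
  \<comment> \<open>The time part of the warped form is nonpositive, so c2 |v|^2 \<le> G(v, v) is at
    most \<rho>^2 times \<sigma> on the spatial part of \<open>DF y v\<close>. Being spacelike thus
    bounds the derivative of the projection to the second factor from below.\<close>
  define Q where "Q = C3\<^sup>2 * \<bar>C9\<bar> / c2"
  have Q: "(norm v)\<^sup>2 \<le> Q * (norm (snd (DF y v)))\<^sup>2" if y: "y \<in> J" for y v
  proof -
    have "c2 * (norm v)\<^sup>2 \<le> (\<rho> (fst (F y)))\<^sup>2 * S (snd (F y)) (snd (DF y v)) (snd (DF y v))"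
      using c2(2)[OF y, of v] zero_le_mult_iff
      by (simp add: G(1)[OF JU[OF y]] warped_form_def) (smt (verit) zero_le_square mult_nonneg_nonneg zero_le_power2)
    also have "\<dots> \<le> C3\<^sup>2 * (\<bar>C9\<bar> * (norm (snd (DF y v)))\<^sup>2)"
    proof (rule mult_mono)
      show "(\<rho> (fst (F y)))\<^sup>2 \<le> C3\<^sup>2"
        using power_mono[OF C3[OF y] abs_ge_zero, of 2] by simp
      have "S (snd (F y)) (snd (DF y v)) (snd (DF y v)) \<le> C9 * (norm (snd (DF y v)))\<^sup>2"
        using C9[OF y, of "snd (DF y v)" "snd (DF y v)"] by (simp add: power2_eq_square)
      also have "\<dots> \<le> \<bar>C9\<bar> * (norm (snd (DF y v)))\<^sup>2"
        by (intro mult_right_mono) auto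
      finally show "S (snd (F y)) (snd (DF y v)) (snd (DF y v)) \<le> \<bar>C9\<bar> * (norm (snd (DF y v)))\<^sup>2" .
      show "0 \<le> S (snd (F y)) (snd (DF y v)) (snd (DF y v))"
        using c1(2)[OF y, of "snd (DF y v)"] c1(1) by (meson less_imp_le mult_nonneg_nonneg order_trans zero_le_power2)
    qed simp
    finally show ?thesis
      using c2(1) by (simp add: Q_def field_simps)
  qed
  \<comment> \<open>Merges all bounds into one constant; the entry 1 ensures that powers of
    \<open>K\<close> are increasing.\<close>
  define A where "A = {1, C1, C2, C3, C4, C5, C6, C7, C8, C9, C10, C11, 1 / c1, 1 / c2, Q}"
  define K where "K = Max A"
  have A_le: "c \<le> K" if "c \<in> A" for c
    unfolding K_def using that by (intro Max_ge) (simp_all add: A_def)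
  have K: "1 \<le> K" "C1 \<le> K" "C2 \<le> K" "C3 \<le> K" "C4 \<le> K" "C5 \<le> K" "C6 \<le> K" "C7 \<le> K" "C8 \<le> K" "C9 \<le> K"
    "C10 \<le> K" "C11 \<le> K" "1 / c1 \<le> K" "1 / c2 \<le> K" "Q \<le> K"
    by (rule A_le, simp add: A_def)+
  \<comment> \<open>Takes square roots in quadratic bounds without changing the constant, as K \<le>
    K^2.\<close>
  have K_sq: "x \<le> K * y" if "x\<^sup>2 \<le> K * y\<^sup>2" "0 \<le> y" for x y :: real
  proof (rule power2_le_imp_le)
    have "K * y\<^sup>2 \<le> K\<^sup>2 * y\<^sup>2"
      using K(1) by (intro mult_right_mono) (auto simp: power2_eq_square)
    then show "x\<^sup>2 \<le> (K * y)\<^sup>2"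
      using that by (simp add: power_mult_distrib)
  qed (use K that in auto)
  define m where "m = real DIM('e)"
  \<comment> \<open>One summand for each of the three clauses of the conclusion.\<close>
  define C where "C = K + m * K\<^sup>2 + m * 10 * K ^ 24"
  have m: "m > 0"
    by (simp add: m_def)
  have C: "C > 0" "K \<le> C" "m * K\<^sup>2 \<le> C" "m * 10 * K ^ 24 \<le> C"
    using K(1) m by (simp_all add: C_def add_pos_nonneg)
  show ?thesis
  proof (intro exI conjI ballI allI impI)
    show "r > 0" "C > 0" "ball y0 r \<subseteq> U"
      using r C by auto
    fix y E n N
    assume "y \<in> ball y0 r" and E: "orthonormal_basis (G y) E"
      and normal: "\<forall>v. warped_form h \<rho> S (F y) n (DF y v) = 0"
      and unit: "warped_form h \<rho> S (F y) n n = -1" and n: "fst n > 0"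
      and mean: "DIM('e) * deriv \<rho> (fst (F y)) / (h (snd (F y)) * \<rho> (fst (F y))) \<le>
        - warped_form h \<rho> S (F y)
          (\<Sum>e\<in>E. D2F y e e + levi_civita_form (warped_form h \<rho> S) (F y) (DF y e) (DF y e)) n"
      and N: "0 \<le> N" "\<forall>v. \<bar>fst (DF y v)\<bar> \<le> N * norm v"
    then have y: "y \<in> J"
      by (simp add: J_def)
    note yU = JU[OF y] and yV = JV[OF y]
    have fin: "finite E" and card: "card E = DIM('e)"
      using orthonormal_basis_finite_card[OF E] by auto
    have G1: "G y e e = 1" if "e \<in> E" for e
      using E that by (simp add: orthonormal_basis_def)
    have ne: "norm e \<le> K" if e: "e \<in> E" for e
    proof -
      have "(norm e)\<^sup>2 \<le> 1 / c2"
        using c2(2)[OF y, of e] c2(1) G1[OF e] by (simp add: field_simps)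
      then show ?thesis
        using K_sq[of "norm e" 1] K(14) by simp
    qed
    show "(norm w)\<^sup>2 \<le> C * (\<Sum>e\<in>E. (e \<bullet> w)\<^sup>2)" for w
    proof -
      have "G y v v \<le> K * (norm v)\<^sup>2" for v
      proof -
        have "G y v v \<le> C11 * (norm v)\<^sup>2"
          using C11[OF y, of v v] by (simp add: power2_eq_square)
        also have "\<dots> \<le> K * (norm v)\<^sup>2"
          using K by (intro mult_right_mono) auto
        finally show ?thesis .
      qed
      then have "(norm w)\<^sup>2 \<le> K * (\<Sum>e\<in>E. (e \<bullet> w)\<^sup>2)"
        by (rule norm_le_sum_orthonormal_basis[OF bilG[OF yU] symG[OF yU] E])
      also have "\<dots> \<le> C * (\<Sum>e\<in>E. (e \<bullet> w)\<^sup>2)"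
        using C by (intro mult_right_mono sum_nonneg) auto
      finally show ?thesis .
    qed
    have "(\<Sum>e\<in>E. (norm e)\<^sup>2) \<le> (\<Sum>e\<in>E. K\<^sup>2)"
      using ne by (intro sum_mono power_mono) auto
    then show "(\<Sum>e\<in>E. (norm e)\<^sup>2) \<le> C"
      using C(3) card by (simp add: m_def)
    have weaken: "x \<le> K * z" if "x \<le> c * z" "c \<le> K" "0 \<le> z" for x c z :: real
      using that by (meson mult_right_mono order_trans)
    let ?z = "F y" and ?h = "h (snd (F y))" and ?r = "\<rho> (fst (F y))" and ?S = "S (snd (F y))"
    obtain b Y where nb: "n = (b, Y)"
      by (cases n)
    have bilW: "bilinear (warped_form h \<rho> S ?z)"
      by (intro bilinear_warped_form S yV)
    note Dh = has_derivative_linear[OF smooth_on_derivative[OF V(2) yV(1)]]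
    have normDF: "norm (snd (DF y v)) \<le> norm (DF y v)" "\<bar>fst (DF y v)\<bar> \<le> norm (DF y v)" for v
      using norm_snd_le[of "snd (DF y v)" "fst (DF y v)"] norm_fst_le[of "fst (DF y v)" "snd (DF y v)"] by auto
    \<comment> \<open>The estimate wants a gradient bound that is at most \<open>K\<close>, whereas
      \<open>N\<close> is arbitrary. By \<open>C6\<close>, \<open>K\<close> itself bounds the time
      derivative, so the minimum does too.\<close>
    have "(\<Sum>e\<in>E. fst (D2F y e e)) \<ge> - (card E * 10 * K ^ 24 * min N K)"
    proof (rule spacelike_trace_estimate[where Du = "\<lambda>v. fst (DF y v)" and Df = "\<lambda>v. snd (DF y v)"
          and d2f = "\<lambda>v. snd (D2F y v v)" and Dh = "frechet_derivative h (at (snd (F y)))"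
          and h = ?h and r = ?r and ?r1.0 = "deriv \<rho> (fst (F y))" and S = ?S and DS = "DS (snd (F y))" and b = b and Y = Y])
      show "1 \<le> K" "0 \<le> min N K" "min N K \<le> K" "finite E"
        using K N fin by auto
      show "\<bar>fst (DF y v)\<bar> \<le> min N K * norm v" for v
        using N(2) order_trans[OF normDF(2) weaken[OF C6[OF y] K(7)]] by (simp add: min_def)
      show "0 < ?h" "0 < ?r"
        using V(3)[OF yV(1)] I(3)[OF yV(2)] by auto
      show "?h \<le> K" "inverse ?h \<le> K" "?r \<le> K" "inverse ?r \<le> K" "\<bar>deriv \<rho> (fst (F y))\<bar> \<le> K"
        using C1[OF y] C2[OF y] C3[OF y] C4[OF y] C5[OF y] K by linarith+
      show "linear (\<lambda>v. snd (DF y v))"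
        using linDF[OF yU] by (auto intro!: linearI simp: linear_add linear_scale)
      show "norm (snd (DF y v)) \<le> K * norm v" for v
        using order_trans[OF normDF(1) weaken[OF C6[OF y] K(7)]] by simp
      show "norm v \<le> K * norm (snd (DF y v))" for v
        by (rule K_sq[OF weaken[OF Q[OF y] K(15)]]) simp_all
      show "norm (snd (D2F y v v)) \<le> K * (norm v * norm v)" for v
        using order_trans[OF norm_snd_le[of "snd (D2F y v v)" "fst (D2F y v v)"]]
          weaken[OF C7[OF y, of v v] K(8)] by simp
      show "linear (frechet_derivative h (at (snd (F y))))"
        by (rule Dh)
      show "\<bar>frechet_derivative h (at (snd (F y))) v\<bar> \<le> K * norm v" for v
        using weaken[OF C8[OF y] K(9)] by simp
      show "bilinear ?S"
        by (intro S yV)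
      show "\<bar>?S v w\<bar> \<le> K * (norm v * norm w)" for v w
        using weaken[OF C9[OF y] K(10)] by simp
      show "(norm v)\<^sup>2 \<le> K * ?S v v" for v
      proof -
        have "(norm v)\<^sup>2 \<le> 1 / c1 * ?S v v"
          using c1(2)[OF y, of v] c1(1) by (simp add: field_simps)
        moreover have "0 \<le> ?S v v"
          using c1(2)[OF y, of v] c1(1) by (meson less_imp_le mult_nonneg_nonneg order_trans zero_le_power2)
        ultimately show ?thesis
          using weaken[OF _ K(13)] by simp
      qed
      show "bilinear (DS (snd (F y)) u)" "linear (\<lambda>u. DS (snd (F y)) u v w)" for u v w
        using bilDS[OF yV(1)] by auto
      show "\<bar>DS (snd (F y)) u v w\<bar> \<le> K * (norm u * (norm v * norm w))" for u v w
        using weaken[OF C10[OF y] K(11)] by simp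
      show "norm e \<le> K" if "e \<in> E" for e
        using ne[OF that] .
      show "- ?h\<^sup>2 * (fst (DF y e))\<^sup>2 + ?r\<^sup>2 * ?S (snd (DF y e)) (snd (DF y e)) = 1" if "e \<in> E" for e
        using G1[OF that] by (simp add: G(1)[OF yU] warped_form_def power2_eq_square)
      show "0 < b" "- ?h\<^sup>2 * b\<^sup>2 + ?r\<^sup>2 * ?S Y Y = -1"
        using n unit by (simp_all add: nb warped_form_def power2_eq_square)
      show "?r\<^sup>2 * ?S Y (snd (DF y v)) = ?h\<^sup>2 * b * fst (DF y v)" for v
        using normal[rule_format, of v] by (simp add: nb warped_form_def)
      have lW: "linear (\<lambda>v. warped_form h \<rho> S ?z v n)"
        using bilW unfolding bilinear_def by blast
      have "warped_form h \<rho> S ?z (D2F y e e + levi_civita_form (warped_form h \<rho> S) ?z (DF y e) (DF y e)) n =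
          - ?h\<^sup>2 * b * fst (D2F y e e) + ?r\<^sup>2 * ?S (snd (D2F y e e)) Y
          - 2 * ?h * frechet_derivative h (at (snd (F y))) (snd (DF y e)) * fst (DF y e) * b
          + 2 * ?r * deriv \<rho> (fst (F y)) * fst (DF y e) * ?S (snd (DF y e)) Y
          + ?h * frechet_derivative h (at (snd (F y))) Y * (fst (DF y e))\<^sup>2
          - ?r * deriv \<rho> (fst (F y)) * b * ?S (snd (DF y e)) (snd (DF y e))
          + ?r\<^sup>2 * (DS (snd (F y)) (snd (DF y e)) (snd (DF y e)) Y - DS (snd (F y)) Y (snd (DF y e)) (snd (DF y e)) / 2)"
        for e
      proof -
        have "warped_form h \<rho> S ?z (D2F y e e) n = - ?h\<^sup>2 * b * fst (D2F y e e) + ?r\<^sup>2 * ?S (snd (D2F y e e)) Y"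
          by (simp add: nb warped_form_def)
        moreover have "warped_form h \<rho> S ?z (levi_civita_form (warped_form h \<rho> S) ?z
            (fst (DF y e), snd (DF y e)) (fst (DF y e), snd (DF y e))) (b, Y) =
          - 2 * ?h * frechet_derivative h (at (snd (F y))) (snd (DF y e)) * fst (DF y e) * b
          + 2 * ?r * deriv \<rho> (fst (F y)) * fst (DF y e) * ?S (snd (DF y e)) Y
          + ?h * frechet_derivative h (at (snd (F y))) Y * (fst (DF y e))\<^sup>2
          - ?r * deriv \<rho> (fst (F y)) * b * ?S (snd (DF y e)) (snd (DF y e))
          + ?r\<^sup>2 * (frechet_derivative (\<lambda>x. S x (snd (DF y e)) Y) (at (snd (F y))) (snd (DF y e))
              - frechet_derivative (\<lambda>x. S x (snd (DF y e)) (snd (DF y e))) (at (snd (F y))) Y / 2)"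
          by (rule warped_form_koszul[of I _ _ V]; (rule I V S yV; assumption)?)
        ultimately show ?thesis
          unfolding linear_add[OF lW] DS_def unfolding nb prod.collapse by linarith
      qed
      then show "card E * deriv \<rho> (fst (F y)) / (?h * ?r) \<le>
        - (\<Sum>e\<in>E. - ?h\<^sup>2 * b * fst (D2F y e e) + ?r\<^sup>2 * ?S (snd (D2F y e e)) Y
          - 2 * ?h * frechet_derivative h (at (snd (F y))) (snd (DF y e)) * fst (DF y e) * b
          + 2 * ?r * deriv \<rho> (fst (F y)) * fst (DF y e) * ?S (snd (DF y e)) Y
          + ?h * frechet_derivative h (at (snd (F y))) Y * (fst (DF y e))\<^sup>2
          - ?r * deriv \<rho> (fst (F y)) * b * ?S (snd (DF y e)) (snd (DF y e))
          + ?r\<^sup>2 * (DS (snd (F y)) (snd (DF y e)) (snd (DF y e)) Y - DS (snd (F y)) Y (snd (DF y e)) (snd (DF y e)) / 2))"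
        using mean by (simp only: card linear_sum[OF lW])
    qed
    moreover have "card E * 10 * K ^ 24 * min N K \<le> C * N"
      using C(1,4) N(1) K(1) by (intro mult_mono) (auto simp: card m_def)
    ultimately show "- (C * N) \<le> (\<Sum>e\<in>E. fst (D2F y e e))"
      by linarith
  qed
qed

section \<open>Charts and tangent vectors\<close>

lemma chart_dom_subset_points: "c \<in> M \<Longrightarrow> chart_dom c \<subseteq> points M"
  by (auto simp: points_def)

lemma smooth_manifold_homeomorphism:
  "smooth_manifold M \<Longrightarrow> c \<in> M \<Longrightarrow>
    homeomorphism (chart_dom c) (chart_map c ` chart_dom c) (chart_map c) (chart_inv c)"
  by (simp add: smooth_manifold_def)

lemma smooth_manifold_open_image: "smooth_manifold M \<Longrightarrow> c \<in> M \<Longrightarrow> open (chart_map c ` chart_dom c)"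
  by (simp add: smooth_manifold_def)

lemma smooth_manifold_openin_dom:
  "smooth_manifold M \<Longrightarrow> c \<in> M \<Longrightarrow> openin (top_of_set (points M)) (chart_dom c)"
  by (simp add: smooth_manifold_def)

lemma chart_inv_chart_map:
  "smooth_manifold M \<Longrightarrow> c \<in> M \<Longrightarrow> p \<in> chart_dom c \<Longrightarrow> chart_inv c (chart_map c p) = p"
  using homeomorphism_apply1[OF smooth_manifold_homeomorphism] .

lemma open_chart_image:
  assumes M: "smooth_manifold M" "c \<in> M" and U: "openin (top_of_set (points M)) U"
  shows "open (chart_map c ` (chart_dom c \<inter> U))"
proof -
  have "openin (top_of_set (chart_dom c)) (chart_dom c \<inter> U)"
    using U chart_dom_subset_points[OF M(2)] smooth_manifold_openin_dom[OF M]
    by (meson inf_le1 openin_Int openin_subset_trans)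
  then have "openin (top_of_set (chart_map c ` chart_dom c)) (chart_map c ` (chart_dom c \<inter> U))"
    using homeomorphism_imp_open_map[OF smooth_manifold_homeomorphism[OF M]] by blast
  then show ?thesis
    using smooth_manifold_open_image[OF M] openin_open_trans by blast
qed

lemma openin_chart_inv_image:
  assumes M: "smooth_manifold M" "c \<in> M" and W: "open W" "W \<subseteq> chart_map c ` chart_dom c"
  shows "openin (top_of_set (points M)) (chart_inv c ` W)"
proof -
  have "openin (top_of_set (chart_map c ` chart_dom c)) W"
    using W by (simp add: openin_open_eq smooth_manifold_open_image[OF M])
  then have "openin (top_of_set (chart_dom c)) (chart_inv c ` W)"
    using homeomorphism_imp_open_map[OF homeomorphism_symD[OF smooth_manifold_homeomorphism[OF M]]] by blast
  then show ?thesis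
    using smooth_manifold_openin_dom[OF M] openin_trans by blast
qed

lemma openin_preimage_dom:
  assumes "smooth_manifold N" "d \<in> N" "continuous_on (points M) F" "F ` points M \<subseteq> points N"
    "openin (top_of_set (points N)) U"
  shows "openin (top_of_set (points M)) (points M \<inter> F -` (chart_dom d \<inter> U))"
  using assms smooth_manifold_openin_dom[OF assms(1,2)]
  by (intro continuous_openin_preimage[where T = "points N"]) auto

lemma open_local_rep_domain:
  assumes M: "smooth_manifold M" "c \<in> M" and N: "smooth_manifold N" "d \<in> N" and F: "smooth_map M N F"
  shows "open (chart_map c ` (chart_dom c \<inter> F -` chart_dom d))"
proof -
  have "openin (top_of_set (points M)) (points M \<inter> F -` (chart_dom d \<inter> points N))"
    using F by (intro openin_preimage_dom[OF N]) (auto simp: smooth_map_def)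
  moreover have "chart_dom c \<inter> F -` chart_dom d = chart_dom c \<inter> (points M \<inter> F -` (chart_dom d \<inter> points N))"
    using chart_dom_subset_points[OF M(2)] chart_dom_subset_points[OF N(2)] by auto
  ultimately show ?thesis
    using open_chart_image[OF M] by simp
qed

text \<open>The neighbourhood is shrunk until \<open>F\<close> maps it into a single chart
  \<open>d\<close>; there the composite, seen in any chart of \<open>M\<close>, is a composite of
  two smooth coordinate expressions.\<close>

lemma smooth_near_compose:
  assumes M: "smooth_manifold M" and N: "smooth_manifold N" and F: "smooth_map M N F"
    and p: "p \<in> points M" and f: "smooth_near N (F p) f"
  shows "smooth_near M p (f \<circ> F)"
proof -
  obtain U where U: "openin (top_of_set (points N)) U" "F p \<in> U" "smooth_fun_on N U f"
    using f by (auto simp: smooth_near_def)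
  have "F p \<in> points N"
    using F p by (auto simp: smooth_map_def)
  then obtain d where d: "d \<in> N" "F p \<in> chart_dom d"
    by (auto simp: points_def)
  define U' where "U' = points M \<inter> F -` (chart_dom d \<inter> U)"
  have U': "openin (top_of_set (points M)) U'"
    unfolding U'_def using F by (intro openin_preimage_dom[OF N d(1)] U) (auto simp: smooth_map_def)
  have "smooth_on (chart_map c ` (chart_dom c \<inter> U')) ((f \<circ> F) \<circ> chart_inv c)" if c: "c \<in> M" for c
  proof -
    let ?W = "chart_map c ` (chart_dom c \<inter> U')"
    have oW: "open ?W"
      by (rule open_chart_image[OF M c U'])
    have "smooth_on (chart_map c ` (chart_dom c \<inter> F -` chart_dom d)) (local_rep c d F)"
      using F c d(1) unfolding smooth_map_def by blast
    then have 1: "smooth_on ?W (local_rep c d F)"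
      by (rule smooth_on_subset) (unfold U'_def, blast)
    have 2: "smooth_on (chart_map d ` (chart_dom d \<inter> U)) (f \<circ> chart_inv d)"
      using U(3) d by (simp add: smooth_fun_on_def)
    have 3: "local_rep c d F ` ?W \<subseteq> chart_map d ` (chart_dom d \<inter> U)"
      using chart_inv_chart_map[OF M c] by (auto simp: local_rep_def U'_def)
    have "smooth_on ?W (\<lambda>x. (f \<circ> chart_inv d) (local_rep c d F x))"
      by (rule smooth_on_compose[OF oW open_chart_image[OF N d(1) U(1)] 1 2 3])
    moreover have "(f \<circ> chart_inv d) (local_rep c d F x) = ((f \<circ> F) \<circ> chart_inv c) x" if "x \<in> ?W" for x
      using that chart_inv_chart_map[OF M c] chart_inv_chart_map[OF N d(1)] by (auto simp: local_rep_def U'_def)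
    ultimately show ?thesis
      by (rule smooth_on_eq[OF oW])
  qed
  then show ?thesis
    using U' p U(2) d unfolding smooth_near_def smooth_fun_on_def by (intro exI[of _ U']) (auto simp: U'_def)
qed

text \<open>The chain rule in charts. For functions that are not smooth near \<open>F p\<close> both
  sides are 0 by convention; for the others \<open>smooth_near_compose\<close> guarantees that the
  inner tangent vector does not fall back to 0.\<close>

lemma differential_coord_tangent:
  assumes M: "smooth_manifold M" and N: "smooth_manifold N" and F: "smooth_map M N F"
    and c: "c \<in> M" "p \<in> chart_dom c" and d: "d \<in> N" "F p \<in> chart_dom d"
  shows "differential N F p (coord_tangent M c p v) =
    coord_tangent N d (F p) (frechet_derivative (local_rep c d F) (at (chart_map c p)) v)"
proof
  fix f
  let ?y = "chart_map c p" and ?L = "local_rep c d F"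
  show "differential N F p (coord_tangent M c p v) f =
      coord_tangent N d (F p) (frechet_derivative ?L (at ?y) v) f"
  proof (cases "smooth_near N (F p) f")
    case True
    have pM: "p \<in> points M"
      using c chart_dom_subset_points by blast
    obtain U where U: "openin (top_of_set (points N)) U" "F p \<in> U" "smooth_fun_on N U f"
      using True by (auto simp: smooth_near_def)
    let ?W = "chart_map c ` (chart_dom c \<inter> F -` chart_dom d)"
    have W: "open ?W" "?y \<in> ?W"
      using open_local_rep_domain[OF M c(1) N d(1) F] c d by auto
    have Ly: "?L ?y = chart_map d (F p)"
      using chart_inv_chart_map[OF M c] by (simp add: local_rep_def)
    have "(?L has_derivative frechet_derivative ?L (at ?y)) (at ?y)"
      using F c d W(2) by (intro smooth_on_derivative[of ?W]) (auto simp: smooth_map_def)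
    moreover have "((f \<circ> chart_inv d) has_derivative frechet_derivative (f \<circ> chart_inv d) (at (?L ?y))) (at (?L ?y))"
      using U d by (intro smooth_on_derivative[of "chart_map d ` (chart_dom d \<inter> U)"])
        (auto simp: smooth_fun_on_def Ly)
    ultimately have "((\<lambda>x. (f \<circ> chart_inv d) (?L x)) has_derivative
        (\<lambda>v. frechet_derivative (f \<circ> chart_inv d) (at (?L ?y)) (frechet_derivative ?L (at ?y) v))) (at ?y)"
      by (rule has_derivative_compose)
    moreover have "(f \<circ> chart_inv d) (?L x) = ((f \<circ> F) \<circ> chart_inv c) x" if "x \<in> ?W" for x
      using that chart_inv_chart_map[OF M c(1)] chart_inv_chart_map[OF N d(1)] by (auto simp: local_rep_def)
    ultimately have "((f \<circ> F) \<circ> chart_inv c has_derivative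
        (\<lambda>v. frechet_derivative (f \<circ> chart_inv d) (at (?L ?y)) (frechet_derivative ?L (at ?y) v))) (at ?y)"
      by (rule has_derivative_transform_within_open[OF _ W])
    from frechet_derivative_at[OF this, symmetric] show ?thesis
      using True smooth_near_compose[OF M N F pM True]
      by (simp add: differential_def coord_tangent_def Ly)
  qed (simp add: differential_def coord_tangent_def)
qed

lemma smooth_map_ident: "smooth_manifold M \<Longrightarrow> smooth_map M M (\<lambda>p. p)"
  by (auto simp: smooth_map_def smooth_manifold_def local_rep_def o_def vimage_def Int_def)

text \<open>The case of the identity map in \<open>differential_coord_tangent\<close>. Its
  differential fixes coordinate tangent vectors because these already vanish on functions that are
  not smooth near \<open>p\<close>.\<close>

lemma coord_tangent_change_chart:
  assumes "smooth_manifold M" "c \<in> M" "p \<in> chart_dom c" "d \<in> M" "p \<in> chart_dom d"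
  shows "\<exists>w. coord_tangent M c p v = coord_tangent M d p w"
proof -
  have "differential M (\<lambda>p. p) p (coord_tangent M c p v) = coord_tangent M c p v"
    by (auto simp: differential_def coord_tangent_def o_def)
  with differential_coord_tangent[OF assms(1) assms(1) smooth_map_ident[OF assms(1)] assms(2-5), of v]
  show ?thesis
    by (intro exI) (rule trans[OF sym])
qed

section \<open>Product manifolds and intervals\<close>

lemma chart_prod_simps [simp]:
  "chart_dom (A, f) = A" "chart_map (A, f) = f"
  by (simp_all add: chart_dom_def chart_map_def)

definition prod_chart :: "('a, 'e) chart \<Rightarrow> ('b, 'f) chart \<Rightarrow> ('a \<times> 'b, 'e \<times> 'f) chart" where
  "prod_chart c d = (chart_dom c \<times> chart_dom d, map_prod (chart_map c) (chart_map d))"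

lemma prod_manifold_eq: "prod_manifold M N = {prod_chart c d | c d. c \<in> M \<and> d \<in> N}"
  by (simp add: prod_manifold_def prod_chart_def)

lemma points_prod_manifold: "points (prod_manifold M N) = points M \<times> points N"
  by (auto simp: points_def prod_manifold_def) blast

lemma chart_inv_prod_chart:
  assumes "smooth_manifold M" "c \<in> M" "smooth_manifold N" "d \<in> N"
    and "y \<in> chart_map c ` chart_dom c \<times> chart_map d ` chart_dom d"
  shows "chart_inv (prod_chart c d) y = (chart_inv c (fst y), chart_inv d (snd y))"
proof -
  obtain p q where y: "y = (chart_map c p, chart_map d q)" "p \<in> chart_dom c" "q \<in> chart_dom d"
    using assms(5) by auto
  have inj: "inj_on (chart_map c) (chart_dom c)" "inj_on (chart_map d) (chart_dom d)"
    using chart_inv_chart_map[OF assms(1,2)] chart_inv_chart_map[OF assms(3,4)] by (metis inj_onI)+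
  have "inv_into (chart_dom c \<times> chart_dom d) (map_prod (chart_map c) (chart_map d))
      (map_prod (chart_map c) (chart_map d) (p, q)) = (p, q)"
    using y by (intro inv_into_f_f map_prod_inj_on inj) auto
  then show ?thesis
    using chart_inv_chart_map[OF assms(1,2) y(2)] chart_inv_chart_map[OF assms(3,4) y(3)]
    by (simp add: y(1) chart_inv_def prod_chart_def)
qed

lemma smooth_manifold_prod:
  assumes M: "smooth_manifold M" and N: "smooth_manifold N"
  shows "smooth_manifold (prod_manifold M N)"
  unfolding smooth_manifold_def
proof (intro conjI ballI)
  fix a assume "a \<in> prod_manifold M N"
  then obtain c d where a: "a = prod_chart c d" and c: "c \<in> M" and d: "d \<in> N"
    by (auto simp: prod_manifold_eq)
  have im: "chart_map a ` chart_dom a = chart_map c ` chart_dom c \<times> chart_map d ` chart_dom d"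
    by (simp add: a prod_chart_def map_prod_image)
  note inv = chart_inv_prod_chart[OF M c N d]
  note hc = smooth_manifold_homeomorphism[OF M c] and hd = smooth_manifold_homeomorphism[OF N d]
  show "openin (top_of_set (points (prod_manifold M N))) (chart_dom a)"
    using smooth_manifold_openin_dom[OF M c] smooth_manifold_openin_dom[OF N d]
    by (simp add: a prod_chart_def points_prod_manifold openin_Times)
  show "open (chart_map a ` chart_dom a)"
    unfolding im by (intro open_Times smooth_manifold_open_image[OF M c] smooth_manifold_open_image[OF N d])
  show "homeomorphism (chart_dom a) (chart_map a ` chart_dom a) (chart_map a) (chart_inv a)"
  proof (rule homeomorphismI)
    show "continuous_on (chart_dom a) (chart_map a)"
      using homeomorphism_cont1[OF hc] homeomorphism_cont1[OF hd]
      by (auto simp: a prod_chart_def map_prod_def split_beta intro!: continuous_on_Pair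
          intro: continuous_on_compose2[OF _ continuous_on_fst[OF continuous_on_id]]
            continuous_on_compose2[OF _ continuous_on_snd[OF continuous_on_id]])
    have "continuous_on (chart_map c ` chart_dom c \<times> chart_map d ` chart_dom d)
        (\<lambda>y. (chart_inv c (fst y), chart_inv d (snd y)))"
      by (intro continuous_on_Pair
          continuous_on_compose2[OF homeomorphism_cont2[OF hc] continuous_on_fst[OF continuous_on_id]]
          continuous_on_compose2[OF homeomorphism_cont2[OF hd] continuous_on_snd[OF continuous_on_id]]) auto
    then show "continuous_on (chart_map a ` chart_dom a) (chart_inv a)"
      unfolding im unfolding a by (rule continuous_on_eq) (simp only: inv)
    show inv1: "chart_inv a (chart_map a p) = p" if "p \<in> chart_dom a" for p
      using that inv[of "chart_map a p"] chart_inv_chart_map[OF M c] chart_inv_chart_map[OF N d]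
      by (auto simp: a prod_chart_def)
    show "chart_inv a ` chart_map a ` chart_dom a \<subseteq> chart_dom a"
      using inv1 by auto
    show "chart_map a (chart_inv a y) = y" if "y \<in> chart_map a ` chart_dom a" for y
      using that inv1 by auto
  qed auto
next
  fix a b assume "a \<in> prod_manifold M N" "b \<in> prod_manifold M N"
  then obtain c d c' d' where a: "a = prod_chart c d" "c \<in> M" "d \<in> N"
    and b: "b = prod_chart c' d'" "c' \<in> M" "d' \<in> N"
    by (auto simp: prod_manifold_eq)
  let ?W = "chart_map c ` (chart_dom c \<inter> chart_dom c')" and ?W' = "chart_map d ` (chart_dom d \<inter> chart_dom d')"
  have im: "chart_map a ` (chart_dom a \<inter> chart_dom b) = ?W \<times> ?W'"
    by (simp add: a b prod_chart_def map_prod_image Times_Int_Times)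
  have o: "open ?W" "open ?W'"
    using open_chart_image[OF M a(2) smooth_manifold_openin_dom[OF M b(2)]]
      open_chart_image[OF N a(3) smooth_manifold_openin_dom[OF N b(3)]] by auto
  have tr: "smooth_on ?W (chart_map c' \<circ> chart_inv c)" "smooth_on ?W' (chart_map d' \<circ> chart_inv d)"
    using M N a b by (auto simp: smooth_manifold_def)
  have "smooth_on (?W \<times> ?W') (\<lambda>y. ((chart_map c' \<circ> chart_inv c) (fst y), (chart_map d' \<circ> chart_inv d) (snd y)))"
    using o
    by (intro smooth_on_Pair open_Times smooth_on_compose[OF _ o(1) _ tr(1)] smooth_on_compose[OF _ o(2) _ tr(2)]
        smooth_on_bounded_linear bounded_linear_fst bounded_linear_snd) auto
  moreover have "((chart_map c' \<circ> chart_inv c) (fst y), (chart_map d' \<circ> chart_inv d) (snd y)) =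
      (chart_map b \<circ> chart_inv a) y" if "y \<in> ?W \<times> ?W'" for y
    using that chart_inv_prod_chart[OF M a(2) N a(3), of y] by (auto simp: a(1) b(1) prod_chart_def)
  ultimately show "smooth_on (chart_map a ` (chart_dom a \<inter> chart_dom b)) (chart_map b \<circ> chart_inv a)"
    unfolding im by (rule smooth_on_eq[OF open_Times[OF o]])
qed

lemma local_rep_fst_snd:
  assumes M: "smooth_manifold M" "c \<in> M" and N: "smooth_manifold N" "d \<in> N"
    and y: "y \<in> chart_map c ` chart_dom c \<times> chart_map d ` chart_dom d"
  shows "local_rep (prod_chart c d) e fst y = (chart_map e \<circ> chart_inv c) (fst y)"
    "local_rep (prod_chart c d) e' snd y = (chart_map e' \<circ> chart_inv d) (snd y)"
  using chart_inv_prod_chart[OF M N y] by (simp_all add: local_rep_def)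

lemma smooth_map_fst_snd:
  assumes M: "smooth_manifold M" and N: "smooth_manifold N"
  shows "smooth_map (prod_manifold M N) M fst" "smooth_map (prod_manifold M N) N snd"
proof -
  have 1: "smooth_on (chart_map a ` (chart_dom a \<inter> fst -` chart_dom e)) (local_rep a e fst)"
    if mem: "a \<in> prod_manifold M N" and e: "e \<in> M" for a e
  proof -
    obtain c d where a: "a = prod_chart c d" and c: "c \<in> M" and d: "d \<in> N"
      using mem unfolding prod_manifold_eq by blast
    let ?W = "chart_map c ` (chart_dom c \<inter> chart_dom e)" and ?W' = "chart_map d ` chart_dom d"
    have im: "chart_map a ` (chart_dom a \<inter> fst -` chart_dom e) = ?W \<times> ?W'"
    proof -
      have "chart_dom a \<inter> fst -` chart_dom e = (chart_dom c \<inter> chart_dom e) \<times> chart_dom d"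
        by (auto simp: a prod_chart_def)
      then show ?thesis
        by (simp add: a prod_chart_def map_prod_image)
    qed
    have o: "open ?W" "open ?W'"
      using open_chart_image[OF M c smooth_manifold_openin_dom[OF M e]] smooth_manifold_open_image[OF N d] by auto
    have "smooth_on ?W (chart_map e \<circ> chart_inv c)"
      using M c e unfolding smooth_manifold_def by blast
    then have "smooth_on (?W \<times> ?W') (\<lambda>y. (chart_map e \<circ> chart_inv c) (fst y))"
      by (rule smooth_on_compose[OF open_Times[OF o] o(1)
            smooth_on_bounded_linear[OF open_Times[OF o] bounded_linear_fst]]) auto
    moreover have "(chart_map e \<circ> chart_inv c) (fst y) = local_rep a e fst y" if "y \<in> ?W \<times> ?W'" for y
      using local_rep_fst_snd(1)[OF M c N d, where e = e and y = y] that by (auto simp: a)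
    ultimately show ?thesis
      unfolding im by (rule smooth_on_eq[OF open_Times[OF o]])
  qed
  have 2: "smooth_on (chart_map a ` (chart_dom a \<inter> snd -` chart_dom e)) (local_rep a e snd)"
    if mem: "a \<in> prod_manifold M N" and e: "e \<in> N" for a e
  proof -
    obtain c d where a: "a = prod_chart c d" and c: "c \<in> M" and d: "d \<in> N"
      using mem unfolding prod_manifold_eq by blast
    let ?W = "chart_map c ` chart_dom c" and ?W' = "chart_map d ` (chart_dom d \<inter> chart_dom e)"
    have im: "chart_map a ` (chart_dom a \<inter> snd -` chart_dom e) = ?W \<times> ?W'"
    proof -
      have "chart_dom a \<inter> snd -` chart_dom e = chart_dom c \<times> (chart_dom d \<inter> chart_dom e)"
        by (auto simp: a prod_chart_def)
      then show ?thesis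
        by (simp add: a prod_chart_def map_prod_image)
    qed
    have o: "open ?W" "open ?W'"
      using open_chart_image[OF N d smooth_manifold_openin_dom[OF N e]] smooth_manifold_open_image[OF M c] by auto
    have "smooth_on ?W' (chart_map e \<circ> chart_inv d)"
      using N d e unfolding smooth_manifold_def by blast
    then have "smooth_on (?W \<times> ?W') (\<lambda>y. (chart_map e \<circ> chart_inv d) (snd y))"
      by (rule smooth_on_compose[OF open_Times[OF o] o(2)
            smooth_on_bounded_linear[OF open_Times[OF o] bounded_linear_snd]]) auto
    moreover have "(chart_map e \<circ> chart_inv d) (snd y) = local_rep a e snd y" if "y \<in> ?W \<times> ?W'" for y
      using local_rep_fst_snd(2)[OF M c N d, where e' = e and y = y] that by (auto simp: a)
    ultimately show ?thesis
      unfolding im by (rule smooth_on_eq[OF open_Times[OF o]])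
  qed
  show "smooth_map (prod_manifold M N) M fst" "smooth_map (prod_manifold M N) N snd"
    using 1 2 by (auto simp: smooth_map_def points_prod_manifold intro!: continuous_intros)
qed

text \<open>In a product chart the projections are represented by the linear maps \<open>fst\<close>
  and \<open>snd\<close>, though only on the image of the chart, an open set on which the
  derivatives are compared.\<close>

lemma differential_fst_snd:
  assumes M: "smooth_manifold M" "c \<in> M" and N: "smooth_manifold N" "d \<in> N"
    and z: "z \<in> chart_dom c \<times> chart_dom d"
  shows "differential M fst z (coord_tangent (prod_manifold M N) (prod_chart c d) z v) =
      coord_tangent M c (fst z) (fst v)"
    "differential N snd z (coord_tangent (prod_manifold M N) (prod_chart c d) z v) =
      coord_tangent N d (snd z) (snd v)"
proof -
  let ?a = "prod_chart c d" and ?W = "chart_map c ` chart_dom c" and ?W' = "chart_map d ` chart_dom d"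
  have a: "?a \<in> prod_manifold M N" "z \<in> chart_dom ?a"
    using M N z unfolding prod_manifold_eq by (blast, simp add: prod_chart_def)
  have W: "open (?W \<times> ?W')" "chart_map ?a z \<in> ?W \<times> ?W'"
    using z by (auto simp: prod_chart_def intro!: open_Times smooth_manifold_open_image[OF M] smooth_manifold_open_image[OF N])
  have inv: "chart_map c (chart_inv c (fst y)) = fst y" "chart_map d (chart_inv d (snd y)) = snd y"
    if "y \<in> ?W \<times> ?W'" for y
    using that chart_inv_chart_map[OF M] chart_inv_chart_map[OF N] by auto
  have eq: "local_rep ?a c fst y = fst y" "local_rep ?a d snd y = snd y" if "y \<in> ?W \<times> ?W'" for y
    by (simp_all add: local_rep_fst_snd[OF M N that] inv[OF that])
  have "frechet_derivative (local_rep ?a c fst) (at (chart_map ?a z)) = frechet_derivative fst (at (chart_map ?a z))"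
    "frechet_derivative (local_rep ?a d snd) (at (chart_map ?a z)) = frechet_derivative snd (at (chart_map ?a z))"
    by (rule frechet_derivative_cong_open[OF W eq(1)], assumption, rule frechet_derivative_cong_open[OF W eq(2)])
  moreover have "frechet_derivative fst (at y) = (fst :: 'b \<times> 'd \<Rightarrow> 'b)"
    "frechet_derivative snd (at y) = (snd :: 'b \<times> 'd \<Rightarrow> 'd)" for y
    by (rule frechet_derivative_at[symmetric]; auto intro!: derivative_eq_intros)+
  ultimately have D: "frechet_derivative (local_rep ?a c fst) (at (chart_map ?a z)) = fst"
    "frechet_derivative (local_rep ?a d snd) (at (chart_map ?a z)) = snd"
    by simp_all
  note MN = smooth_manifold_prod[OF M(1) N(1)] and sm = smooth_map_fst_snd[OF M(1) N(1)]
  have "fst z \<in> chart_dom c" "snd z \<in> chart_dom d"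
    using z by auto
  from differential_coord_tangent[OF MN M(1) sm(1) a M(2) this(1), of v]
    differential_coord_tangent[OF MN N(1) sm(2) a N(2) this(2), of v]
  show "differential M fst z (coord_tangent (prod_manifold M N) ?a z v) = coord_tangent M c (fst z) (fst v)"
    "differential N snd z (coord_tangent (prod_manifold M N) ?a z v) = coord_tangent N d (snd z) (snd v)"
    by (simp_all only: D)
qed

lemma smooth_manifold_interval: "open I \<Longrightarrow> smooth_manifold (interval_manifold I)"
proof -
  assume I: "open I"
  have inv: "chart_inv (I, \<lambda>t::real. t) t = t" if "t \<in> I" for t
    using that inv_into_f_f[of "\<lambda>t. t" I t] by (simp add: chart_inv_def inj_on_def)
  have "homeomorphism I I (\<lambda>t. t) (chart_inv (I, \<lambda>t::real. t))"
    using inv by (intro homeomorphismI) (auto cong: continuous_on_cong)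
  moreover have "smooth_on I (chart_inv (I, \<lambda>t::real. t))"
    using smooth_on_cong[OF I inv] smooth_on_bounded_linear[OF I bounded_linear_ident] by simp
  ultimately show ?thesis
    using I by (auto simp: smooth_manifold_def interval_manifold_def points_def o_def)
qed

text \<open>This is how \<open>dt_squared\<close> reads off the component of a vector. Smoothness of
  the identity near \<open>t\<close> has to be shown, as the tangent vector would otherwise return
  its default 0.\<close>

lemma coord_tangent_interval_ident:
  assumes I: "open I" "t \<in> I"
  shows "coord_tangent (interval_manifold I) (I, \<lambda>t. t) t v (\<lambda>s. s) = v"
proof -
  have inv: "chart_inv (I, \<lambda>t::real. t) t = t" if "t \<in> I" for t
    using that inv_into_f_f[of "\<lambda>t. t" I t] by (simp add: chart_inv_def inj_on_def)
  have "smooth_on I (\<lambda>x. chart_inv (I, \<lambda>t::real. t) x)"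
    using smooth_on_cong[OF I(1) inv] smooth_on_bounded_linear[OF I(1) bounded_linear_ident] by simp
  then have "smooth_near (interval_manifold I) t (\<lambda>s. s)"
    using I unfolding smooth_near_def smooth_fun_on_def
    by (intro exI[of _ I]) (simp add: interval_manifold_def points_def o_def)
  moreover have "frechet_derivative (chart_inv (I, \<lambda>t::real. t)) (at t) = frechet_derivative (\<lambda>t. t) (at t)"
    by (rule frechet_derivative_cong_open[OF I]) (rule inv)
  moreover have "frechet_derivative (\<lambda>t::real. t) (at t) = (\<lambda>v. v)"
    by (rule frechet_derivative_at[symmetric]) (rule has_derivative_ident)
  ultimately show ?thesis
    by (simp add: coord_tangent_def o_def)
qed

section \<open>The warped product spacetime\<close>

abbreviation warped_chart :: "real set \<Rightarrow> ('p, 'e) chart \<Rightarrow> (real \<times> 'p, real \<times> 'e) chart" where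
  "warped_chart I e \<equiv> prod_chart (I, \<lambda>t. t) e"

lemma interval_chart: "(I, \<lambda>t. t) \<in> interval_manifold I"
  by (simp add: interval_manifold_def)

lemma points_interval_manifold: "points (interval_manifold I) = I"
  by (simp add: interval_manifold_def points_def)

lemma doubly_warped_metric_coord_tangent:
  fixes P :: "('p::topological_space, 'e::euclidean_space) atlas"
  assumes I: "open I" and P: "smooth_manifold P" "e \<in> P" and z: "z \<in> I \<times> chart_dom e"
  shows "doubly_warped_metric I P h \<rho> \<sigma> z
      (coord_tangent (prod_manifold (interval_manifold I) P) (warped_chart I e) z v)
      (coord_tangent (prod_manifold (interval_manifold I) P) (warped_chart I e) z w) =
    warped_form (h \<circ> chart_inv e) \<rho> (metric_coeff P \<sigma> e) (chart_map (warped_chart I e) z) v w"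
proof -
  have z': "z \<in> chart_dom (I, \<lambda>t. t) \<times> chart_dom e"
    using z by simp
  note d = differential_fst_snd[OF smooth_manifold_interval[OF I] interval_chart P z']
  have "chart_inv e (chart_map e (snd z)) = snd z" "fst z \<in> I"
    using chart_inv_chart_map[OF P] z by auto
  moreover have "chart_map (warped_chart I e) z = (fst z, chart_map e (snd z))"
    by (simp add: prod_chart_def map_prod_def split_beta)
  ultimately show ?thesis
    by (simp add: doubly_warped_metric_def pullback_metric_def d dt_squared_def
        coord_tangent_interval_ident[OF I] warped_form_def metric_coeff_def)
qed

text \<open>\<open>time_vector\<close> is defined by a partial derivative and not through a chart,
  so its images under the two projections are computed directly: the unit vector and the zero
  vector. The formula shows that a future-pointing normal has positive time component.\<close>

lemma doubly_warped_metric_time_vector: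
  fixes P :: "('p::topological_space, 'e::euclidean_space) atlas"
  assumes I: "open I" and P: "smooth_manifold P" "e \<in> P" and z: "z \<in> I \<times> chart_dom e"
    and \<sigma>: "riemannian_metric P \<sigma>"
  shows "doubly_warped_metric I P h \<rho> \<sigma> z
      (coord_tangent (prod_manifold (interval_manifold I) P) (warped_chart I e) z v) (time_vector I P z) =
    - (h (snd z))\<^sup>2 * fst v"
proof -
  let ?N = "prod_manifold (interval_manifold I) P"
  have z': "z \<in> chart_dom (I, \<lambda>t. t) \<times> chart_dom e" and zI: "fst z \<in> I" "snd z \<in> chart_dom e"
    using z by auto
  have zN: "z \<in> points ?N"
    using z chart_dom_subset_points[OF P(2)] by (auto simp: points_prod_manifold points_interval_manifold)
  note MN = smooth_manifold_interval[OF I]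
  note NN = smooth_manifold_prod[OF MN P(1)]
  note d = differential_fst_snd[OF MN interval_chart P z']
  \<comment> \<open>Smoothness of the identity is recovered from this value: the default would have
    been 0.\<close>
  have "coord_tangent (interval_manifold I) (I, \<lambda>t. t) (fst z) 1 (\<lambda>s. s) = 1"
    by (rule coord_tangent_interval_ident[OF I zI(1)])
  then have near: "smooth_near (interval_manifold I) (fst z) (\<lambda>s. s)"
    by (auto simp: coord_tangent_def split: if_splits)
  have "smooth_near ?N z ((\<lambda>s. s) \<circ> fst)"
    by (rule smooth_near_compose[OF NN MN smooth_map_fst_snd(1)[OF MN P(1)] zN near])
  then have t: "differential (interval_manifold I) fst z (time_vector I P z) (\<lambda>s. s) = 1"
    using near by (simp add: differential_def time_vector_def)
  have "differential P snd z (time_vector I P z) f = coord_tangent P e (snd z) 0 f" for f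
  proof (cases "smooth_near P (snd z) f")
    case True
    then obtain U where U: "openin (top_of_set (points P)) U" "snd z \<in> U" "smooth_fun_on P U f"
      by (auto simp: smooth_near_def)
    then have "((f \<circ> chart_inv e) has_derivative frechet_derivative (f \<circ> chart_inv e) (at (chart_map e (snd z))))
        (at (chart_map e (snd z)))"
      using zI P(2) by (intro smooth_on_derivative[of "chart_map e ` (chart_dom e \<inter> U)"])
        (simp_all add: smooth_fun_on_def)
    then have "frechet_derivative (f \<circ> chart_inv e) (at (chart_map e (snd z))) 0 = 0"
      using has_derivative_linear linear_0 by blast
    moreover have "smooth_near ?N z (f \<circ> snd)"
      by (rule smooth_near_compose[OF NN P(1) smooth_map_fst_snd(2)[OF MN P(1)] zN True])
    ultimately show ?thesis
      using True by (simp add: differential_def coord_tangent_def time_vector_def)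
  qed (simp add: differential_def coord_tangent_def)
  then have s: "differential P snd z (time_vector I P z) = coord_tangent P e (snd z) 0" ..
  have ch: "chart_inv e (chart_map e (snd z)) = snd z"
    using chart_inv_chart_map[OF P] zI by simp
  have "bilinear (metric_coeff P \<sigma> e (chart_map e (snd z)))"
    using \<sigma> P(2) zI by (simp add: riemannian_metric_def)
  then have "\<sigma> (snd z) (coord_tangent P e (snd z) (snd v)) (coord_tangent P e (snd z) 0) = 0"
    using bilinear_rzero[of "metric_coeff P \<sigma> e (chart_map e (snd z))" "snd v"] ch
    by (simp add: metric_coeff_def)
  then show ?thesis
    using zI(1) by (simp add: doubly_warped_metric_def pullback_metric_def d s t dt_squared_def
        coord_tangent_interval_ident[OF I])
qed

theorem theorem6:
  fixes I :: "real set" and \<rho> :: "real \<Rightarrow> real"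
    and P :: "('p::{t2_space, second_countable_topology}, 'e::euclidean_space) atlas"
    and \<sigma> :: "'p metric_field" and h :: "'p \<Rightarrow> real"
    and M :: "('a::{t2_space, second_countable_topology}, 'e) atlas"
    and \<psi> :: "'a \<Rightarrow> real \<times> 'p" and \<nu> :: "'a \<Rightarrow> (real \<times> 'p) tangent" and H :: "'a \<Rightarrow> real"
  defines "Mbar \<equiv> prod_manifold (interval_manifold I) P"
    and "gbar \<equiv> doubly_warped_metric I P h \<rho> \<sigma>"
  assumes "smooth_manifold P" and "connected (points P)" and "riemannian_metric P \<sigma>"
    and "open I" and "is_interval I"
    and "smooth_fun_on P (points P) h" and "\<And>x. x \<in> points P \<Longrightarrow> h x > 0"
    and "smooth_on I \<rho>" and "\<And>t. t \<in> I \<Longrightarrow> \<rho> t > 0"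
    and "\<And>t. t \<in> I \<Longrightarrow> deriv \<rho> t \<ge> 0"
    and "spacelike_hypersurface M Mbar gbar \<psi>"
    and "connected (points M)" and "points M \<noteq> {}" and "compact (points M)"
    and "future_unit_normal M Mbar gbar (time_vector I P) \<psi> \<nu>"
    and "mean_curvature_function M Mbar gbar \<psi> \<nu> H"
    and "\<And>p t x. p \<in> points M \<Longrightarrow> \<psi> p = (t, x) \<Longrightarrow> H p \<ge> deriv \<rho> t / (h x * \<rho> t)"
  shows "\<exists>t0\<in>I. \<psi> ` points M = {t0} \<times> points P"
proof -
  note P = assms(3) and connP = assms(4) and \<sigma> = assms(5) and I = assms(6) and h = assms(8,9) and \<rho> = assms(10,11)
    and hyp = assms(13) and connM = assms(14,15) and compM = assms(16) and \<nu> = assms(17) and H = assms(18,19)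
  have M: "smooth_manifold M" and \<psi>: "smooth_map M Mbar \<psi>"
    and g: "riemannian_metric M (pullback_metric Mbar \<psi> gbar)"
    using hyp by (auto simp: spacelike_hypersurface_def immersion_def)
  have Mbar: "smooth_manifold Mbar"
    unfolding Mbar_def by (intro smooth_manifold_prod smooth_manifold_interval I P)
  have pts: "points Mbar = I \<times> points P"
    by (simp add: Mbar_def points_prod_manifold points_interval_manifold)
  have \<psi>_pts: "\<psi> p \<in> I \<times> points P" if "p \<in> points M" for p
    using \<psi> that pts by (auto simp: smooth_map_def)
  have cont\<psi>: "continuous_on (points M) \<psi>"
    using \<psi> by (simp add: smooth_map_def)
  have d: "warped_chart I e \<in> Mbar" "chart_dom (warped_chart I e) = I \<times> chart_dom e"
    "\<And>z. chart_map (warped_chart I e) z = (fst z, chart_map e (snd z))" if "e \<in> P" for e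
  proof -
    show "warped_chart I e \<in> Mbar"
      unfolding Mbar_def prod_manifold_eq using that interval_chart by blast
  qed (simp_all add: prod_chart_def map_prod_def split_beta)

  \<comment> \<open>The hypersurface and the metrics in charts\<close>
  define F where "F c e = local_rep c (warped_chart I e) \<psi>" for c :: "('a, 'e) chart" and e :: "('p, 'e) chart"
  define U where "U c e = chart_map c ` (chart_dom c \<inter> \<psi> -` (I \<times> chart_dom e))" for c :: "('a, 'e) chart" and e :: "('p, 'e) chart"
  define V where "V e = chart_map e ` chart_dom e" for e :: "('p, 'e) chart"
  define W where "W e = warped_form (h \<circ> chart_inv e) \<rho> (metric_coeff P \<sigma> e)" for e :: "('p, 'e) chart"
  define G where "G c = metric_coeff M (pullback_metric Mbar \<psi> gbar) c" for c :: "('a, 'e) chart"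
  define DF where "DF c e y = frechet_derivative (F c e) (at y)" for c :: "('a, 'e) chart" and e :: "('p, 'e) chart" and y

  have U: "open (U c e)" and F: "smooth_on (U c e) (F c e)" if "c \<in> M" "e \<in> P" for c e
  proof -
    have "smooth_on (chart_map c ` (chart_dom c \<inter> \<psi> -` chart_dom (warped_chart I e)))
        (local_rep c (warped_chart I e) \<psi>)"
      using \<psi> that(1) d(1)[OF that(2)] unfolding smooth_map_def by blast
    then show "open (U c e)" "smooth_on (U c e) (F c e)"
      using open_local_rep_domain[OF M that(1) Mbar d(1)[OF that(2)] \<psi>]
      unfolding U_def F_def d(2)[OF that(2)] by blast+
  qed
  have q: "chart_inv c y \<in> chart_dom c" "\<psi> (chart_inv c y) \<in> I \<times> chart_dom e" "chart_map c (chart_inv c y) = y"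
    "F c e y = (fst (\<psi> (chart_inv c y)), chart_map e (snd (\<psi> (chart_inv c y))))" "chart_inv c y \<in> points M"
    "y \<in> chart_map c ` chart_dom c"
    if "c \<in> M" "e \<in> P" "y \<in> U c e" for c e y
    using that chart_inv_chart_map[OF M that(1)] chart_dom_subset_points[OF that(1)] d(3)[OF that(2)]
    by (auto simp: U_def F_def local_rep_def)
  have FV: "F c e ` U c e \<subseteq> I \<times> V e" if "c \<in> M" "e \<in> P" for c e
    using q[OF that] by (force simp: V_def)
  have gW: "gbar z (coord_tangent Mbar (warped_chart I e) z v) (coord_tangent Mbar (warped_chart I e) z w) =
      W e (chart_map (warped_chart I e) z) v w" if "e \<in> P" "z \<in> I \<times> chart_dom e" for e z v w
    unfolding gbar_def Mbar_def W_def by (rule doubly_warped_metric_coord_tangent[OF I P that])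
  have d\<psi>: "differential Mbar \<psi> (chart_inv c y) (coord_tangent M c (chart_inv c y) v) =
      coord_tangent Mbar (warped_chart I e) (\<psi> (chart_inv c y)) (DF c e y v)"
    if "c \<in> M" "e \<in> P" "y \<in> U c e" for c e y v
    using differential_coord_tangent[OF M Mbar \<psi> that(1) q(1)[OF that] d(1)[OF that(2)]] q[OF that] d(2)[OF that(2)]
    by (simp add: DF_def F_def)
  have G: "G c y v w = W e (F c e y) (DF c e y v) (DF c e y w)" if "c \<in> M" "e \<in> P" "y \<in> U c e" for c e y v w
    using q[OF that] d(3)[OF that(2)]
    by (simp add: G_def metric_coeff_def pullback_metric_def d\<psi>[OF that] gW[OF that(2)])
  have G_riem: "bilinear (G c y)" "G c y v w = G c y w v" "v \<noteq> 0 \<Longrightarrow> G c y v v > 0"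
    if "c \<in> M" "y \<in> chart_map c ` chart_dom c" for c y v w
    using g that by (auto simp: riemannian_metric_def G_def)
  have G_smooth: "smooth_on (U c e) (\<lambda>y. G c y v w)" if "c \<in> M" for c e v w
  proof (rule smooth_on_subset)
    show "smooth_on (chart_map c ` chart_dom c) (\<lambda>y. G c y v w)"
      using g that by (simp add: riemannian_metric_def G_def)
  qed (auto simp: U_def)
  have V: "open (V e)" "smooth_on (V e) (h \<circ> chart_inv e)" "\<And>x. x \<in> V e \<Longrightarrow> (h \<circ> chart_inv e) x > 0"
    if e: "e \<in> P" for e
  proof -
    show "open (V e)"
      unfolding V_def by (rule smooth_manifold_open_image[OF P e])
    have "chart_dom e \<inter> points P = chart_dom e"
      using chart_dom_subset_points[OF e] by blast
    then show "smooth_on (V e) (h \<circ> chart_inv e)"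
      using h(1) e unfolding smooth_fun_on_def V_def by metis
    show "(h \<circ> chart_inv e) x > 0" if "x \<in> V e" for x
      using that h(2) chart_inv_chart_map[OF P e] chart_dom_subset_points[OF e] by (auto simp: V_def)
  qed
  have S: "bilinear (metric_coeff P \<sigma> e x)" "metric_coeff P \<sigma> e x v w = metric_coeff P \<sigma> e x w v"
    "v \<noteq> 0 \<Longrightarrow> metric_coeff P \<sigma> e x v v > 0" if "e \<in> P" "x \<in> V e" for e x v w
    using \<sigma> that by (auto simp: riemannian_metric_def V_def)
  have S_smooth: "smooth_on (V e) (\<lambda>x. metric_coeff P \<sigma> e x v w)" if "e \<in> P" for e v w
    using \<sigma> that by (auto simp: riemannian_metric_def V_def)

  \<comment> \<open>The mean curvature inequality in charts\<close>
  have normal: "\<exists>n. (\<forall>v. W e (F c e y) n (DF c e y v) = 0) \<and> W e (F c e y) n n = -1 \<and> fst n > 0 \<and>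
      DIM('e) * deriv \<rho> (fst (F c e y)) / ((h \<circ> chart_inv e) (snd (F c e y)) * \<rho> (fst (F c e y))) \<le>
      - W e (F c e y) (\<Sum>b\<in>(SOME E. orthonormal_basis (G c y) E).
          frechet_derivative (\<lambda>z. DF c e z b) (at y) b + levi_civita_form (W e) (F c e y) (DF c e y b) (DF c e y b)) n"
    if c: "c \<in> M" and e: "e \<in> P" and y: "y \<in> U c e" for c e y
  proof -
    note q = q[OF c e y]
    let ?p = "chart_inv c y" and ?d = "warped_chart I e"
    have Fy: "chart_map ?d (\<psi> ?p) = F c e y"
      using d(3)[OF e] q(4) by simp
    have FI: "fst (F c e y) \<in> I" "snd (F c e y) \<in> V e"
      using FV[OF c e] y by (auto simp: image_subset_iff mem_Times_iff)
    have n_tangent: "\<nu> ?p \<in> tangent_space Mbar (\<psi> ?p)"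
      and n_normal: "\<And>X. X \<in> tangent_space M ?p \<Longrightarrow> gbar (\<psi> ?p) (\<nu> ?p) (differential Mbar \<psi> ?p X) = 0"
      and n_unit: "gbar (\<psi> ?p) (\<nu> ?p) (\<nu> ?p) = -1"
      and n_future: "gbar (\<psi> ?p) (\<nu> ?p) (time_vector I P (\<psi> ?p)) < 0"
      using \<nu> q(5) unfolding future_unit_normal_def by blast+
    obtain d' v where dv: "d' \<in> Mbar" "\<psi> ?p \<in> chart_dom d'" "\<nu> ?p = coord_tangent Mbar d' (\<psi> ?p) v"
      using n_tangent unfolding tangent_space_def by blast
    have \<psi>d: "\<psi> ?p \<in> chart_dom ?d"
      using q(2) d(2)[OF e] by simp
    \<comment> \<open>The chart in which the normal is given as a tangent vector need not be the
      product chart in use.\<close>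
    obtain n where n: "\<nu> ?p = coord_tangent Mbar ?d (\<psi> ?p) n"
      using coord_tangent_change_chart[OF Mbar dv(1,2) d(1)[OF e] \<psi>d] dv(3) by metis
    have W_normal: "W e (F c e y) n (DF c e y v) = 0" for v
    proof -
      have "coord_tangent M c ?p v \<in> tangent_space M ?p"
        unfolding tangent_space_def using c q(1) by blast
      from n_normal[OF this] show ?thesis
        by (simp add: d\<psi>[OF c e y] n gW[OF e q(2)] Fy)
    qed
    have W_unit: "W e (F c e y) n n = -1"
      using n_unit by (simp add: n gW[OF e q(2)] Fy)
    have "- (h (snd (\<psi> ?p)))\<^sup>2 * fst n < 0"
      using n_future doubly_warped_metric_time_vector[OF I P e q(2) \<sigma>, of h \<rho> n]
      by (simp add: n gbar_def Mbar_def)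
    then have n_pos: "fst n > 0"
      by (smt (verit) mult_nonneg_nonpos zero_le_power2 mult_minus_left)
    have W_sym: "W e (F c e y) a b = W e (F c e y) b a" for a b
      using S(2)[OF e FI(2), of "snd a" "snd b"] by (simp add: W_def warped_form_def mult.commute)
    have W_lin: "linear (\<lambda>a. W e (F c e y) a n)"
      using bilinear_warped_form[of "metric_coeff P \<sigma> e" "F c e y" "h \<circ> chart_inv e" \<rho>, OF S(1)[OF e FI(2)]]
      unfolding W_def bilinear_def by blast
    define II where "II = second_fundamental_form M Mbar gbar \<psi> c ?d ?p"
    define E where "E = (SOME E. orthonormal_basis (G c y) E)"
    define B where "B b = frechet_derivative (\<lambda>z. DF c e z b) (at y) b +
        levi_civita_form (W e) (F c e y) (DF c e y b) (DF c e y b)" for b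
    have inv_d: "chart_inv ?d z \<in> I \<times> chart_dom e" "chart_map ?d (chart_inv ?d z) = z" if "z \<in> I \<times> V e" for z
    proof -
      obtain x where x: "x \<in> chart_dom ?d" "z = chart_map ?d x"
      proof -
        obtain x where "x \<in> chart_dom e" "snd z = chart_map e x"
          using \<open>z \<in> I \<times> V e\<close> by (auto simp: V_def)
        then show ?thesis
          using that[of "(fst z, x)"] \<open>z \<in> I \<times> V e\<close> d(2,3)[OF e] by auto
      qed
      then show "chart_inv ?d z \<in> I \<times> chart_dom e" "chart_map ?d (chart_inv ?d z) = z"
        using chart_inv_chart_map[OF Mbar d(1)[OF e] x(1)] d(2)[OF e] by auto
    qed
    have LC: "levi_civita_form (metric_coeff Mbar gbar ?d) (F c e y) = levi_civita_form (W e) (F c e y)"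
    proof (rule levi_civita_form_cong)
      show "open (I \<times> V e)"
        using I V(1)[OF e] by (rule open_Times)
      show "F c e y \<in> I \<times> V e"
        using FI by (simp add: mem_Times_iff)
      show "metric_coeff Mbar gbar ?d z v w = W e z v w" if "z \<in> I \<times> V e" for z v w
        unfolding metric_coeff_def using gW[OF e inv_d(1)[OF that]] inv_d(2)[OF that] by simp
    qed
    \<comment> \<open>The vector \<open>a\<close> is the connection term of the induced metric. Its
      image under \<open>DF\<close> is tangential, so pairing with the normal removes it whatever
      its value.\<close>
    have "\<exists>a. II b b = B b - DF c e y a" for b
      unfolding II_def second_fundamental_form_def Let_def B_def F_def[symmetric] DF_def[symmetric] q(3) LC by blast
    then have WII: "W e (F c e y) (II b b) n = W e (F c e y) (B b) n" for b
      using W_normal W_sym by (metis linear_diff[OF W_lin] diff_zero)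
    have "H ?p = - gbar (\<psi> ?p) (mean_curvature_vector M Mbar gbar \<psi> c ?d ?p) (\<nu> ?p)"
      using H(1) q(1,5) c d(1)[OF e] \<psi>d unfolding mean_curvature_function_def by blast
    also have "\<dots> = - W e (F c e y) ((1 / DIM('e)) *\<^sub>R (\<Sum>b\<in>E. II b b)) n"
      by (simp add: mean_curvature_vector_def metric_trace_def n gW[OF e q(2)] Fy q(3) II_def[symmetric]
          G_def[symmetric] E_def[symmetric])
    also have "\<dots> = - (1 / DIM('e)) * (\<Sum>b\<in>E. W e (F c e y) (II b b) n)"
      by (simp add: linear_scale[OF W_lin] linear_sum[OF W_lin])
    also have "\<dots> = - (1 / DIM('e)) * W e (F c e y) (\<Sum>b\<in>E. B b) n"
      by (simp add: WII linear_sum[OF W_lin])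
    finally have "DIM('e) * H ?p = - W e (F c e y) (\<Sum>b\<in>E. B b) n"
      by simp
    moreover have "deriv \<rho> (fst (F c e y)) / ((h \<circ> chart_inv e) (snd (F c e y)) * \<rho> (fst (F c e y))) \<le> H ?p"
    proof -
      have "chart_inv e (chart_map e (snd (\<psi> ?p))) = snd (\<psi> ?p)"
        using chart_inv_chart_map[OF P e] q(2) by auto
      then show ?thesis
        using H(2)[OF q(5), of "fst (\<psi> ?p)" "snd (\<psi> ?p)"] by (simp add: q(4))
    qed
    then have "DIM('e) * (deriv \<rho> (fst (F c e y)) / ((h \<circ> chart_inv e) (snd (F c e y)) * \<rho> (fst (F c e y)))) \<le> DIM('e) * H ?p"
      by (intro mult_left_mono) auto
    ultimately show ?thesis
      using W_normal W_unit n_pos by (intro exI[of _ n]) (simp add: B_def E_def)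
  qed

  \<comment> \<open>The time coordinate is constant\<close>
  define \<tau> where "\<tau> p = fst (\<psi> p)" for p
  have \<tau>_cont: "continuous_on (points M) \<tau>"
    unfolding \<tau>_def by (intro continuous_on_fst cont\<psi>)
  obtain p0 where p0: "p0 \<in> points M" "\<And>p. p \<in> points M \<Longrightarrow> \<tau> p \<le> \<tau> p0"
    using continuous_attains_sup[OF compM connM(2) \<tau>_cont] by blast
  define A where "A = {p \<in> points M. \<tau> p = \<tau> p0}"
  have charts: "\<exists>c\<in>M. \<exists>e\<in>P. p \<in> chart_dom c \<and> chart_map c p \<in> U c e \<and> chart_inv c (chart_map c p) = p"
    if pM: "p \<in> points M" for p
  proof -
    obtain c where c: "c \<in> M" "p \<in> chart_dom c"
      using pM unfolding points_def by blast
    moreover obtain e where "e \<in> P" "snd (\<psi> p) \<in> chart_dom e"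
      using \<psi>_pts[OF pM] by (auto simp: points_def mem_Times_iff simp del: split_paired_Ex)
    ultimately show ?thesis
      using \<psi>_pts[OF pM] chart_inv_chart_map[OF M c] unfolding U_def
      by (intro bexI[of _ c] bexI[of _ e]) (auto simp: mem_Times_iff)
  qed
  have "\<exists>T. openin (top_of_set (points M)) T \<and> p \<in> T \<and> T \<subseteq> A" if p: "p \<in> A" for p
  proof -
    have pM: "p \<in> points M" "\<tau> p = \<tau> p0"
      using p by (auto simp: A_def)
    obtain c e where c: "c \<in> M" and e: "e \<in> P" and y0: "chart_map c p \<in> U c e" "chart_inv c (chart_map c p) = p"
      using charts[OF pM(1)] by blast
    let ?y0 = "chart_map c p"
    have \<tau>F: "\<tau> (chart_inv c y) = fst (F c e y)" if "y \<in> U c e" for y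
      using q(4)[OF c e that] by (simp add: \<tau>_def)
    let ?D2 = "\<lambda>y v w. frechet_derivative (\<lambda>z. DF c e z w) (at y) v"
    obtain r C where r: "r > 0" "C > 0" "ball ?y0 r \<subseteq> U c e" and ell:
      "\<And>y E n N. y \<in> ball ?y0 r \<Longrightarrow> orthonormal_basis (G c y) E \<Longrightarrow>
        (\<And>v. W e (F c e y) n (DF c e y v) = 0) \<Longrightarrow> W e (F c e y) n n = -1 \<Longrightarrow> fst n > 0 \<Longrightarrow>
        DIM('e) * deriv \<rho> (fst (F c e y)) / ((h \<circ> chart_inv e) (snd (F c e y)) * \<rho> (fst (F c e y))) \<le>
          - W e (F c e y) (\<Sum>b\<in>E. ?D2 y b b + levi_civita_form (W e) (F c e y) (DF c e y b) (DF c e y b)) n \<Longrightarrow>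
        0 \<le> N \<Longrightarrow> (\<And>v. \<bar>fst (DF c e y v)\<bar> \<le> N * norm v) \<Longrightarrow>
        (\<forall>w. (norm w)\<^sup>2 \<le> C * (\<Sum>b\<in>E. (b \<bullet> w)\<^sup>2)) \<and> (\<Sum>b\<in>E. (norm b)\<^sup>2) \<le> C \<and>
        (\<Sum>b\<in>E. fst (?D2 y b b)) \<ge> - (C * N)"
    proof -
      have "G c y v w = warped_form (h \<circ> chart_inv e) \<rho> (metric_coeff P \<sigma> e) (F c e y)
          (frechet_derivative (F c e) (at y) v) (frechet_derivative (F c e) (at y) w)" if "y \<in> U c e" for y v w
        using G[OF c e that] by (simp add: W_def DF_def)
      from warped_graph_elliptic_inequality[OF I \<rho> V(1)[OF e] V(2)[OF e] V(3)[OF e] S(1)[OF e] S(2)[OF e]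
          S(3)[OF e] S_smooth[OF e] U[OF c e] F[OF c e] FV[OF c e] this G_smooth[OF c] G_riem(3)[OF c q(6)[OF c e]] y0(1)]
      show ?thesis
        using that unfolding W_def DF_def by blast
    qed
    have dF: "(F c e has_derivative DF c e y) (at y)" if "y \<in> U c e" for y
      unfolding DF_def by (rule smooth_on_derivative[OF F[OF c e] that])
    have d2F: "((\<lambda>z. DF c e z v) has_derivative (\<lambda>w. ?D2 y w v)) (at y)" if "y \<in> U c e" for y v
      unfolding DF_def by (rule smooth_on_derivative[OF smooth_on_frechet_derivative[OF F[OF c e]] that])
    have "\<exists>r'>0. ball ?y0 r' \<subseteq> ball ?y0 r \<and> (\<forall>y\<in>ball ?y0 r'. fst (F c e y) = fst (F c e ?y0))"
    proof (rule strong_maximum_principle[where Du = "\<lambda>y v. fst (DF c e y v)" and D2u = "\<lambda>y v w. fst (?D2 y w v)"])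
      show "open (ball ?y0 r)" "?y0 \<in> ball ?y0 r" "C > 0"
        using r by auto
      fix y assume "y \<in> ball ?y0 r"
      then have y: "y \<in> U c e" and yb: "y \<in> ball ?y0 r"
        using r by auto
      show "fst (F c e y) \<le> fst (F c e ?y0)"
        using p0(2)[OF q(5)[OF c e y]] \<tau>F[OF y] \<tau>F[OF y0(1)] pM(2) y0(2) by simp
      show "((\<lambda>y. fst (F c e y)) has_derivative (\<lambda>v. fst (DF c e y v))) (at y)"
        by (rule has_derivative_fst[OF dF[OF y]])
      show "((\<lambda>z. fst (DF c e z v)) has_derivative (\<lambda>w. fst (?D2 y w v))) (at y)" for v
        by (rule has_derivative_fst[OF d2F[OF y]])
      fix N :: real assume N: "0 \<le> N" "\<And>v. \<bar>fst (DF c e y v)\<bar> \<le> N * norm v"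
      \<comment> \<open>\<open>normal\<close> speaks of the basis that \<open>metric_trace\<close>
        picks by \<open>SOME\<close>; existence makes this choice an orthonormal basis, and
        \<open>ell\<close> is applied to it.\<close>
      have "\<exists>E. orthonormal_basis (G c y) E"
        by (rule orthonormal_basis_exists) (use G_riem[OF c q(6)[OF c e y]] in auto)
      then have on: "orthonormal_basis (G c y) (SOME E. orthonormal_basis (G c y) E)"
        by (rule someI_ex)
      obtain n where n: "\<And>v. W e (F c e y) n (DF c e y v) = 0" "W e (F c e y) n n = -1" "fst n > 0"
        "DIM('e) * deriv \<rho> (fst (F c e y)) / ((h \<circ> chart_inv e) (snd (F c e y)) * \<rho> (fst (F c e y))) \<le>
          - W e (F c e y) (\<Sum>b\<in>(SOME E. orthonormal_basis (G c y) E).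
            ?D2 y b b + levi_civita_form (W e) (F c e y) (DF c e y b) (DF c e y b)) n"
        using normal[OF c e y] by blast
      show "\<exists>E. (\<forall>w. (norm w)\<^sup>2 \<le> C * (\<Sum>b\<in>E. (b \<bullet> w)\<^sup>2)) \<and> (\<Sum>b\<in>E. (norm b)\<^sup>2) \<le> C \<and>
          - (C * N) \<le> (\<Sum>b\<in>E. fst (?D2 y b b))"
        using ell[OF yb on n N] by blast
    qed
    then obtain r' where r': "r' > 0" "ball ?y0 r' \<subseteq> ball ?y0 r"
      "\<And>y. y \<in> ball ?y0 r' \<Longrightarrow> fst (F c e y) = fst (F c e ?y0)"
      by blast
    have bU: "ball ?y0 r' \<subseteq> U c e"
      using r' r by blast
    show ?thesis
    proof (intro exI conjI)
      show "openin (top_of_set (points M)) (chart_inv c ` ball ?y0 r')"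
        using bU q(6)[OF c e] by (intro openin_chart_inv_image[OF M c]) auto
      show "p \<in> chart_inv c ` ball ?y0 r'"
        using y0(2) r'(1) by (intro image_eqI[of _ _ ?y0]) auto
      show "chart_inv c ` ball ?y0 r' \<subseteq> A"
      proof
        fix x assume "x \<in> chart_inv c ` ball ?y0 r'"
        then obtain y where y: "x = chart_inv c y" "y \<in> ball ?y0 r'"
          by blast
        then have yU: "y \<in> U c e"
          using bU by blast
        show "x \<in> A"
          using q(5)[OF c e yU] \<tau>F[OF yU] \<tau>F[OF y0(1)] r'(3)[OF y(2)] y0(2) pM(2) by (simp add: A_def y(1))
      qed
    qed
  qed
  then have "openin (top_of_set (points M)) A"
    by (subst openin_subopen) blast
  moreover have "closedin (top_of_set (points M)) A"
    unfolding A_def by (rule continuous_closedin_preimage_constant[OF \<tau>_cont])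
  moreover have "A \<noteq> {}"
    using p0 by (auto simp: A_def)
  ultimately have A: "A = points M"
    using connM(1) connected_clopen by blast

  \<comment> \<open>The projection to the second factor is onto\<close>
  define \<pi> where "\<pi> p = snd (\<psi> p)" for p
  have \<psi>_eq: "\<psi> p = (\<tau> p0, \<pi> p)" if "p \<in> points M" for p
    using that A by (auto simp: A_def \<tau>_def \<pi>_def prod_eq_iff)
  have "\<exists>T. openin (top_of_set (points P)) T \<and> x \<in> T \<and> T \<subseteq> \<pi> ` points M" if x: "x \<in> \<pi> ` points M" for x
  proof -
    obtain p where p: "p \<in> points M" "x = \<pi> p"
      using x by blast
    obtain c e where c: "c \<in> M" and e: "e \<in> P" and y0: "chart_map c p \<in> U c e" "chart_inv c (chart_map c p) = p"
      using charts[OF p(1)] by blast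
    let ?y0 = "chart_map c p" and ?f = "\<lambda>y. snd (F c e y)"
    note FI = FV[OF c e]
    have V0: "snd (F c e ?y0) \<in> V e"
      using FI y0 by (auto simp: image_subset_iff mem_Times_iff)
    have df: "(?f has_derivative (\<lambda>v. snd (DF c e ?y0 v))) (at ?y0)"
      unfolding DF_def by (rule has_derivative_snd[OF smooth_on_derivative[OF F[OF c e] y0(1)]])
    have lin: "linear (\<lambda>v. snd (DF c e ?y0 v))"
      using df by (rule has_derivative_linear)
    \<comment> \<open>A vector in the kernel has an image with time component only, on which the
      warped form is nonpositive, against positivity of the induced metric.\<close>
    have "v = 0" if v: "snd (DF c e ?y0 v) = 0" for v
    proof (rule ccontr)
      assume "v \<noteq> 0"
      then have "0 < W e (F c e ?y0) (DF c e ?y0 v) (DF c e ?y0 v)"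
        using G_riem(3)[OF c q(6)[OF c e y0(1)]] G[OF c e y0(1)] by metis
      then show False
        using bilinear_lzero[OF S(1)[OF e V0]] zero_le_square[of "fst (DF c e ?y0 v)"]
        by (simp add: W_def warped_form_def v mult_less_0_iff zero_less_mult_iff)
    qed
    then have "inj (\<lambda>v. snd (DF c e ?y0 v))"
      unfolding linear_injective_0[OF lin] by blast
    then have "surj (\<lambda>v. snd (DF c e ?y0 v))"
      using linear_injective_imp_surjective[OF lin] by blast
    then obtain g' where g': "linear g'" "(\<lambda>v. snd (DF c e ?y0 v)) \<circ> g' = id"
      using linear_surjective_right_inverse[OF lin] by blast
    have contf: "continuous_on (U c e) ?f"
      by (intro continuous_on_snd smooth_on_imp_continuous_on F c e)
    \<comment> \<open>A right inverse of the derivative at the single point \<open>?y0\<close>,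
      together with continuity of the map, already makes the image point interior.\<close>
    have int: "?f ?y0 \<in> interior (?f ` U c e)"
    proof (rule sussmann_open_mapping[OF U[OF c e] contf y0(1) df _ g'(2) order_refl])
      show "bounded_linear g'"
        using g'(1) by (rule linear_conv_bounded_linear[THEN iffD1])
      show "?y0 \<in> interior (U c e)"
        using y0(1) interior_open[OF U[OF c e]] by simp
    qed
    have fV: "interior (?f ` U c e) \<subseteq> chart_map e ` chart_dom e"
      using FI interior_subset[of "?f ` U c e"] unfolding V_def by (force simp: image_subset_iff mem_Times_iff)
    have inv_f: "chart_inv e (?f y) = \<pi> (chart_inv c y)" if "y \<in> U c e" for y
      using q(2,4)[OF c e that] chart_inv_chart_map[OF P e] by (auto simp: \<pi>_def mem_Times_iff)
    show ?thesis
    proof (intro exI conjI)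
      show "openin (top_of_set (points P)) (chart_inv e ` interior (?f ` U c e))"
        by (rule openin_chart_inv_image[OF P e open_interior fV])
      show "x \<in> chart_inv e ` interior (?f ` U c e)"
        using int inv_f[OF y0(1)] y0(2) p(2) by (intro image_eqI[of _ _ "?f ?y0"]) auto
      show "chart_inv e ` interior (?f ` U c e) \<subseteq> \<pi> ` points M"
      proof
        fix a assume "a \<in> chart_inv e ` interior (?f ` U c e)"
        then obtain y where "y \<in> U c e" "a = chart_inv e (?f y)"
          using interior_subset[of "?f ` U c e"] by blast
        then show "a \<in> \<pi> ` points M"
          using inv_f q(5)[OF c e] by auto
      qed
    qed
  qed
  then have "openin (top_of_set (points P)) (\<pi> ` points M)"
    by (subst openin_subopen) blast
  moreover have "closedin (top_of_set (points P)) (\<pi> ` points M)"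
  proof (rule closed_subset)
    show "\<pi> ` points M \<subseteq> points P"
      using \<psi>_pts by (auto simp: \<pi>_def mem_Times_iff)
    have "continuous_on (points M) \<pi>"
      unfolding \<pi>_def by (intro continuous_on_snd cont\<psi>)
    then show "closed (\<pi> ` points M)"
      using compM by (intro compact_imp_closed compact_continuous_image)
  qed
  moreover have "\<pi> ` points M \<noteq> {}"
    using connM by blast
  ultimately have "\<pi> ` points M = points P"
    using connP connected_clopen by blast
  moreover have "\<psi> ` points M = {\<tau> p0} \<times> \<pi> ` points M"
    using \<psi>_eq by (auto simp: image_iff)
  moreover have "\<tau> p0 \<in> I"
    using \<psi>_pts[OF p0(1)] by (auto simp: \<tau>_def mem_Times_iff)
  ultimately show ?thesis by auto
qed

end
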